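(* Let $\mu\ge 0$, $n\ge 0$ and $0\le k\le n$ be given ($n,k$ integers), and let $\xi_\nu=\frac{\nu\pi}{n+1}$ for $0\le\nu\le 2n+1$. Then for every $f\in L^2(W_\mu;B^2)$ and $(x,y)\in B^2$, $$\operatorname{proj}_k^\mu f(x,y)=\frac{1}{n+1}\sum_{\nu=0}^{n}a_\mu\int_{-1}^1\mathcal R_{\xi_\nu}^\mu(f;t)\,D_k^{\mu+1/2}(\xi_\nu,t;x,y)\,dt$$ $$\phantom{\operatorname{proj}_k^\mu f(x,y)}=\frac{1}{2n+2}\sum_{\nu=0}^{2n+1}a_\mu\int_{-1}^1\mathcal R_{\xi_\nu}^\mu(f;t)\,D_k^{\mu+1/2}(\xi_\nu,t;x,y)\,dt .$$
   Context: $B^2$ is the closed unit disk in $\mathbb R^2$; $W_\mu(x,y)=(1-x^2-y^2)^{\mu-1/2}$ on $B^2$; $a_\mu=(\mu+1/2)/\pi=1/\int_{B^2}W_\mu$; $\langle P,Q\rangle_\mu=a_\mu\int_{B^2}PQW_\mu\,dx\,dy$. $\mathcal V_k^2(W_\mu)$ is the space of polynomials in two variables of degree $k$ (together with $0$) that are orthogonal under $\langle\cdot,\cdot\rangle_\mu$ to all polynomials of total degree $<k$, and $\operatorname{proj}_k^\mu$ is the orthogonal projection of $L^2(W_\mu;B^2)$ onto $\mathcal V_k^2(W_\mu)$ (identified with its polynomial representative). Attenuated Radon projection: $$\mathcal R_\theta^\mu(f;t)=\int_{-\sqrt{1-t^2}}^{\sqrt{1-t^2}}f(t\cos\theta-s\sin\theta,\,t\sin\theta+s\cos\theta)\,(1-s^2-t^2)^{\mu-1/2}\,ds,\qquad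 -1\le t\le 1$$ (defined for a.e. $t$ for $f\in L^2(W_\mu;B^2)$). $(a)_k=a(a+1)\cdots(a+k-1)$. $C_k^\lambda$ is the Gegenbauer polynomial of degree $k$, orthogonal for $(1-s^2)^{\lambda-1/2}$ on $[-1,1]$, with $C_k^\lambda(1)=(2\lambda)_k/k!$. $p_l^{(\alpha,\beta)}$ is the Jacobi polynomial of degree $l$ with positive leading coefficient, orthonormal for the weight $(1-t)^\alpha(1+t)^\beta$ normalized to have integral $1$ on $[-1,1]$. Orthonormal basis of $\mathcal V_k^2(W_\mu)$: in polar coordinates $x=r\cos\phi$, $y=r\sin\phi$, $$P_{l,\varepsilon}^k(x,y)=h_{l,k}\,p_l^{(\mu-1/2,\,k-2l)}(2r^2-1)\,r^{k-2l}S_{k-2l,\varepsilon}(\phi),$$ where $S_{j,0}(\phi)=\cos j\phi$, $S_{j,1}(\phi)=\sin j\phi$, $0\le 2l\le k$ if $\varepsilon=0$, $0\le 2l\le k-1$ if $\varepsilon=1$, and $$h_{l,k}^2=\frac1{d_{l,k}}\,\frac{\Gamma(k-2l+\mu+3/2)}{\Gamma(\mu+3/2)\Gamma(k-2l+1)},\quad h_{l,k}>0,\qquad d_{l,k}=\tfrac12\ (2l<k),\quad d_{l,k}=1\ (2l=k).$$ $$\lambda_{l,k}^\mu=\frac{l!\,(k-l)!\,(k-l+\mu+\frac12)}{(\mu+\frac12)_l\,(\mu+\frac32)_{k-l}\,(k+\mu+\frac12)},\qquad D_k^{\mu+1/2}(\xi;x,y)=\sum_{l,\varepsilon}\lambda_{l,k}^\mu\,P_{l,\varepsilon}^k(\cos\xi,\sin\xi)\,P_{l,\varepsilon}^k(x,y)$$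 (sum over all admissible pairs $(l,\varepsilon)$), and $$D_k^{\mu+1/2}(\xi,t;x,y)=\frac{k+\mu+1/2}{\mu+1/2}\,C_k^{\mu+1/2}(t)\,D_k^{\mu+1/2}(\xi;x,y).$$ *)

theory Defs
  imports "HOL-Analysis.Analysis" "HOL-Computational_Algebra.Polynomial"
begin

definition unit_disk :: "(real \<times> real) set" where
  "unit_disk = {(x, y). x\<^sup>2 + y\<^sup>2 \<le> 1}"

text \<open>
  The weights below are written with \<open>powr\<close>, for which \<open>0 powr a = 0\<close>. This affects their values
  only where a base vanishes, a null set for every integral in which they occur.
\<close>

definition disk_weight :: "real \<Rightarrow> real \<times> real \<Rightarrow> real" where
  "disk_weight \<mu> = (\<lambda>(x, y). (1 - x\<^sup>2 - y\<^sup>2) powr (\<mu> - 1/2))"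

definition disk_const :: "real \<Rightarrow> real" where
  "disk_const \<mu> = (\<mu> + 1/2) / pi"

definition disk_inner :: "real \<Rightarrow> (real \<times> real \<Rightarrow> real) \<Rightarrow> (real \<times> real \<Rightarrow> real) \<Rightarrow> real" where
  "disk_inner \<mu> P Q = disk_const \<mu> * (LINT p|lebesgue_on unit_disk. P p * Q p * disk_weight \<mu> p)"

definition L2_disk :: "real \<Rightarrow> (real \<times> real \<Rightarrow> real) set" where
  "L2_disk \<mu> = {f. f \<in> borel_measurable (lebesgue_on unit_disk) \<and>
     integrable (lebesgue_on unit_disk) (\<lambda>p. (f p)\<^sup>2 * disk_weight \<mu> p)}"

text \<open>
  Bivariate polynomials are represented by the functions they induce on the plane;
  \<open>polys_below d\<close> consists of those of total degree less than \<open>d\<close>, zero included.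
\<close>

definition polys_below :: "nat \<Rightarrow> (real \<times> real \<Rightarrow> real) set" where
  "polys_below d = {P. \<exists>c :: nat \<Rightarrow> nat \<Rightarrow> real. \<forall>x y.
     P (x, y) = (\<Sum>(i, j) \<in> {(i, j). i + j < d}. c i j * x ^ i * y ^ j)}"

definition orth_polys :: "real \<Rightarrow> nat \<Rightarrow> (real \<times> real \<Rightarrow> real) set" where
  "orth_polys \<mu> k = {P. (P = (\<lambda>_. 0) \<or> P \<in> polys_below (Suc k) - polys_below k) \<and>
     (\<forall>Q \<in> polys_below k. disk_inner \<mu> P Q = 0)}"

definition disk_proj :: "real \<Rightarrow> nat \<Rightarrow> (real \<times> real \<Rightarrow> real) \<Rightarrow> real \<times> real \<Rightarrow> real" where
  "disk_proj \<mu> k f = (THE P. P \<in> orth_polys \<mu> k \<and>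
     (\<forall>Q \<in> orth_polys \<mu> k. disk_inner \<mu> (\<lambda>p. f p - P p) Q = 0))"

text \<open>
  The line integral is zero by convention for those \<open>t\<close> at which the integrand is not integrable;
  for \<open>f \<in> L2_disk \<mu>\<close> these form a null set.
\<close>

definition radon :: "real \<Rightarrow> real \<Rightarrow> (real \<times> real \<Rightarrow> real) \<Rightarrow> real \<Rightarrow> real" where
  "radon \<mu> \<theta> f t = (LINT s|lebesgue_on {- sqrt (1 - t\<^sup>2) .. sqrt (1 - t\<^sup>2)}.
     f (t * cos \<theta> - s * sin \<theta>, t * sin \<theta> + s * cos \<theta>) * (1 - s\<^sup>2 - t\<^sup>2) powr (\<mu> - 1/2))"

definition gegenbauer :: "real \<Rightarrow> nat \<Rightarrow> real poly" where
  "gegenbauer lam k = (THE p. degree p = k \<and>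
     (\<forall>q. degree q < k \<longrightarrow>
        (LINT s|lebesgue_on {-1..1}. poly p s * poly q s * (1 - s\<^sup>2) powr (lam - 1/2)) = 0) \<and>
     poly p 1 = pochhammer (2 * lam) k / fact k)"

definition jacobi_weight :: "real \<Rightarrow> real \<Rightarrow> real \<Rightarrow> real" where
  "jacobi_weight \<alpha> \<beta> t = (1 - t) powr \<alpha> * (1 + t) powr \<beta>"

definition jacobi_inner :: "real \<Rightarrow> real \<Rightarrow> real poly \<Rightarrow> real poly \<Rightarrow> real" where
  "jacobi_inner \<alpha> \<beta> p q =
     (LINT t|lebesgue_on {-1..1}. poly p t * poly q t * jacobi_weight \<alpha> \<beta> t) /
     (LINT t|lebesgue_on {-1..1}. jacobi_weight \<alpha> \<beta> t)"

definition jacobi :: "real \<Rightarrow> real \<Rightarrow> nat \<Rightarrow> real poly" where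
  "jacobi \<alpha> \<beta> l = (THE p. degree p = l \<and> lead_coeff p > 0 \<and>
     (\<forall>q. degree q < l \<longrightarrow> jacobi_inner \<alpha> \<beta> p q = 0) \<and> jacobi_inner \<alpha> \<beta> p p = 1)"

definition sph :: "nat \<Rightarrow> nat \<Rightarrow> real \<Rightarrow> real" where
  "sph j \<epsilon> \<phi> = (if \<epsilon> = 0 then cos (real j * \<phi>) else sin (real j * \<phi>))"

definition basis_indices :: "nat \<Rightarrow> (nat \<times> nat) set" where
  "basis_indices k = {(l, \<epsilon>). \<epsilon> = 0 \<and> 2 * l \<le> k \<or> \<epsilon> = 1 \<and> 2 * l + 1 \<le> k}"

definition basis_const :: "real \<Rightarrow> nat \<Rightarrow> nat \<Rightarrow> real" where
  "basis_const \<mu> l k = sqrt (1 / (if 2 * l < k then 1/2 else 1) *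
     (Gamma (real k - 2 * real l + \<mu> + 3/2) /
      (Gamma (\<mu> + 3/2) * Gamma (real k - 2 * real l + 1))))"

text \<open>
  \<open>cmod\<close> and \<open>Arg\<close> are the polar coordinates of the point. The value \<open>Arg 0 = 0\<close> plays no role:
  at the origin the factor \<open>r ^ (k - 2 * l)\<close> vanishes unless \<open>k = 2 * l\<close>, and then \<open>sph\<close> is
  constant in the angle.
\<close>

definition disk_basis :: "real \<Rightarrow> nat \<Rightarrow> nat \<Rightarrow> nat \<Rightarrow> real \<times> real \<Rightarrow> real" where
  "disk_basis \<mu> k l \<epsilon> = (\<lambda>(x, y).
     let r = cmod (Complex x y); \<phi> = Arg (Complex x y) in
       basis_const \<mu> l k * poly (jacobi (\<mu> - 1/2) (real (k - 2 * l)) l) (2 * r\<^sup>2 - 1) *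
       r ^ (k - 2 * l) * sph (k - 2 * l) \<epsilon> \<phi>)"

definition kernel_coeff :: "real \<Rightarrow> nat \<Rightarrow> nat \<Rightarrow> real" where
  "kernel_coeff \<mu> l k =
     (fact l * fact (k - l) * (real k - real l + \<mu> + 1/2)) /
     (pochhammer (\<mu> + 1/2) l * pochhammer (\<mu> + 3/2) (k - l) * (real k + \<mu> + 1/2))"

text \<open>
  The two kernels are parametrised by \<open>\<mu>\<close> itself rather than by the superscript \<open>\<mu> + 1/2\<close> that
  is customary in the notation for them.
\<close>

definition D_angle :: "real \<Rightarrow> nat \<Rightarrow> real \<Rightarrow> real \<times> real \<Rightarrow> real" where
  "D_angle \<mu> k \<xi> p = (\<Sum>(l, \<epsilon>) \<in> basis_indices k.
     kernel_coeff \<mu> l k * disk_basis \<mu> k l \<epsilon> (cos \<xi>, sin \<xi>) * disk_basis \<mu> k l \<epsilon> p)"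

definition D_kernel :: "real \<Rightarrow> nat \<Rightarrow> real \<Rightarrow> real \<Rightarrow> real \<times> real \<Rightarrow> real" where
  "D_kernel \<mu> k \<xi> t p =
     (real k + \<mu> + 1/2) / (\<mu> + 1/2) * poly (gegenbauer (\<mu> + 1/2) k) t * D_angle \<mu> k \<xi> p"

definition node :: "nat \<Rightarrow> nat \<Rightarrow> real" where
  "node n \<nu> = real \<nu> * pi / (real n + 1)"

end

theory Submission
  imports Defs
begin

text \<open>
  Let \<open>K \<xi> p\<close> be the multiple \<open>(k + \<mu> + 1/2) / (\<mu> + 1/2) C (\<langle>p, \<xi>\<rangle>)\<close> of the Gegenbauer ridge polynomial of
  degree \<open>k\<close> in the direction \<open>\<xi>\<close>. Fubini in rotated coordinates turns each integral in the theorem into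
  \<open>\<langle>f, K \<xi>\<rangle>\<close>. The Radon projection of a polynomial of degree \<open>k\<close> is \<open>(1 - t\<^sup>2)\<^sup>\<mu>\<close> times a polynomial of
  degree at most \<open>k\<close>, so \<open>K \<xi>\<close> lies in the space of orthogonal polynomials and reproduces the value of its
  elements at the point \<open>\<xi>\<close> of the unit circle. An element of the space is determined by its values on the
  circle, and there the coefficients \<open>\<lambda>\<close> make \<open>D \<xi>\<close> a Dirichlet kernel, which the equidistant nodes
  integrate exactly. Hence every \<open>P\<close> in the space is the average of \<open>P \<xi>\<^sub>\<nu> D \<xi>\<^sub>\<nu>\<close>, and by duality the average of
  \<open>\<langle>f, K \<xi>\<^sub>\<nu>\<rangle> D \<xi>\<^sub>\<nu>\<close> is the projection of \<open>f\<close>.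
\<close>

text \<open>Reproduction and discretization have different causes. That K \<xi> reproduces at \<xi>
  comes from chords shrinking to the point \<xi>: the polynomial factor of a Radon projection takes
  at t = 1 a constant times P \<xi>. That n + 1 nodes on a half circle suffice comes from parity: on
  the circle K and D contain only the frequencies k - 2 m, so their products contain only
  frequencies 2 a with |a| <= k, and nodes of step pi / (n + 1) annihilate such a term unless n + 1
  divides a. The full circle satisfies the same condition, so both formulas are instances of one
  statement about \<open>exact_nodes\<close>. Parity is established for K; an arbitrary P of the
  space gets its node expansion by pairing P with the expansion of K \<eta>, which turns each K into
  a value of P. The duality is a transposition: P = avg <P, K_\<nu>> D_\<nu> on the space gives Q =
  avg <Q, D_\<nu>> K_\<nu>, and in this second form Q can be paired with an f outside the space. The
  sum obtained is the witness for the definite description in \<open>disk_proj\<close>.\<close>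

subsection \<open>Jacobi polynomials\<close>

text \<open>The endpoints are left out because every Jacobi weight vanishes there under the
  \<open>powr\<close> convention, so that integrals against it carry no information at -1 and
  1.\<close>

lemma AE_lebesgue_on_poly_eq_0:
  fixes r :: "real poly"
  assumes "AE t in lebesgue_on {-1..1}. t \<in> {-1<..<1} \<longrightarrow> poly r t = 0"
  shows "r = 0"
proof (rule ccontr)
  assume "r \<noteq> 0"
  then have "finite ({t. poly r t = 0} \<union> {-1, 1})" by (simp add: poly_roots_finite)
  then have "{t. poly r t = 0} \<union> {-1, 1} \<in> null_sets lebesgue"
    by (simp add: finite_imp_null_set_lborel null_sets_completionI)
  then have "AE t in lebesgue. t \<notin> {t. poly r t = 0} \<union> {-1, 1}"
    by (rule AE_not_in)
  moreover have "AE t in lebesgue. t \<in> {-1..1} \<longrightarrow> (t \<in> {-1<..<1} \<longrightarrow> poly r t = 0)"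
    using assms by (subst (asm) AE_restrict_space_iff) auto
  ultimately have "AE t in lebesgue. t \<notin> {-1<..<1::real}"
    by eventually_elim auto
  then have "{-1<..<1::real} \<in> null_sets lebesgue"
    by (subst (asm) AE_iff_null_sets[symmetric]) auto
  then show False by (simp add: null_sets_def)
qed

section \<open>Beta integrals as moments of the Jacobi weight\<close>

lemma has_bochner_integral_Beta_interval:
  fixes a b :: real
  assumes "a > -1" "b > -1"
  shows "has_bochner_integral (lebesgue_on {-1..1})
           (\<lambda>t. ((1 - t) / 2) powr a * ((1 + t) / 2) powr b) (2 * Beta (a + 1) (b + 1))"
proof -
  let ?h = "\<lambda>t. indicator {0..1} t *\<^sub>R (t powr b * (1 - t) powr a)"
  have "set_integrable lborel {0..1} (\<lambda>t. t powr (b + 1 - 1) * (1 - t) powr (a + 1 - 1))"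
    by (rule integrable_Beta) (use assms in auto)
  then have si: "set_integrable lborel {0..1} (\<lambda>t. t powr b * (1 - t) powr a)" by simp
  have "((\<lambda>t. t powr (b + 1 - 1) * (1 - t) powr (a + 1 - 1)) has_integral Beta (b + 1) (a + 1)) {0..1}"
    by (rule has_integral_Beta_real) (use assms in auto)
  then have "integral {0..1} (\<lambda>t. t powr b * (1 - t) powr a) = Beta (b + 1) (a + 1)"
    by (simp add: integral_unique)
  then have "(LINT t|lborel. ?h t) = Beta (b + 1) (a + 1)"
    using set_borel_integral_eq_integral[OF si] by (simp add: set_lebesgue_integral_def)
  with si have "has_bochner_integral lborel ?h (Beta (b + 1) (a + 1))"
    by (simp add: has_bochner_integral_iff set_integrable_def)
  then have *: "has_bochner_integral lborel (\<lambda>x. ?h (1/2 + (1/2) * x)) (Beta (b + 1) (a + 1) /\<^sub>R \<bar>1/2\<bar>)"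
    by (subst (asm) lborel_has_bochner_integral_real_affine_iff[where c = "1/2" and t = "1/2"]) auto
  have eq: "?h (1/2 + (1/2) * x) =
     indicator {-1..1} x *\<^sub>R (((1 - x) / 2) powr a * ((1 + x) / 2) powr b)" for x
    by (auto simp: indicator_def add_divide_distrib diff_divide_distrib)
  have "has_bochner_integral lborel
     (\<lambda>x. indicator {-1..1} x *\<^sub>R (((1 - x) / 2) powr a * ((1 + x) / 2) powr b)) (2 * Beta (a + 1) (b + 1))"
    using * unfolding eq by (simp add: Beta_commute[of "b + 1"] mult.commute)
  then have "has_bochner_integral lebesgue
     (\<lambda>x. indicator {-1..1} x *\<^sub>R (((1 - x) / 2) powr a * ((1 + x) / 2) powr b)) (2 * Beta (a + 1) (b + 1))"
    unfolding has_bochner_integral_iff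
    by (auto simp: integrable_completion integral_completion)
  then show ?thesis
    unfolding has_bochner_integral_iff by (simp add: integrable_restrict_space integral_restrict_space)
qed

lemma has_bochner_integral_jacobi_moment:
  fixes a b :: real
  assumes "a > -1" "b > -1"
  shows "has_bochner_integral (lebesgue_on {-1..1})
           (\<lambda>t. ((1 - t) / 2) ^ i * ((1 + t) / 2) ^ m * jacobi_weight a b t)
           (2 powr (a + b + 1) * Beta (a + 1 + real i) (b + 1 + real m))"
proof -
  have "has_bochner_integral (lebesgue_on {-1..1})
     (\<lambda>t. 2 powr (a + b) * (((1 - t) / 2) powr (a + real i) * ((1 + t) / 2) powr (b + real m)))
     (2 powr (a + b) * (2 * Beta (a + real i + 1) (b + real m + 1)))"
    by (intro has_bochner_integral_mult_right has_bochner_integral_Beta_interval) (use assms in auto)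
  moreover have "2 powr (a + b) * (((1 - t) / 2) powr (a + real i) * ((1 + t) / 2) powr (b + real m)) =
     ((1 - t) / 2) ^ i * ((1 + t) / 2) ^ m * jacobi_weight a b t" if "t \<in> {-1..1}" for t
  proof -
    \<comment> \<open>At x = 0 both sides are 0, since \<open>0 powr a = 0\<close> for every
      exponent; hence the endpoints of the interval are covered.\<close>
    have pw: "x powr (c + real j) = x powr c * x ^ j" if "x \<ge> 0" for x c :: real and j
      using that by (cases "x = 0") (auto simp: powr_add powr_realpow)
    have "(1 - t) powr a = 2 powr a * ((1 - t) / 2) powr a" "(1 + t) powr b = 2 powr b * ((1 + t) / 2) powr b"
      using that by (simp_all add: powr_divide)
    moreover have "((1 - t) / 2) powr (a + real i) = ((1 - t) / 2) powr a * ((1 - t) / 2) ^ i"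
      "((1 + t) / 2) powr (b + real m) = ((1 + t) / 2) powr b * ((1 + t) / 2) ^ m"
      using that by (auto intro!: pw)
    ultimately show ?thesis
      by (simp only: jacobi_weight_def powr_add[of 2 a b] mult_ac)
  qed
  ultimately have "has_bochner_integral (lebesgue_on {-1..1})
     (\<lambda>t. ((1 - t) / 2) ^ i * ((1 + t) / 2) ^ m * jacobi_weight a b t)
     (2 powr (a + b) * (2 * Beta (a + real i + 1) (b + real m + 1)))"
    by (subst has_bochner_integral_cong[OF refl _ refl, symmetric]) auto
  then show ?thesis by (simp add: powr_add algebra_simps)
qed

text \<open>\<open>jacobi1\<close> is a sum of powers of (1 - t) / 2; test polynomials in powers of
  (1 + t) / 2 keep every product a single Beta integral.\<close>

lemma poly_in_half_powers:
  fixes q :: "real poly"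
  shows "poly q t = (\<Sum>m\<le>degree q. coeff (q \<circ>\<^sub>p [:-1, 2:]) m * ((1 + t) / 2) ^ m)"
proof -
  have "poly q t = poly (q \<circ>\<^sub>p [:-1, 2:]) ((1 + t) / 2)" by (simp add: poly_pcompose field_simps)
  also have "\<dots> = (\<Sum>m\<le>degree q. coeff (q \<circ>\<^sub>p [:-1, 2:]) m * ((1 + t) / 2) ^ m)"
    by (simp add: poly_altdef degree_pcompose)
  finally show ?thesis .
qed

lemma integrable_poly_jacobi_weight:
  assumes "a > -1" "b > -1"
  shows "integrable (lebesgue_on {-1..1}) (\<lambda>t. poly q t * jacobi_weight a b t)"
proof -
  have "integrable (lebesgue_on {-1..1})
     (\<lambda>t. \<Sum>m\<le>degree q. coeff (q \<circ>\<^sub>p [:-1, 2:]) m * (((1 - t) / 2) ^ 0 * ((1 + t) / 2) ^ m * jacobi_weight a b t))"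
    by (intro Bochner_Integration.integrable_sum integrable_mult_right integrable.intros[OF has_bochner_integral_jacobi_moment] assms)
  then show ?thesis
    by (subst poly_in_half_powers) (simp add: sum_distrib_right mult.assoc)
qed

lemma integrable_poly_poly_jacobi_weight:
  assumes "a > -1" "b > -1"
  shows "integrable (lebesgue_on {-1..1}) (\<lambda>t. poly p t * poly q t * jacobi_weight a b t)"
  using integrable_poly_jacobi_weight[OF assms, of "p * q"] by simp

lemma jacobi_weight_nonneg: "jacobi_weight a b t \<ge> 0"
  by (simp add: jacobi_weight_def)

lemma jacobi_square_eq_0:
  assumes "a > -1" "b > -1"
    and "(LINT t|lebesgue_on {-1..1}. poly r t * poly r t * jacobi_weight a b t) = 0"
  shows "r = 0"
proof -
  have "AE t in lebesgue_on {-1..1}. poly r t * poly r t * jacobi_weight a b t = 0"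
    using assms by (subst integral_nonneg_eq_0_iff_AE[symmetric])
      (auto intro: integrable_poly_poly_jacobi_weight simp: jacobi_weight_nonneg)
  then have "AE t in lebesgue_on {-1..1}. t \<in> {-1<..<1} \<longrightarrow> poly r t = 0"
    by eventually_elim (auto simp: jacobi_weight_def)
  then show ?thesis by (rule AE_lebesgue_on_poly_eq_0)
qed

text \<open>\<open>jacobi1 a b l\<close> is the hypergeometric form \<open>\<^sub>2F\<^sub>1(-l, l + a + b + 1; a + 1; (1 - t) / 2)\<close> of the
  Jacobi polynomial, which takes the value 1 at 1; its moments are evaluated by the Chu-Vandermonde identity.\<close>

definition jacobi1 :: "real \<Rightarrow> real \<Rightarrow> nat \<Rightarrow> real poly" where
  "jacobi1 a b l = (\<Sum>i\<le>l. smult (pochhammer (a + b + 1 + real l) i * pochhammer (- real l) i /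
      (fact i * pochhammer (a + 1) i)) ([:1/2, -1/2:] ^ i))"

lemma poly_jacobi1:
  "poly (jacobi1 a b l) t = (\<Sum>i\<le>l. pochhammer (a + b + 1 + real l) i * pochhammer (- real l) i /
      (fact i * pochhammer (a + 1) i) * ((1 - t) / 2) ^ i)"
  by (simp add: jacobi1_def poly_sum diff_divide_distrib)

lemma poly_jacobi1_1: "poly (jacobi1 a b l) 1 = 1"
proof -
  have "poly (jacobi1 a b l) 1 = (\<Sum>i\<in>{0}. pochhammer (a + b + 1 + real l) i * pochhammer (- real l) i /
      (fact i * pochhammer (a + 1) i) * ((1 - 1) / 2) ^ i)"
    unfolding poly_jacobi1 by (rule sum.mono_neutral_right) auto
  then show ?thesis by simp
qed

lemma degree_jacobi1_le: "degree (jacobi1 a b l) \<le> l"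
  unfolding jacobi1_def
proof (rule degree_sum_le)
  fix i assume "i \<in> {..l}"
  have "degree ([:1/2, -1/2:] ^ i :: real poly) = i"
    by (simp add: degree_power_eq)
  then show "degree (smult (pochhammer (a + b + 1 + real l) i * pochhammer (- real l) i /
      (fact i * pochhammer (a + 1) i)) ([:1/2, -1/2:] ^ i)) \<le> l"
    using \<open>i \<in> {..l}\<close> by (simp del: degree_power_eq)
qed simp

lemma coeff_linear_power:
  fixes c d :: real
  assumes "d \<noteq> 0"
  shows "coeff ([:c, d:] ^ i) i = d ^ i"
proof -
  have "degree ([:c, d:] ^ i) = i" using assms by (simp add: degree_power_eq)
  then have "coeff ([:c, d:] ^ i) i = lead_coeff ([:c, d:] ^ i)" by simp
  then show ?thesis using assms by (simp add: lead_coeff_power)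
qed

lemma pochhammer_minus_real: "pochhammer (- real l) l = (-1) ^ l * fact l"
  using pochhammer_minus[of "real l" l] by (simp add: pochhammer_fact)

text \<open>Only the term i = l reaches degree l. The sign of \<open>pochhammer (- real l) l\<close>
  cancels the one in the leading coefficient of ((1 - t) / 2)^l.\<close>

lemma coeff_jacobi1:
  "coeff (jacobi1 a b l) l = pochhammer (a + b + 1 + real l) l / pochhammer (a + 1) l / 2 ^ l"
proof -
  have z: "coeff ([:1/2, -1/2:] ^ i :: real poly) l = 0" if "i < l" for i
    using that by (intro coeff_eq_0) (simp add: degree_power_eq)
  have "coeff (jacobi1 a b l) l = (\<Sum>i\<le>l. pochhammer (a + b + 1 + real l) i * pochhammer (- real l) i /
      (fact i * pochhammer (a + 1) i) * coeff ([:1/2, -1/2:] ^ i) l)"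
    by (simp add: jacobi1_def coeff_sum)
  also have "\<dots> = (\<Sum>i\<in>{l}. pochhammer (a + b + 1 + real l) i * pochhammer (- real l) i /
      (fact i * pochhammer (a + 1) i) * coeff ([:1/2, -1/2:] ^ i) l)"
    by (rule sum.mono_neutral_right) (auto simp: z[simplified])
  also have "\<dots> = pochhammer (a + b + 1 + real l) l / pochhammer (a + 1) l / 2 ^ l"
    by (simp add: coeff_linear_power pochhammer_minus_real power_divide power_minus[of "1/2"] flip: power_mult_distrib)
  finally show ?thesis .
qed

section \<open>Orthogonality, norm and uniqueness of the Jacobi polynomials\<close>

context
  fixes a b :: real
  assumes ab: "a > -1" "b > -1" "a + b > -1"
begin

lemma degree_jacobi1: "degree (jacobi1 a b l) = l"
  and lead_coeff_jacobi1: "lead_coeff (jacobi1 a b l) > 0"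
proof -
  have pos: "coeff (jacobi1 a b l) l > 0"
    unfolding coeff_jacobi1 using ab by (intro divide_pos_pos pochhammer_pos) auto
  then show "degree (jacobi1 a b l) = l"
    using degree_jacobi1_le[of a b l] le_degree[of "jacobi1 a b l" l] by fastforce
  with pos show "lead_coeff (jacobi1 a b l) > 0" by simp
qed

lemma jacobi1_nonzero: "jacobi1 a b l \<noteq> 0"
  using lead_coeff_jacobi1[of l] by (metis coeff_0 less_irrefl)

text \<open>The Beta value at i carries a factor \<open>pochhammer (a + 1) i\<close> that cancels
  the one in the coefficient of \<open>jacobi1\<close>; what remains is a terminating Gauss series
  at 1. In its value, \<open>pochhammer (1 + real m - real l) l\<close> is 0 for m < l and l! for m
  = l, so orthogonality and norm are both read off here.\<close>

lemma jacobi1_moment: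
  "(LINT t|lebesgue_on {-1..1}. poly (jacobi1 a b l) t * ((1 + t) / 2) ^ m * jacobi_weight a b t) =
     2 powr (a + b + 1) * Beta (a + 1) (b + 1 + real m) *
       (pochhammer (1 + real m - real l) l / pochhammer (a + b + 2 + real m) l)"
proof -
  let ?c = "\<lambda>i. pochhammer (a + b + 1 + real l) i * pochhammer (- real l) i /
      (fact i * pochhammer (a + 1) i)"
  have B: "Beta (a + 1 + real i) (b + 1 + real m) =
     Beta (a + 1) (b + 1 + real m) * (pochhammer (a + 1) i / pochhammer (a + b + 2 + real m) i)" for i
  proof -
    have "a + 1 \<notin> \<int>\<^sub>\<le>\<^sub>0" "a + b + 2 + real m \<notin> \<int>\<^sub>\<le>\<^sub>0"
      using ab by (auto elim!: nonpos_Ints_cases)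
    moreover have "Gamma (a + 1) > 0" "Gamma (a + b + 2 + real m) > 0" using ab by (auto intro!: Gamma_real_pos)
    ultimately show ?thesis
      unfolding Beta_def
      by (simp add: pochhammer_Gamma add_ac less_imp_neq[THEN not_sym] field_simps)
  qed
  have p0: "pochhammer (a + 1) i \<noteq> 0" for i
    using pochhammer_pos[of "a + 1" i] ab by auto
  have "(LINT t|lebesgue_on {-1..1}. poly (jacobi1 a b l) t * ((1 + t) / 2) ^ m * jacobi_weight a b t) =
     (LINT t|lebesgue_on {-1..1}. (\<Sum>i\<le>l. ?c i * (((1 - t) / 2) ^ i * ((1 + t) / 2) ^ m * jacobi_weight a b t)))"
    by (simp add: poly_jacobi1 sum_distrib_right mult.assoc)
  also have "\<dots> = (\<Sum>i\<le>l. ?c i * (2 powr (a + b + 1) * Beta (a + 1 + real i) (b + 1 + real m)))"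
    by (intro has_bochner_integral_integral_eq has_bochner_integral_sum has_bochner_integral_mult_right
        has_bochner_integral_jacobi_moment ab)
  also have "\<dots> = 2 powr (a + b + 1) * Beta (a + 1) (b + 1 + real m) *
     (\<Sum>i\<in>{0..l}. pochhammer (a + b + 1 + real l) i * pochhammer (- real l) i /
       (of_nat (fact i) * pochhammer (a + b + 2 + real m) i))"
    unfolding sum_distrib_left B atMost_atLeast0 using p0 by (intro sum.cong refl) (simp add: field_simps)
  also have "(\<Sum>i\<in>{0..l}. pochhammer (a + b + 1 + real l) i * pochhammer (- real l) i /
       (of_nat (fact i) * pochhammer (a + b + 2 + real m) i)) =
      pochhammer (a + b + 2 + real m - (a + b + 1 + real l)) l / pochhammer (a + b + 2 + real m) l"
    using ab by (intro Vandermonde_pochhammer) auto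
  also have "a + b + 2 + real m - (a + b + 1 + real l) = 1 + real m - real l" by simp
  finally show ?thesis .
qed

lemma jacobi1_orth_power:
  assumes "m < l"
  shows "(LINT t|lebesgue_on {-1..1}. poly (jacobi1 a b l) t * ((1 + t) / 2) ^ m * jacobi_weight a b t) = 0"
proof -
  have "1 + real m - real l = - real (l - Suc m)" using assms by (simp add: of_nat_diff)
  then have "pochhammer (1 + real m - real l) l = 0"
    by (simp only:) (intro pochhammer_of_nat_eq_0_lemma, use assms in auto)
  then show ?thesis by (simp add: jacobi1_moment)
qed

lemma jacobi1_integral_expand:
  "(LINT t|lebesgue_on {-1..1}. poly (jacobi1 a b l) t * poly q t * jacobi_weight a b t) =
   (\<Sum>m\<le>degree q. coeff (q \<circ>\<^sub>p [:-1, 2:]) m *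
     (LINT t|lebesgue_on {-1..1}. poly (jacobi1 a b l) t * ((1 + t) / 2) ^ m * jacobi_weight a b t))"
proof -
  have int: "integrable (lebesgue_on {-1..1}) (\<lambda>t. poly (jacobi1 a b l) t * ((1 + t) / 2) ^ m * jacobi_weight a b t)" for m
    using integrable_poly_poly_jacobi_weight[OF ab(1,2), of "jacobi1 a b l" "[:1/2,1/2:] ^ m"]
    by (simp add: add_divide_distrib)
  have "(LINT t|lebesgue_on {-1..1}. poly (jacobi1 a b l) t * poly q t * jacobi_weight a b t) =
    (LINT t|lebesgue_on {-1..1}. (\<Sum>m\<le>degree q. coeff (q \<circ>\<^sub>p [:-1, 2:]) m * (poly (jacobi1 a b l) t * ((1 + t) / 2) ^ m * jacobi_weight a b t)))"
    by (subst poly_in_half_powers[of q]) (simp add: sum_distrib_left sum_distrib_right mult_ac)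
  also have "\<dots> = (\<Sum>m\<le>degree q. coeff (q \<circ>\<^sub>p [:-1, 2:]) m *
     (LINT t|lebesgue_on {-1..1}. poly (jacobi1 a b l) t * ((1 + t) / 2) ^ m * jacobi_weight a b t))"
    by (subst Bochner_Integration.integral_sum) (auto intro!: int)
  finally show ?thesis .
qed

lemma jacobi1_orth:
  assumes "degree q < l"
  shows "(LINT t|lebesgue_on {-1..1}. poly (jacobi1 a b l) t * poly q t * jacobi_weight a b t) = 0"
  unfolding jacobi1_integral_expand using assms by (intro sum.neutral) (simp add: jacobi1_orth_power)

lemma jacobi_weight_integral:
  "(LINT t|lebesgue_on {-1..1}. jacobi_weight a b t) = 2 powr (a + b + 1) * Beta (a + 1) (b + 1)"
  using has_bochner_integral_integral_eq[OF has_bochner_integral_jacobi_moment[OF ab(1,2), of 0 0]] by simp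

text \<open>By orthogonality only the top coefficient of one factor, in powers of (1 + t) / 2,
  counts, and it meets the moment m = l. The condition a + b > -1 keeps the quotient (a + b + 1 + l)
  / (a + b + 1 + 2 l) from being 0 / 0 at l = 0.\<close>

lemma jacobi1_norm:
  "jacobi_inner a b (jacobi1 a b l) (jacobi1 a b l) =
     fact l * pochhammer (b + 1) l * (a + b + 1 + real l) /
       (pochhammer (a + 1) l * pochhammer (a + b + 2) l * (a + b + 1 + 2 * real l))"
proof -
  let ?M = "\<lambda>m. LINT t|lebesgue_on {-1..1}. poly (jacobi1 a b l) t * ((1 + t) / 2) ^ m * jacobi_weight a b t"
  let ?q = "jacobi1 a b l \<circ>\<^sub>p [:-1, 2:]"
  have "coeff ?q l = lead_coeff ?q" by (simp add: degree_jacobi1 degree_pcompose)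
  also have "\<dots> = pochhammer (a + b + 1 + real l) l / pochhammer (a + 1) l"
    by (subst lead_coeff_comp) (auto simp: degree_jacobi1 coeff_jacobi1)
  finally have c: "coeff ?q l = pochhammer (a + b + 1 + real l) l / pochhammer (a + 1) l" .
  have "(\<Sum>m\<le>degree (jacobi1 a b l). coeff ?q m * ?M m) = (\<Sum>m\<in>{l}. coeff ?q m * ?M m)"
    by (rule sum.mono_neutral_right) (auto simp: degree_jacobi1 jacobi1_orth_power)
  then have n: "(LINT t|lebesgue_on {-1..1}. poly (jacobi1 a b l) t * poly (jacobi1 a b l) t * jacobi_weight a b t) =
     pochhammer (a + b + 1 + real l) l / pochhammer (a + 1) l *
     (2 powr (a + b + 1) * Beta (a + 1) (b + 1 + real l) * (fact l / pochhammer (a + b + 2 + real l) l))"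
    unfolding jacobi1_integral_expand by (simp add: c jacobi1_moment pochhammer_fact)
  have nI: "b + 1 \<notin> \<int>\<^sub>\<le>\<^sub>0" "a + b + 2 \<notin> \<int>\<^sub>\<le>\<^sub>0"
    using ab by (auto elim!: nonpos_Ints_cases)
  have pos: "Gamma (a + 1) > 0" "Gamma (a + b + 2) > 0" "Gamma (b + 1) > 0"
      "Gamma (a + b + 2 + real l) > 0" "pochhammer (a + 1) l > 0" "pochhammer (a + b + 2) l > 0"
      "pochhammer (a + b + 2 + real l) l > 0"
    using ab by (auto intro!: Gamma_real_pos pochhammer_pos)
  have B: "Beta (a + 1) (b + 1 + real l) = Beta (a + 1) (b + 1) * (pochhammer (b + 1) l / pochhammer (a + b + 2) l)"
    unfolding Beta_def using nI pos
    by (simp add: pochhammer_Gamma add_ac less_imp_neq[THEN not_sym] field_simps)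
  have "Beta (a + 1) (b + 1) > 0" unfolding Beta_def using pos by (simp add: add_ac)
  have "(a + b + 1 + real l) * pochhammer (a + b + 1 + real l + 1) l = pochhammer (a + b + 1 + real l) (Suc l)"
    by (simp add: pochhammer_rec)
  also have "\<dots> = pochhammer (a + b + 1 + real l) l * (a + b + 1 + 2 * real l)"
    by (simp add: pochhammer_rec' algebra_simps)
  finally have "pochhammer (a + b + 1 + real l) l * (a + b + 1 + 2 * real l) = (a + b + 1 + real l) * pochhammer (a + b + 2 + real l) l"
    by (simp add: add_ac)
  then have r: "pochhammer (a + b + 1 + real l) l = (a + b + 1 + real l) * pochhammer (a + b + 2 + real l) l / (a + b + 1 + 2 * real l)"
    using ab by (simp add: field_simps)
  have q: "a + b + 1 + 2 * real l > 0" using ab by simp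
  have alg: "(c * P / q / p\<^sub>1 * (T * (B * (p\<^sub>2 / p\<^sub>3)) * (f / P))) / (T * B) = f * p\<^sub>2 * c / (p\<^sub>1 * p\<^sub>3 * q)"
    if "T \<noteq> 0" "B \<noteq> 0" "P \<noteq> 0" "q \<noteq> 0" "p\<^sub>1 \<noteq> 0" "p\<^sub>3 \<noteq> 0" for c P q p\<^sub>1 T B p\<^sub>2 p\<^sub>3 f :: real
    using that by (simp add: field_simps)
  show ?thesis
    unfolding jacobi_inner_def n jacobi_weight_integral B r
    by (rule alg) (use pos \<open>Beta (a + 1) (b + 1) > 0\<close> q in auto)
qed

lemma jacobi1_norm_pos: "jacobi_inner a b (jacobi1 a b l) (jacobi1 a b l) > 0"
  unfolding jacobi1_norm using ab by (intro divide_pos_pos mult_pos_pos pochhammer_pos) auto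

lemma jacobi_inner_smult_left: "jacobi_inner a b (smult c p) q = c * jacobi_inner a b p q"
  by (simp add: jacobi_inner_def mult.assoc)

lemma jacobi_inner_smult_right: "jacobi_inner a b p (smult c q) = c * jacobi_inner a b p q"
  by (simp add: jacobi_inner_def mult.left_commute mult.assoc)

text \<open>Subtracting the multiple of \<open>jacobi1\<close> with the same top coefficient leaves
  a polynomial of smaller degree that is orthogonal to itself. The multiple is expressed by the
  value at 1 because this is the value of the polynomial factor that a Radon projection
  determines.\<close>

lemma orthogonal_poly_unique:
  assumes p: "degree p \<le> l" "\<And>q. degree q < l \<Longrightarrow> (LINT t|lebesgue_on {-1..1}. poly p t * poly q t * jacobi_weight a b t) = 0"
  shows "p = smult (poly p 1) (jacobi1 a b l)"
proof -
  define c where "c = coeff p l / lead_coeff (jacobi1 a b l)"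
  define r where "r = p - smult c (jacobi1 a b l)"
  have l0: "lead_coeff (jacobi1 a b l) \<noteq> 0" using jacobi1_nonzero by simp
  have "r = 0"
  proof (cases "l = 0")
    case True
    then show ?thesis
      using p(1) degree_jacobi1[of l] l0 by (auto simp: r_def c_def elim!: degree_eq_zeroE)
  next
    case False
    have "coeff r l = 0"
      unfolding r_def c_def using p(1) degree_jacobi1[of l] l0 by simp
    moreover have "degree r \<le> l" unfolding r_def
      using p(1) degree_jacobi1[of l] by (intro degree_diff_le) (auto simp: degree_smult_le)
    ultimately have d: "degree r < l" using False
      by (metis le_neq_implies_less leading_coeff_0_iff degree_0 gr0I)
    have "(LINT t|lebesgue_on {-1..1}. poly r t * poly r t * jacobi_weight a b t) =
       (LINT t|lebesgue_on {-1..1}. poly p t * poly r t * jacobi_weight a b t -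
          c * (poly (jacobi1 a b l) t * poly r t * jacobi_weight a b t))"
      by (simp add: r_def algebra_simps)
    also have "\<dots> = 0"
      using p(2)[OF d] jacobi1_orth[OF d]
      by (subst Bochner_Integration.integral_diff) (auto intro!: integrable_poly_poly_jacobi_weight ab)
    finally show ?thesis using jacobi_square_eq_0 ab by blast
  qed
  then have *: "p = smult c (jacobi1 a b l)" by (simp add: r_def)
  then have "poly p 1 = c" using poly_jacobi1_1[of a b l] by simp
  with * show ?thesis by metis
qed

text \<open>The sign of the leading coefficient in the definite description selects the positive
  square root.\<close>

lemma jacobi_eq:
  "jacobi a b l = smult (1 / sqrt (jacobi_inner a b (jacobi1 a b l) (jacobi1 a b l))) (jacobi1 a b l)"
  (is "_ = ?J")
proof -
  let ?N = "jacobi_inner a b (jacobi1 a b l) (jacobi1 a b l)"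
  have N: "?N > 0" by (rule jacobi1_norm_pos)
  have W: "(LINT t|lebesgue_on {-1..1}. jacobi_weight a b t) > 0"
    unfolding jacobi_weight_integral Beta_def using ab
    by (intro mult_pos_pos divide_pos_pos Gamma_real_pos) auto
  show ?thesis
    unfolding jacobi_def
  proof (rule the_equality)
    show "degree ?J = l \<and> lead_coeff ?J > 0 \<and>
     (\<forall>q. degree q < l \<longrightarrow> jacobi_inner a b ?J q = 0) \<and> jacobi_inner a b ?J ?J = 1"
      using N degree_jacobi1[of l] lead_coeff_jacobi1[of l] jacobi1_orth[of _ l] jacobi1_nonzero[of l]
      by (auto simp: jacobi_inner_smult_left jacobi_inner_smult_right )
         (simp add: jacobi_inner_def)
  next
    fix p assume p: "degree p = l \<and> lead_coeff p > 0 \<and>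
     (\<forall>q. degree q < l \<longrightarrow> jacobi_inner a b p q = 0) \<and> jacobi_inner a b p p = 1"
    define c where "c = poly p 1"
    have pc: "p = smult c (jacobi1 a b l)"
      unfolding c_def using p W by (intro orthogonal_poly_unique) (auto simp: jacobi_inner_def)
    have "c > 0"
      using p lead_coeff_jacobi1[of l] unfolding pc by (auto simp: zero_less_mult_iff)
    moreover have "c * c * ?N = 1"
      using p unfolding pc by (simp add: jacobi_inner_smult_left jacobi_inner_smult_right mult.assoc)
    ultimately have "c = 1 / sqrt ?N"
      using N by (metis abs_of_pos divide_divide_eq_right div_by_1 nonzero_eq_divide_eq order_less_irrefl
          power2_eq_square real_sqrt_abs real_sqrt_divide real_sqrt_one)
    then show "p = ?J" using pc by simp
  qed
qed

lemma degree_jacobi: "degree (jacobi a b l) = l"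
  unfolding jacobi_eq using jacobi1_norm_pos[of l] degree_jacobi1[of l] by simp

lemma jacobi_orth:
  assumes "degree q < l"
  shows "(LINT t|lebesgue_on {-1..1}. poly (jacobi a b l) t * poly q t * jacobi_weight a b t) = 0"
  unfolding jacobi_eq using jacobi1_orth[OF assms] by (simp add: mult.assoc)

text \<open>On the unit circle the argument 2 r^2 - 1 equals 1, so this is the radial factor in the
  products of basis values that make up \<open>D_angle\<close> there.\<close>

lemma jacobi_at_1_square:
  "(poly (jacobi a b l) 1)\<^sup>2 =
     pochhammer (a + 1) l * pochhammer (a + b + 2) l * (a + b + 1 + 2 * real l) /
     (fact l * pochhammer (b + 1) l * (a + b + 1 + real l))"
proof -
  have "(poly (jacobi a b l) 1)\<^sup>2 = 1 / jacobi_inner a b (jacobi1 a b l) (jacobi1 a b l)"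
    using jacobi1_norm_pos[of l] by (simp add: jacobi_eq poly_jacobi1_1 power_divide)
  then show ?thesis by (simp add: jacobi1_norm)
qed

end

subsection \<open>Bivariate polynomials\<close>

lemma finite_total_degree [simp]: "finite {(i, j). i + j < (d :: nat)}"
  by (rule finite_subset[of _ "{..<d} \<times> {..<d}"]) auto

lemma polys_below_zero: "(\<lambda>_. 0) \<in> polys_below d"
  unfolding polys_below_def by (auto intro!: exI[of _ "\<lambda>_ _. 0"])

lemma polys_below_add:
  assumes "P \<in> polys_below d" "Q \<in> polys_below d"
  shows "(\<lambda>p. P p + Q p) \<in> polys_below d"
proof -
  obtain c e where "\<And>x y. P (x, y) = (\<Sum>(i, j) \<in> {(i, j). i + j < d}. c i j * x ^ i * y ^ j)"
    "\<And>x y. Q (x, y) = (\<Sum>(i, j) \<in> {(i, j). i + j < d}. e i j * x ^ i * y ^ j)"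
    using assms unfolding polys_below_def by auto
  then show ?thesis
    unfolding polys_below_def
    by (auto intro!: exI[of _ "\<lambda>i j. c i j + e i j"] simp: sum.distrib[symmetric] distrib_right intro!: sum.cong)
qed

lemma polys_below_cmult:
  assumes "P \<in> polys_below d"
  shows "(\<lambda>p. c * P p) \<in> polys_below d"
proof -
  obtain e where "\<And>x y. P (x, y) = (\<Sum>(i, j) \<in> {(i, j). i + j < d}. e i j * x ^ i * y ^ j)"
    using assms unfolding polys_below_def by auto
  then show ?thesis
    unfolding polys_below_def
    by (auto intro!: exI[of _ "\<lambda>i j. c * e i j"] simp: sum_distrib_left mult.assoc intro!: sum.cong)
qed

lemma polys_below_diff:
  assumes "P \<in> polys_below d" "Q \<in> polys_below d"
  shows "(\<lambda>p. P p - Q p) \<in> polys_below d"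
  using polys_below_add[OF assms(1) polys_below_cmult[OF assms(2), of "-1"]] by simp

lemma polys_below_sum:
  assumes "\<And>i. i \<in> I \<Longrightarrow> P i \<in> polys_below d"
  shows "(\<lambda>p. \<Sum>i\<in>I. P i p) \<in> polys_below d"
  using assms by (induction I rule: infinite_finite_induct) (auto simp: polys_below_zero intro!: polys_below_add)

lemma polys_below_monomial:
  assumes "i + j < d"
  shows "(\<lambda>p. fst p ^ i * snd p ^ j) \<in> polys_below d"
proof -
  have eq: "x ^ i * y ^ j = (\<Sum>(i', j') \<in> {(i, j). i + j < d}. (if i' = i \<and> j' = j then 1 else 0) * x ^ i' * y ^ j')" for x y :: real
  proof -
    have "(\<Sum>(i', j') \<in> {(i, j). i + j < d}. (if i' = i \<and> j' = j then 1 else 0) * x ^ i' * y ^ j') =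
       (\<Sum>(i', j') \<in> {(i, j)}. (if i' = i \<and> j' = j then 1 else 0) * x ^ i' * y ^ j')"
      using assms by (intro sum.mono_neutral_right) (auto split: if_splits)
    then show ?thesis by simp
  qed
  show ?thesis unfolding polys_below_def
    by (auto simp: eq intro!: exI[of _ "\<lambda>i' j'. if i' = i \<and> j' = j then 1 else 0"])
qed

text \<open>Statements that are linear in the polynomial reduce to monomials, without handling
  coefficient functions again. The case \<open>zero\<close> is the empty sum, which is all there is
  for d = 0.\<close>

lemma polys_below_induct [consumes 1, case_names zero add cmult monomial]:
  assumes "P \<in> polys_below d"
    and zero: "Q (\<lambda>_. 0)"
    and add: "\<And>F G. Q F \<Longrightarrow> Q G \<Longrightarrow> Q (\<lambda>p. F p + G p)"
    and cmult: "\<And>c F. Q F \<Longrightarrow> Q (\<lambda>p. c * F p)"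
    and monomial: "\<And>i j. i + j < d \<Longrightarrow> Q (\<lambda>p. fst p ^ i * snd p ^ j)"
  shows "Q P"
proof -
  obtain c where c: "\<And>x y. P (x, y) = (\<Sum>(i, j) \<in> {(i, j). i + j < d}. c i j * x ^ i * y ^ j)"
    using assms(1) unfolding polys_below_def by auto
  have "Q (\<lambda>p. \<Sum>(i, j) \<in> A. c i j * (fst p ^ i * snd p ^ j))" if "A \<subseteq> {(i, j). i + j < d}" for A
  proof -
    have "finite A" using that by (rule finite_subset) simp
    then show ?thesis using that
    proof (induction A)
      case empty
      then show ?case using zero by simp
    next
      case (insert a A)
      obtain i j where a: "a = (i, j)" by (cases a)
      have "Q (\<lambda>p. c i j * (fst p ^ i * snd p ^ j))"
        using insert.prems by (intro cmult monomial) (auto simp: a)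
      with insert have "Q (\<lambda>p. c i j * (fst p ^ i * snd p ^ j) + (\<Sum>(i, j) \<in> A. c i j * (fst p ^ i * snd p ^ j)))"
        by (intro add) auto
      then show ?case using insert.hyps by (simp add: a case_prod_beta)
    qed
  qed
  from this[of "{(i, j). i + j < d}"] have "Q (\<lambda>p. \<Sum>(i, j) \<in> {(i, j). i + j < d}. c i j * (fst p ^ i * snd p ^ j))"
    by simp
  moreover have "(\<lambda>p. \<Sum>(i, j) \<in> {(i, j). i + j < d}. c i j * (fst p ^ i * snd p ^ j)) = P"
    by (auto simp: c mult.assoc)
  ultimately show ?thesis by simp
qed

lemma polys_below_mono:
  assumes "P \<in> polys_below d" "d \<le> e"
  shows "P \<in> polys_below e"
  using assms(1)
  by (induction rule: polys_below_induct)
    (use assms(2) in \<open>auto intro!: polys_below_zero polys_below_add polys_below_cmult polys_below_monomial\<close>)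

lemma polys_below_monomial_mult:
  assumes "P \<in> polys_below d"
  shows "(\<lambda>p. fst p ^ i * snd p ^ j * P p) \<in> polys_below (i + j + d)"
  using assms
proof (induction rule: polys_below_induct)
  case (monomial i' j')
  then show ?case
    using polys_below_monomial[of "i + i'" "j + j'" "i + j + d"] by (simp add: power_add mult_ac)
next
  case (cmult c F)
  then show ?case using polys_below_cmult[OF cmult, of c] by (simp add: mult.left_commute)
next
  case (add F G)
  then show ?case using polys_below_add[OF add] by (simp add: distrib_left)
qed (simp add: polys_below_zero)

text \<open>The bounds are asymmetric because \<open>polys_below (Suc d)\<close> means degree at
  most d, whereas \<open>polys_below e\<close> means degree less than e.\<close>

lemma polys_below_mult:
  assumes "P \<in> polys_below (Suc d)" "Q \<in> polys_below e"
  shows "(\<lambda>p. P p * Q p) \<in> polys_below (d + e)"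
  using assms(1)
proof (induction rule: polys_below_induct)
  case (monomial i j)
  then show ?case
    using polys_below_mono[OF polys_below_monomial_mult[OF assms(2), of i j], of "d + e"] by simp
next
  case (cmult c F)
  then show ?case using polys_below_cmult[OF cmult, of c] by (simp add: mult.assoc)
next
  case (add F G)
  then show ?case using polys_below_add[OF add] by (simp add: distrib_right)
qed (simp add: polys_below_zero)

lemma polys_below_const: "(\<lambda>_. c) \<in> polys_below (Suc d)"
  using polys_below_cmult[OF polys_below_monomial[of 0 0 "Suc d"], of c] by (simp add: case_prod_beta)

lemma polys_below_linear: "(\<lambda>p. a * fst p + b * snd p) \<in> polys_below (Suc (Suc d))"
  using polys_below_add[OF polys_below_cmult[OF polys_below_monomial[of 1 0 "Suc (Suc d)"], of a]
      polys_below_cmult[OF polys_below_monomial[of 0 1 "Suc (Suc d)"], of b]]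
  by (simp add: case_prod_beta)

lemma polys_below_power:
  assumes "P \<in> polys_below (Suc d)"
  shows "(\<lambda>p. P p ^ m) \<in> polys_below (Suc (d * m))"
proof (induction m)
  case 0
  then show ?case by (simp add: polys_below_const)
next
  case (Suc m)
  then show ?case using polys_below_mult[OF assms Suc] by (simp add: add_ac)
qed

lemma polys_below_poly_comp:
  assumes "P \<in> polys_below (Suc d)" "d * degree q < e"
  shows "(\<lambda>p. poly q (P p)) \<in> polys_below e"
proof -
  have "(\<lambda>p. \<Sum>i\<le>degree q. coeff q i * P p ^ i) \<in> polys_below e"
  proof (intro polys_below_sum polys_below_cmult)
    fix i assume "i \<in> {..degree q}"
    then have "d * i \<le> d * degree q" by simp
    with assms(2) show "(\<lambda>p. P p ^ i) \<in> polys_below e"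
      by (intro polys_below_mono[OF polys_below_power[OF assms(1)]]) linarith
  qed
  then show ?thesis by (simp add: poly_altdef)
qed

lemma polys_below_linear_comp:
  assumes "P \<in> polys_below d"
  shows "(\<lambda>p. P (a * fst p + b * snd p, a' * fst p + b' * snd p)) \<in> polys_below d"
  using assms
proof (induction rule: polys_below_induct)
  case (monomial i j)
  have "(\<lambda>p. (a * fst p + b * snd p) ^ i * (a' * fst p + b' * snd p) ^ j) \<in> polys_below (1 * i + Suc (1 * j))"
    by (intro polys_below_mult polys_below_power) (simp_all add: polys_below_linear)
  then show ?case using monomial by (simp add: polys_below_mono[of _ "Suc (i + j)"])
qed (auto intro: polys_below_zero polys_below_add polys_below_cmult)

lemma polys_below_continuous:
  assumes "P \<in> polys_below d"
  shows "continuous_on UNIV P"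
  using assms
  by (induction rule: polys_below_induct)
    (auto simp: case_prod_beta intro!: continuous_intros)

text \<open>Restriction to a line makes the finiteness of the roots of a univariate polynomial
  available.\<close>

lemma polys_below_poly_line:
  assumes "P \<in> polys_below d"
  shows "\<exists>q. \<forall>s. P (x + s * u, y + s * v) = poly q s"
  using assms
proof (induction rule: polys_below_induct)
  case zero
  show ?case by (auto intro!: exI[of _ 0])
next
  case (add F G)
  then obtain q r where "\<forall>s. F (x + s * u, y + s * v) = poly q s" "\<forall>s. G (x + s * u, y + s * v) = poly r s"
    by auto
  then show ?case by (auto intro!: exI[of _ "q + r"])
next
  case (cmult c F)
  then obtain q where "\<forall>s. F (x + s * u, y + s * v) = poly q s"
    by auto
  then show ?case by (auto intro!: exI[of _ "smult c q"])
next
  case (monomial i j)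
  show ?case by (auto intro!: exI[of _ "[:x, u:] ^ i * [:y, v:] ^ j"])
qed

subsection \<open>Rotations and the Radon projection\<close>

text \<open>In a completion, a set that differs from a Borel set by a null set is measurable. This
  gives the measurability of slice integrals that are known only almost everywhere.\<close>

lemma borel_measurable_lebesgue_cong_AE:
  fixes f g :: "'a::euclidean_space \<Rightarrow> 'b::topological_space"
  assumes g: "g \<in> borel_measurable borel" and ae: "AE x in lborel. f x = g x"
  shows "f \<in> borel_measurable lebesgue"
proof (rule measurableI)
  fix A :: "'b set" assume "A \<in> sets borel"
  then have "g -` A \<in> sets lebesgue"
    using measurable_sets[OF g, of A] by (simp add: sets_completionI_sets)
  moreover have "AE x in lebesgue. x \<in> g -` A \<longleftrightarrow> x \<in> f -` A"
    by (rule AE_completion) (use ae in \<open>eventually_elim, auto\<close>)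
  ultimately show "f -` A \<inter> space lebesgue \<in> sets lebesgue"
    using completion.in_sets_AE[of "g -` A" "f -` A" lborel] by simp
qed simp

text \<open>Cosine and sine are the parameters instead of the angle, so that the factorization into
  shears is an identity between rational functions.\<close>

definition rot2 :: "real \<Rightarrow> real \<Rightarrow> real \<times> real \<Rightarrow> real \<times> real" where
  "rot2 c s p = (fst p * c - snd p * s, fst p * s + snd p * c)"

lemma measurable_rot2 [measurable]: "rot2 c s \<in> borel_measurable borel"
  unfolding rot2_def by (intro borel_measurable_continuous_onI continuous_intros)

text \<open>On each horizontal line the shear is a translation; Fubini then reduces the claim to
  translation invariance in one variable.\<close>

lemma distr_lborel_shear_fst:
  "distr lborel borel (\<lambda>p::real \<times> real. (fst p + a * snd p, snd p)) = lborel"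
proof -
  have m [measurable]: "(\<lambda>p::real \<times> real. (fst p + a * snd p, snd p)) \<in> borel_measurable borel"
    by (intro borel_measurable_continuous_onI continuous_intros)
  have em: "emeasure (distr lborel borel (\<lambda>p::real \<times> real. (fst p + a * snd p, snd p))) A = emeasure lborel A"
    if A [measurable]: "A \<in> sets borel" for A
  proof -
  have "emeasure (distr lborel borel (\<lambda>p::real \<times> real. (fst p + a * snd p, snd p))) A =
      (\<integral>\<^sup>+p. indicator A p \<partial>distr lborel borel (\<lambda>p::real \<times> real. (fst p + a * snd p, snd p)))"
    by simp
  also have "\<dots> = (\<integral>\<^sup>+p. indicator A (fst p + a * snd p, snd p) \<partial>(lborel \<Otimes>\<^sub>M lborel))"
    by (subst nn_integral_distr) (auto simp: lborel_prod)
  also have "\<dots> = (\<integral>\<^sup>+y. \<integral>\<^sup>+x. indicator A (x + a * y, y) \<partial>lborel \<partial>lborel)"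
  proof -
    have "(\<lambda>p::real \<times> real. indicator A (fst p + a * snd p, snd p) :: ennreal) \<in> borel_measurable (lborel \<Otimes>\<^sub>M lborel)"
      unfolding lborel_prod by measurable
    then show ?thesis by (subst lborel_pair.nn_integral_snd[symmetric]) auto
  qed
  also have "\<dots> = (\<integral>\<^sup>+y. \<integral>\<^sup>+x. indicator A (x, y) \<partial>lborel \<partial>lborel)"
  proof (rule nn_integral_cong)
    fix y :: real
    have "(\<lambda>x. (x, y)) \<in> borel_measurable borel"
      by (intro borel_measurable_continuous_onI continuous_intros)
    then have "(\<lambda>x. indicator A (x, y) :: ennreal) \<in> borel_measurable borel" by measurable
    from nn_integral_real_affine[OF this, of 1 "a * y"]
    show "(\<integral>\<^sup>+x. indicator A (x + a * y, y) \<partial>lborel) = (\<integral>\<^sup>+x. indicator A (x, y) \<partial>lborel)"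
      by (simp add: add.commute)
  qed
  also have "\<dots> = (\<integral>\<^sup>+p. indicator A p \<partial>(lborel \<Otimes>\<^sub>M lborel))"
  proof -
    have "(indicator A :: real \<times> real \<Rightarrow> ennreal) \<in> borel_measurable (lborel \<Otimes>\<^sub>M lborel)"
      unfolding lborel_prod by measurable
    then show ?thesis by (subst lborel_pair.nn_integral_snd[symmetric]) auto
  qed
  finally show ?thesis by (simp add: lborel_prod)
  qed
  show ?thesis by (rule measure_eqI) (simp_all add: em)
qed

lemma distr_lborel_shear_snd:
  "distr lborel borel (\<lambda>p::real \<times> real. (fst p, snd p + a * fst p)) = lborel"
proof -
  have m [measurable]: "(\<lambda>p::real \<times> real. (fst p, snd p + a * fst p)) \<in> borel_measurable borel"
    by (intro borel_measurable_continuous_onI continuous_intros)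
  have em: "emeasure (distr lborel borel (\<lambda>p::real \<times> real. (fst p, snd p + a * fst p))) A = emeasure lborel A"
    if A [measurable]: "A \<in> sets borel" for A
  proof -
  have "emeasure (distr lborel borel (\<lambda>p::real \<times> real. (fst p, snd p + a * fst p))) A =
      (\<integral>\<^sup>+p. indicator A p \<partial>distr lborel borel (\<lambda>p::real \<times> real. (fst p, snd p + a * fst p)))"
    by simp
  also have "\<dots> = (\<integral>\<^sup>+p. indicator A (fst p, snd p + a * fst p) \<partial>(lborel \<Otimes>\<^sub>M lborel))"
    by (subst nn_integral_distr) (auto simp: lborel_prod)
  also have "\<dots> = (\<integral>\<^sup>+x. \<integral>\<^sup>+y. indicator A (x, y + a * x) \<partial>lborel \<partial>lborel)"
  proof -
    have "(\<lambda>p::real \<times> real. indicator A (fst p, snd p + a * fst p) :: ennreal) \<in> borel_measurable (lborel \<Otimes>\<^sub>M lborel)"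
      unfolding lborel_prod by measurable
    then show ?thesis by (subst lborel.nn_integral_fst[symmetric]) auto
  qed
  also have "\<dots> = (\<integral>\<^sup>+x. \<integral>\<^sup>+y. indicator A (x, y) \<partial>lborel \<partial>lborel)"
  proof (rule nn_integral_cong)
    fix x :: real
    have "(\<lambda>y. (x, y)) \<in> borel_measurable borel"
      by (intro borel_measurable_continuous_onI continuous_intros)
    then have "(\<lambda>y. indicator A (x, y) :: ennreal) \<in> borel_measurable borel" by measurable
    from nn_integral_real_affine[OF this, of 1 "a * x"]
    show "(\<integral>\<^sup>+y. indicator A (x, y + a * x) \<partial>lborel) = (\<integral>\<^sup>+y. indicator A (x, y) \<partial>lborel)"
      by (simp add: add.commute)
  qed
  also have "\<dots> = (\<integral>\<^sup>+p. indicator A p \<partial>(lborel \<Otimes>\<^sub>M lborel))"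
  proof -
    have "(indicator A :: real \<times> real \<Rightarrow> ennreal) \<in> borel_measurable (lborel \<Otimes>\<^sub>M lborel)"
      unfolding lborel_prod by measurable
    then show ?thesis by (subst lborel.nn_integral_fst[symmetric]) auto
  qed
  finally show ?thesis by (simp add: lborel_prod)
  qed
  show ?thesis by (rule measure_eqI) (simp_all add: em)
qed

text \<open>A rotation other than \<open>p \<mapsto> - p\<close> is a product of three shears.\<close>

lemma distr_lborel_rot2:
  assumes cs: "c\<^sup>2 + s\<^sup>2 = 1"
  shows "distr lborel borel (rot2 c s) = lborel"
proof -
  have comp: "distr lborel borel (f \<circ> g) = lborel"
    if "distr lborel borel f = lborel" "distr lborel borel g = lborel"
      "f \<in> borel_measurable borel" "g \<in> borel_measurable borel" for f g :: "real \<times> real \<Rightarrow> real \<times> real"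
  proof -
    have "distr lborel borel (f \<circ> g) = distr (distr lborel borel g) borel f"
      using that(3,4) by (subst distr_distr) auto
    then show ?thesis using that(1,2) by simp
  qed
  have gen: "distr lborel borel (rot2 c s) = lborel" if cs: "c\<^sup>2 + s\<^sup>2 = 1" and c1: "c \<noteq> -1" for c s
  proof -
    \<comment> \<open>Minus the tangent of half the angle. The product of the three shears has the
      diagonal entries 1 + a s and the upper corner 2 a + a^2 s; for this \<open>a\<close> they
      become c and - s.\<close>
    define a where "a = - s / (1 + c)"
    have 0: "1 + c \<noteq> 0" using c1 by linarith
    have "a * (1 + c) = - s" using 0 by (simp add: a_def)
    have "(1 + a * s) * (1 + c) = (1 + c) + (a * (1 + c)) * s" by (simp add: algebra_simps)
    also have "\<dots> = c * (1 + c)" using cs \<open>a * (1 + c) = - s\<close> by (simp add: algebra_simps power2_eq_square)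
    finally have 1: "1 + a * s = c" using 0 by simp
    have 2: "2 * a + a * a * s = - s"
    proof -
      have "2 * a + a * a * s = a * (1 + (1 + a * s))" by (simp add: algebra_simps)
      then show ?thesis using 1 \<open>a * (1 + c) = - s\<close> by simp
    qed
    let ?X = "\<lambda>p::real \<times> real. (fst p + a * snd p, snd p)"
    let ?Y = "\<lambda>p::real \<times> real. (fst p, snd p + s * fst p)"
    have "rot2 c s p = (?X \<circ> (?Y \<circ> ?X)) p" for p
    proof -
      have "(?X \<circ> (?Y \<circ> ?X)) p = (fst p * (1 + a * s) + snd p * (2 * a + a * a * s), fst p * s + snd p * (1 + a * s))"
        by (simp add: algebra_simps)
      then show ?thesis unfolding 1 2 by (simp only: rot2_def mult_minus_right add_uminus_conv_diff)
    qed
    then have "rot2 c s = ?X \<circ> (?Y \<circ> ?X)" by blast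
    moreover have "distr lborel borel (?X \<circ> (?Y \<circ> ?X)) = lborel"
      by (intro comp distr_lborel_shear_fst distr_lborel_shear_snd measurable_comp[of _ borel borel _ borel]
          borel_measurable_continuous_onI continuous_intros)
    ultimately show ?thesis by simp
  qed
  show ?thesis
  proof (cases "c = -1")
    case True
    \<comment> \<open>The half turn is two quarter turns, to which the factorization
      applies.\<close>
    then have "rot2 c s = rot2 0 1 \<circ> rot2 0 1"
      using cs by (auto simp: rot2_def)
    then show ?thesis using comp[of "rot2 0 1" "rot2 0 1"] gen[of 0 1] by simp
  qed (use gen cs in auto)
qed

text \<open>Completeness is what makes almost all slices of a Lebesgue integrable function measurable.\<close>

lemma integral_lebesgue_rot2_Fubini:
  fixes H :: "real \<times> real \<Rightarrow> real"
  assumes int: "integrable lebesgue H" and cs: "c\<^sup>2 + s\<^sup>2 = 1"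
  shows "integral\<^sup>L lebesgue H = (LINT t|lebesgue. LINT u|lebesgue. H (rot2 c s (t, u)))"
proof -
  obtain H0 where H0 [measurable]: "H0 \<in> borel_measurable borel" and ae: "AE p in lborel. H p = H0 p"
    using completion_ex_borel_measurable_real[of H lborel] int by auto
  have H0' [measurable]: "H0 \<in> borel_measurable lebesgue" by (rule measurable_completion) simp
  have ae': "AE p in lebesgue. H p = H0 p" using ae by (rule AE_completion)
  have intH0: "integrable lborel H0"
  proof -
    have "integrable lebesgue H0"
      using int ae' by (intro Bochner_Integration.integrable_cong_AE_imp[OF int]) (auto simp: eq_commute)
    then show ?thesis by (simp add: integrable_completion)
  qed
  have "integral\<^sup>L lebesgue H = integral\<^sup>L lebesgue H0"
    using int ae' by (intro integral_cong_AE) auto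
  also have "\<dots> = integral\<^sup>L (distr lborel borel (rot2 c s)) H0"
    by (simp add: integral_completion distr_lborel_rot2[OF cs])
  also have "\<dots> = integral\<^sup>L (lborel \<Otimes>\<^sub>M lborel) (\<lambda>p. H0 (rot2 c s p))"
    by (subst integral_distr) (auto simp: lborel_prod)
  also have "\<dots> = (LINT t|lborel. LINT u|lborel. H0 (rot2 c s (t, u)))"
  proof -
    have "integrable (distr lborel borel (rot2 c s)) H0"
      using intH0 by (simp add: distr_lborel_rot2[OF cs])
    then have "integrable (lborel \<Otimes>\<^sub>M lborel) (\<lambda>p. H0 (rot2 c s p))"
      by (subst (asm) integrable_distr_eq) (auto simp: lborel_prod)
    from lborel_pair.integral_fst'[OF this] show ?thesis by simp
  qed
  also have "\<dots> = (LINT t|lebesgue. LINT u|lborel. H0 (rot2 c s (t, u)))"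
  proof (subst integral_completion)
    have "(\<lambda>p. H0 (rot2 c s p)) \<in> borel_measurable (lborel \<Otimes>\<^sub>M lborel)"
      unfolding lborel_prod by measurable
    from lborel.borel_measurable_lebesgue_integral[of "\<lambda>t u. H0 (rot2 c s (t, u))" lborel] this
    show "(\<lambda>t. LINT u|lborel. H0 (rot2 c s (t, u))) \<in> borel_measurable lborel" by simp
  qed simp
  also have "\<dots> = (LINT t|lebesgue. LINT u|lebesgue. H (rot2 c s (t, u)))"
  proof (rule sym, rule integral_cong_AE)
    \<comment> \<open>The rotation preserves the null set where \<open>H\<close> and
      \<open>H0\<close> differ, and almost all slices of a null set are null.\<close>
    have "AE p in distr lborel borel (rot2 c s). H p = H0 p"
      unfolding distr_lborel_rot2[OF cs] by (rule ae)
    then have "AE p in lborel. H (rot2 c s p) = H0 (rot2 c s p)"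
      by (rule AE_distrD[rotated]) simp
    then have "AE p in lborel \<Otimes>\<^sub>M lborel. H (rot2 c s p) = H0 (rot2 c s p)"
      unfolding lborel_prod .
    then have ae2: "AE t in lborel. AE u in lborel. H (rot2 c s (t, u)) = H0 (rot2 c s (t, u))"
      by (rule lborel_pair.AE_pair)
    have ae3: "AE t in lborel. (LINT u|lebesgue. H (rot2 c s (t, u))) = (LINT u|lborel. H0 (rot2 c s (t, u)))"
      using ae2
    proof eventually_elim
      fix t assume "AE u in lborel. H (rot2 c s (t, u)) = H0 (rot2 c s (t, u))"
      moreover have "(\<lambda>u. rot2 c s (t, u)) \<in> borel_measurable borel"
        unfolding rot2_def by (intro borel_measurable_continuous_onI continuous_intros)
      then have m: "(\<lambda>u. H0 (rot2 c s (t, u))) \<in> borel_measurable borel" by measurable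
      ultimately have "(LINT u|lebesgue. H (rot2 c s (t, u))) = (LINT u|lebesgue. H0 (rot2 c s (t, u)))"
        by (intro integral_cong_AE borel_measurable_lebesgue_cong_AE[OF m] AE_completion measurable_completion) auto
      then show "(LINT u|lebesgue. H (rot2 c s (t, u))) = (LINT u|lborel. H0 (rot2 c s (t, u)))"
        using m by (simp add: integral_completion)
    qed
    have "(\<lambda>p. H0 (rot2 c s p)) \<in> borel_measurable (lborel \<Otimes>\<^sub>M lborel)"
      unfolding lborel_prod by measurable
    from lborel.borel_measurable_lebesgue_integral[of "\<lambda>t u. H0 (rot2 c s (t, u))" lborel] this
    have m: "(\<lambda>t. LINT u|lborel. H0 (rot2 c s (t, u))) \<in> borel_measurable borel" by simp
    show "(\<lambda>t. LINT u|lebesgue. H (rot2 c s (t, u))) \<in> borel_measurable lebesgue"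
      by (rule borel_measurable_lebesgue_cong_AE[OF m ae3])
    show "(\<lambda>t. LINT u|lborel. H0 (rot2 c s (t, u))) \<in> borel_measurable lebesgue"
      using m by (intro measurable_completion) simp
    show "AE t in lebesgue. (LINT u|lebesgue. H (rot2 c s (t, u))) = (LINT u|lborel. H0 (rot2 c s (t, u)))"
      using ae3 by (rule AE_completion)
  qed
  finally show ?thesis .
qed

lemma integral_lebesgue_rot2:
  fixes H :: "real \<times> real \<Rightarrow> 'a :: {banach, second_countable_topology}"
  assumes [measurable]: "H \<in> borel_measurable borel" and cs: "c\<^sup>2 + s\<^sup>2 = 1"
  shows "(LINT p|lebesgue. H (rot2 c s p)) = integral\<^sup>L lebesgue H"
proof -
  have "integral\<^sup>L lebesgue H = integral\<^sup>L (distr lborel borel (rot2 c s)) H"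
    by (simp add: integral_completion distr_lborel_rot2[OF cs])
  also have "\<dots> = (LINT p|lborel. H (rot2 c s p))"
    by (subst integral_distr) auto
  also have "\<dots> = (LINT p|lebesgue. H (rot2 c s p))"
    by (subst integral_completion) auto
  finally show ?thesis by simp
qed

section \<open>The disk, its chords and integration along a direction\<close>

lemma unit_disk_sets [measurable, simp]: "unit_disk \<in> sets borel"
proof -
  have "unit_disk = {p. (fst p)\<^sup>2 + (snd p)\<^sup>2 \<le> 1}" by (auto simp: unit_disk_def)
  moreover have "closed {p :: real \<times> real. (fst p)\<^sup>2 + (snd p)\<^sup>2 \<le> 1}"
    by (intro closed_Collect_le continuous_intros)
  ultimately show ?thesis by (simp add: borel_closed)
qed

lemma rot2_norm:
  assumes "c\<^sup>2 + s\<^sup>2 = 1"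
  shows "(fst (rot2 c s p))\<^sup>2 + (snd (rot2 c s p))\<^sup>2 = (fst p)\<^sup>2 + (snd p)\<^sup>2"
proof -
  have "(fst (rot2 c s p))\<^sup>2 + (snd (rot2 c s p))\<^sup>2 = (c\<^sup>2 + s\<^sup>2) * ((fst p)\<^sup>2 + (snd p)\<^sup>2)"
    by (simp add: rot2_def power2_eq_square algebra_simps)
  then show ?thesis using assms by simp
qed

lemma rot2_in_unit_disk:
  assumes "c\<^sup>2 + s\<^sup>2 = 1"
  shows "rot2 c s p \<in> unit_disk \<longleftrightarrow> p \<in> unit_disk"
  using rot2_norm[OF assms, of p] by (auto simp: unit_disk_def case_prod_beta)

lemma disk_weight_rot2:
  assumes "c\<^sup>2 + s\<^sup>2 = 1"
  shows "disk_weight \<mu> (rot2 c s p) = disk_weight \<mu> p"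
  using rot2_norm[OF assms, of p] by (simp add: disk_weight_def case_prod_beta diff_diff_eq)

lemma notin_unit_disk:
  assumes "t \<notin> {-1..1}"
  shows "(t, u) \<notin> unit_disk"
proof -
  have "t\<^sup>2 > 1" using assms abs_le_square_iff[of t 1] by (auto simp: abs_le_iff)
  then show ?thesis by (simp add: unit_disk_def) (smt (verit) zero_le_power2)
qed

lemma in_unit_disk_chord:
  assumes "t \<in> {-1..1}"
  shows "(t, u) \<in> unit_disk \<longleftrightarrow> u \<in> {- sqrt (1 - t\<^sup>2)..sqrt (1 - t\<^sup>2)}"
  using real_le_rsqrt[of "\<bar>u\<bar>" "1 - t\<^sup>2"] sqrt_ge_absD[of u "1 - t\<^sup>2"]
  by (simp add: unit_disk_def) (smt (verit))

text \<open>In rotated coordinates (t, u) the ridge factor depends on t only and the weight is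
  invariant, so the inner integral over u is the Radon projection times g t. This holds for every t:
  on a slice that is not integrable both sides are 0 by the same default.\<close>

lemma radon_integral:
  assumes int: "integrable (lebesgue_on unit_disk)
      (\<lambda>p. f p * g (fst p * cos \<theta> + snd p * sin \<theta>) * disk_weight \<mu> p)"
  shows "(LINT p|lebesgue_on unit_disk. f p * g (fst p * cos \<theta> + snd p * sin \<theta>) * disk_weight \<mu> p) =
    (LINT t|lebesgue_on {-1..1}. radon \<mu> \<theta> f t * g t)"
proof -
  define H where "H = (\<lambda>p. indicator unit_disk p *\<^sub>R (f p * g (fst p * cos \<theta> + snd p * sin \<theta>) * disk_weight \<mu> p))"
  have cs: "(cos \<theta>)\<^sup>2 + (sin \<theta>)\<^sup>2 = 1" by simp
  have "integrable lebesgue H"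
    using int by (simp add: integrable_restrict_space H_def)
  note F = integral_lebesgue_rot2_Fubini[OF this cs]
  have inner: "(LINT u|lebesgue. H (rot2 (cos \<theta>) (sin \<theta>) (t, u))) = indicator {-1..1} t *\<^sub>R (radon \<mu> \<theta> f t * g t)" for t
  proof -
    have lin: "fst (rot2 (cos \<theta>) (sin \<theta>) (t, u)) * cos \<theta> + snd (rot2 (cos \<theta>) (sin \<theta>) (t, u)) * sin \<theta> = t" for u
    proof -
      have "fst (rot2 (cos \<theta>) (sin \<theta>) (t, u)) * cos \<theta> + snd (rot2 (cos \<theta>) (sin \<theta>) (t, u)) * sin \<theta> =
         t * ((cos \<theta>)\<^sup>2 + (sin \<theta>)\<^sup>2)"
        unfolding rot2_def by (simp only: fst_conv snd_conv) algebra
      then show ?thesis by simp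
    qed
    show ?thesis
    proof (cases "t \<in> {-1..1}")
      case False
      then have "(t, u) \<notin> unit_disk" for u by (rule notin_unit_disk)
      then show ?thesis using False by (simp add: H_def rot2_in_unit_disk[OF cs])
    next
      case True
      note in_unit_disk_chord[OF this]
      then have "H (rot2 (cos \<theta>) (sin \<theta>) (t, u)) = indicator {- sqrt (1 - t\<^sup>2)..sqrt (1 - t\<^sup>2)} u *\<^sub>R
         (f (t * cos \<theta> - u * sin \<theta>, t * sin \<theta> + u * cos \<theta>) * (1 - u\<^sup>2 - t\<^sup>2) powr (\<mu> - 1/2)) * g t" for u
        unfolding H_def lin disk_weight_rot2[OF cs]
        by (simp add: rot2_in_unit_disk[OF cs] indicator_def) (simp add: rot2_def disk_weight_def diff_diff_eq add.commute)
      then show ?thesis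
        using True by (simp add: radon_def integral_restrict_space)
    qed
  qed
  show ?thesis
    using F unfolding inner by (simp add: H_def integral_restrict_space)
qed

subsection \<open>Radon projections of polynomials\<close>

lemma integral_interval_reflect:
  fixes F :: "real \<Rightarrow> real"
  shows "(LINT t|lebesgue_on {-1..1}. F (- t)) = (LINT t|lebesgue_on {-1..1}. F t)"
proof -
  have "(LINT t|lebesgue. indicator {-1..1} t *\<^sub>R F t) = (LINT t|lebesgue. indicator {-1..1} (- t) *\<^sub>R F (- t))"
    by (subst lebesgue_integral_real_affine[of "-1" _ 0]) auto
  also have "\<dots> = (LINT t|lebesgue. indicator {-1..1} t *\<^sub>R F (- t))"
    by (intro Bochner_Integration.integral_cong) (auto simp: indicator_def)
  finally show ?thesis by (simp add: integral_restrict_space)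
qed

lemma powr_one_minus_square:
  fixes t a :: real
  assumes "t \<in> {-1..1}"
  shows "(1 - t\<^sup>2) powr a = jacobi_weight a a t"
proof -
  have "1 - t\<^sup>2 = (1 - t) * (1 + t)" by (simp add: power2_eq_square algebra_simps)
  then show ?thesis using assms by (simp add: jacobi_weight_def powr_mult)
qed

lemma integrable_poly_powr:
  fixes a :: real
  assumes "a > -1"
  shows "integrable (lebesgue_on {-1..1}) (\<lambda>v. poly q v * (1 - v\<^sup>2) powr a)"
  using integrable_poly_jacobi_weight[OF assms assms, of q]
  by (rule Bochner_Integration.integrable_cong[THEN iffD1, rotated -1]) (auto simp: powr_one_minus_square)

text \<open>The moments left over when a chord is scaled to [-1, 1]. The one of index 0 is the
  factor between the value of a polynomial at a boundary point and the value at 1 of the polynomial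
  factor of its projection.\<close>

definition interval_moment :: "real \<Rightarrow> nat \<Rightarrow> real" where
  "interval_moment \<mu> j = (LINT v|lebesgue_on {-1..1}. v ^ j * (1 - v\<^sup>2) powr (\<mu> - 1/2))"

lemma has_bochner_integral_interval_moment:
  assumes "\<mu> \<ge> 0"
  shows "has_bochner_integral (lebesgue_on {-1..1}) (\<lambda>v. v ^ j * (1 - v\<^sup>2) powr (\<mu> - 1/2)) (interval_moment \<mu> j)"
proof -
  have "integrable (lebesgue_on {-1..1}) (\<lambda>v. poly ([:0, 1:] ^ j) v * (1 - v\<^sup>2) powr (\<mu> - 1/2))"
    using assms by (intro integrable_poly_powr) auto
  then show ?thesis by (simp add: interval_moment_def has_bochner_integral_iff)
qed

lemma interval_moment_odd:
  assumes "odd j"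
  shows "interval_moment \<mu> j = 0"
proof -
  have "interval_moment \<mu> j = - interval_moment \<mu> j"
    using integral_interval_reflect[of "\<lambda>v. v ^ j * (1 - v\<^sup>2) powr (\<mu> - 1/2)"] assms
    by (simp add: interval_moment_def)
  then show ?thesis by simp
qed

lemma interval_moment_0:
  assumes "\<mu> \<ge> 0"
  shows "interval_moment \<mu> 0 = 2 powr (2 * \<mu>) * Beta (\<mu> + 1/2) (\<mu> + 1/2)"
proof -
  have "interval_moment \<mu> 0 = (LINT v|lebesgue_on {-1..1}. ((1 - v) / 2) ^ 0 * ((1 + v) / 2) ^ 0 * jacobi_weight (\<mu> - 1/2) (\<mu> - 1/2) v)"
    unfolding interval_moment_def by (intro Bochner_Integration.integral_cong) (auto simp: powr_one_minus_square)
  also have "\<dots> = 2 powr ((\<mu> - 1/2) + (\<mu> - 1/2) + 1) * Beta (\<mu> - 1/2 + 1 + real 0) (\<mu> - 1/2 + 1 + real 0)"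
    using assms by (intro has_bochner_integral_integral_eq has_bochner_integral_jacobi_moment) auto
  also have "\<dots> = 2 powr (2 * \<mu>) * Beta (\<mu> + 1/2) (\<mu> + 1/2)" by (simp add: add.commute)
  finally show ?thesis .
qed

text \<open>Substitute u = r v with r the half chord length: 1 - u^2 - t^2 = r^2 (1 - v^2) gives
  r^(2 \<mu> - 1) from the weight, and du gives another r. This is the origin of (1 - t^2)^\<mu>,
  hence of the Gegenbauer index \<mu> + 1/2.\<close>

lemma has_bochner_integral_chord:
  assumes t: "t \<in> {-1<..<1}"
    and int: "has_bochner_integral (lebesgue_on {-1..1}) (\<lambda>v. h (sqrt (1 - t\<^sup>2) * v) * (1 - v\<^sup>2) powr (\<mu> - 1/2)) I"
  shows "has_bochner_integral (lebesgue_on {- sqrt (1 - t\<^sup>2)..sqrt (1 - t\<^sup>2)})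
    (\<lambda>u. h u * (1 - u\<^sup>2 - t\<^sup>2) powr (\<mu> - 1/2)) ((1 - t\<^sup>2) powr \<mu> * I)"
proof -
  define r where "r = sqrt (1 - t\<^sup>2)"
  have "t\<^sup>2 < 1" using t by (simp add: abs_square_less_1 abs_less_iff)
  then have r: "r > 0" "r\<^sup>2 = 1 - t\<^sup>2" by (simp_all add: r_def)
  let ?g = "\<lambda>u. indicator {-r..r} u *\<^sub>R (h u * (1 - u\<^sup>2 - t\<^sup>2) powr (\<mu> - 1/2))"
  have eq: "?g (0 + r * v) = r powr (2 * \<mu> - 1) * (indicator {-1..1} v *\<^sub>R (h (r * v) * (1 - v\<^sup>2) powr (\<mu> - 1/2)))" for v
  proof (cases "v \<in> {-1..1}")
    case True
    then have "v\<^sup>2 \<le> 1" by (simp add: abs_le_iff abs_square_le_1)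
    have "1 - (r * v)\<^sup>2 - t\<^sup>2 = r\<^sup>2 * (1 - v\<^sup>2)" using r by (simp add: algebra_simps)
    then have "(1 - (r * v)\<^sup>2 - t\<^sup>2) powr (\<mu> - 1/2) = (r\<^sup>2) powr (\<mu> - 1/2) * (1 - v\<^sup>2) powr (\<mu> - 1/2)"
      using \<open>v\<^sup>2 \<le> 1\<close> by (simp add: powr_mult)
    also have "(r\<^sup>2) powr (\<mu> - 1/2) = r powr (2 * \<mu> - 1)"
      using r(1) by (simp add: powr_powr right_diff_distrib flip: powr_numeral)
    finally show ?thesis using True r(1) by (auto simp: indicator_def mult_le_cancel_left_pos[of r] mult_le_cancel_left_pos[of r _ 1, simplified] mult_le_cancel_left_pos[of r "-1", simplified])
  next
    case False
    then have "r * v \<notin> {-r..r}" using r(1) mult_le_cancel_left_pos[of r _ 1] mult_le_cancel_left_pos[of r "-1"] by auto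
    then show ?thesis using False by simp
  qed
  have "has_bochner_integral lebesgue (\<lambda>v. indicator {-1..1} v *\<^sub>R (h (r * v) * (1 - v\<^sup>2) powr (\<mu> - 1/2))) I"
    using int unfolding has_bochner_integral_iff r_def by (simp add: integrable_restrict_space integral_restrict_space)
  then have "has_bochner_integral lebesgue (\<lambda>v. ?g (0 + r * v)) (r powr (2 * \<mu> - 1) * I)"
    unfolding eq by (rule has_bochner_integral_mult_right)
  moreover have "r powr (2 * \<mu> - 1) * I = ((1 - t\<^sup>2) powr \<mu> * I) /\<^sub>R \<bar>r\<bar>"
  proof -
    have "(1 - t\<^sup>2) powr \<mu> = r powr (2 * \<mu>)"
      unfolding r(2)[symmetric] using r(1) by (simp add: powr_powr flip: powr_numeral)
    then show ?thesis using r(1) by (simp add: powr_diff field_simps)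
  qed
  ultimately have "has_bochner_integral lebesgue ?g ((1 - t\<^sup>2) powr \<mu> * I)"
    using has_bochner_integral_lebesgue_real_affine_iff[of r ?g "(1 - t\<^sup>2) powr \<mu> * I" 0] r(1) by simp
  then show ?thesis
    unfolding has_bochner_integral_iff r_def[symmetric] by (simp add: integrable_restrict_space integral_restrict_space)
qed

lemma disk_chord_integral:
  assumes "\<mu> \<ge> 0" "t \<in> {-1<..<1}"
  shows "has_bochner_integral lborel (\<lambda>u. indicator unit_disk (t, u) * disk_weight \<mu> (t, u)) ((1 - t\<^sup>2) powr \<mu> * interval_moment \<mu> 0)"
proof -
  have "has_bochner_integral (lebesgue_on {- sqrt (1 - t\<^sup>2)..sqrt (1 - t\<^sup>2)})
    (\<lambda>u. 1 * (1 - u\<^sup>2 - t\<^sup>2) powr (\<mu> - 1/2)) ((1 - t\<^sup>2) powr \<mu> * interval_moment \<mu> 0)"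
    using has_bochner_integral_interval_moment[OF assms(1), of 0]
    by (intro has_bochner_integral_chord[OF assms(2)]) simp
  moreover have "indicator {- sqrt (1 - t\<^sup>2)..sqrt (1 - t\<^sup>2)} u *\<^sub>R (1 * (1 - u\<^sup>2 - t\<^sup>2) powr (\<mu> - 1/2)) =
      indicator unit_disk (t, u) * disk_weight \<mu> (t, u)" for u
    using in_unit_disk_chord[of t u] assms(2) by (auto simp: indicator_def disk_weight_def diff_diff_eq add.commute)
  ultimately have *: "has_bochner_integral lebesgue (\<lambda>u. indicator unit_disk (t, u) * disk_weight \<mu> (t, u)) ((1 - t\<^sup>2) powr \<mu> * interval_moment \<mu> 0)"
    unfolding has_bochner_integral_iff by (simp add: integrable_restrict_space integral_restrict_space)
  have "(\<lambda>u. (t, u)) \<in> borel_measurable borel"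
    by (intro borel_measurable_continuous_onI continuous_intros)
  then have "(\<lambda>u. indicator unit_disk (t, u) * disk_weight \<mu> (t, u)) \<in> borel_measurable borel"
    unfolding disk_weight_def by measurable
  then show ?thesis using * unfolding has_bochner_integral_iff
    by (simp add: integrable_completion integral_completion)
qed

section \<open>Integrability over the disk\<close>

lemma disk_weight_nonneg: "disk_weight \<mu> p \<ge> 0"
  by (simp add: disk_weight_def case_prod_beta)

lemma measurable_disk_weight [measurable]: "disk_weight \<mu> \<in> borel_measurable borel"
proof -
  have "disk_weight \<mu> = (\<lambda>p. (1 - (fst p)\<^sup>2 - (snd p)\<^sup>2) powr (\<mu> - 1/2))"
    by (auto simp: disk_weight_def)
  then show ?thesis by (simp add: borel_prod[symmetric])
qed

lemma integrable_powr_interval: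
  fixes \<mu> :: real
  assumes "\<mu> \<ge> 0"
  shows "integrable lborel (\<lambda>t. indicator {-1..1} t *\<^sub>R ((1 - t\<^sup>2) powr \<mu>))"
proof -
  have "integrable (lebesgue_on {-1..1}) (\<lambda>v. poly 1 v * (1 - v\<^sup>2) powr \<mu>)"
    using assms by (intro integrable_poly_powr) auto
  then have "integrable lebesgue (\<lambda>t. indicator {-1..1} t *\<^sub>R ((1 - t\<^sup>2) powr \<mu>))"
    by (simp add: integrable_restrict_space)
  then show ?thesis by (subst (asm) integrable_completion) auto
qed

text \<open>For \<mu> < 1/2 the weight is unbounded near the circle, so compactness is not enough.
  The mass of a chord is a multiple of (1 - t^2)^\<mu>, which is integrable in t, and Fubini's
  criterion applies.\<close>

lemma integrable_disk_weight:
  assumes mu: "\<mu> \<ge> 0"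
  shows "integrable (lebesgue_on unit_disk) (disk_weight \<mu>)"
proof -
  let ?H = "\<lambda>p. indicator unit_disk p * disk_weight \<mu> p"
  have mH: "?H \<in> borel_measurable borel" by measurable
  have ae: "AE t in lborel. t \<noteq> (-1::real) \<and> t \<noteq> 1"
    using AE_lborel_singleton[of "-1::real"] AE_lborel_singleton[of "1::real"] by eventually_elim auto
  have hb: "has_bochner_integral lborel (\<lambda>u. ?H (t, u)) (indicator {-1..1} t *\<^sub>R ((1 - t\<^sup>2) powr \<mu> * interval_moment \<mu> 0))"
    if "t \<noteq> -1 \<and> t \<noteq> 1" for t
    using disk_chord_integral[OF mu, of t] notin_unit_disk[of t] that by (cases "t \<in> {-1..1}") (auto simp: indicator_def has_bochner_integral_zero)
  have "integrable (lborel \<Otimes>\<^sub>M lborel) ?H"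
  proof (rule lborel_pair.Fubini_integrable)
    show mH': "?H \<in> borel_measurable (lborel \<Otimes>\<^sub>M lborel)" using mH by (simp add: lborel_prod)
    show "AE t in lborel. integrable lborel (\<lambda>u. ?H (t, u))"
      using ae by eventually_elim (use hb in \<open>auto simp: has_bochner_integral_iff\<close>)
    have nn: "norm (?H p) = ?H p" for p by (simp add: disk_weight_nonneg)
    have "integrable lborel (\<lambda>t. indicator {-1..1} t *\<^sub>R ((1 - t\<^sup>2) powr \<mu>) * interval_moment \<mu> 0)"
      by (intro integrable_mult_left integrable_powr_interval mu)
    then have "integrable lborel (\<lambda>t. indicator {-1..1} t *\<^sub>R ((1 - t\<^sup>2) powr \<mu> * interval_moment \<mu> 0))" by (simp add: mult.assoc)
    then show "integrable lborel (\<lambda>t. LINT u|lborel. norm (?H (t, u)))"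
    proof (rule Bochner_Integration.integrable_cong_AE_imp)
      show "(\<lambda>t. LINT u|lborel. norm (?H (t, u))) \<in> borel_measurable lborel"
        using lborel.borel_measurable_lebesgue_integral[of "\<lambda>t u. ?H (t, u)" lborel] mH' unfolding nn by simp
      show "AE t in lborel. indicator {-1..1} t *\<^sub>R ((1 - t\<^sup>2) powr \<mu> * interval_moment \<mu> 0) = (LINT u|lborel. norm (?H (t, u)))"
        using ae unfolding nn by eventually_elim (use hb in \<open>auto simp: has_bochner_integral_iff\<close>)
    qed
  qed
  then have "integrable lebesgue ?H"
    using mH by (simp add: lborel_prod integrable_completion)
  then show ?thesis by (simp add: integrable_restrict_space)
qed

lemma compact_unit_disk: "compact unit_disk"
proof -
  have "unit_disk = cball (0 :: real \<times> real) 1"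
    by (auto simp: unit_disk_def dist_norm norm_prod_def)
  then show ?thesis using compact_cball[of "0 :: real \<times> real" 1] by metis
qed

lemma integrable_mult_continuous_disk:
  fixes b :: "real \<times> real \<Rightarrow> 'b :: {banach, second_countable_topology}"
  assumes int: "integrable (lebesgue_on unit_disk) F" and b: "continuous_on UNIV b"
  shows "integrable (lebesgue_on unit_disk) (\<lambda>p. F p *\<^sub>R b p)"
proof -
  have "bounded (b ` unit_disk)"
    using compact_continuous_image[OF continuous_on_subset[OF b subset_UNIV] compact_unit_disk] by (rule compact_imp_bounded)
  then obtain C where C: "\<And>p. p \<in> unit_disk \<Longrightarrow> norm (b p) \<le> C"
    by (auto simp: bounded_iff)
  have bm: "b \<in> borel_measurable (lebesgue_on unit_disk)"
    using b by (intro measurable_restrict_space1 measurable_completion) (simp add: borel_measurable_continuous_onI)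
  show ?thesis
  proof (rule Bochner_Integration.integrable_bound)
    show "integrable (lebesgue_on unit_disk) (\<lambda>p. C * F p)"
      using int by simp
    show "(\<lambda>p. F p *\<^sub>R b p) \<in> borel_measurable (lebesgue_on unit_disk)"
      using bm borel_measurable_integrable[OF int] by measurable
    show "AE p in lebesgue_on unit_disk. norm (F p *\<^sub>R b p) \<le> norm (C * F p)"
      using AE_space
    proof eventually_elim
      case (elim p)
      then have "norm (b p) \<le> C" by (intro C) simp
      then have "\<bar>F p\<bar> * norm (b p) \<le> \<bar>F p\<bar> * \<bar>C\<bar>" by (intro mult_left_mono) auto
      then show ?case by (simp add: abs_mult mult.commute)
    qed
  qed
qed

lemma integrable_continuous_disk_weight:
  fixes b :: "real \<times> real \<Rightarrow> 'b :: {banach, second_countable_topology}"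
  assumes "\<mu> \<ge> 0" "continuous_on UNIV b"
  shows "integrable (lebesgue_on unit_disk) (\<lambda>p. disk_weight \<mu> p *\<^sub>R b p)"
  by (intro integrable_mult_continuous_disk integrable_disk_weight assms)

text \<open>The weight has finite mass, so |f| <= f^2 + 1 suffices. This is the form in which f
  enters everything that follows.\<close>

lemma integrable_L2_disk:
  assumes "f \<in> L2_disk \<mu>" "\<mu> \<ge> 0"
  shows "integrable (lebesgue_on unit_disk) (\<lambda>p. f p * disk_weight \<mu> p)"
proof (rule Bochner_Integration.integrable_bound)
  show "integrable (lebesgue_on unit_disk) (\<lambda>p. (f p)\<^sup>2 * disk_weight \<mu> p + disk_weight \<mu> p)"
    using assms integrable_disk_weight by (auto simp: L2_disk_def)
  have "disk_weight \<mu> \<in> borel_measurable (lebesgue_on unit_disk)"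
    using integrable_disk_weight[OF assms(2)] by simp
  moreover have "f \<in> borel_measurable (lebesgue_on unit_disk)" using assms by (simp add: L2_disk_def)
  ultimately show "(\<lambda>p. f p * disk_weight \<mu> p) \<in> borel_measurable (lebesgue_on unit_disk)" by measurable
  show "AE p in lebesgue_on unit_disk. norm (f p * disk_weight \<mu> p) \<le> norm ((f p)\<^sup>2 * disk_weight \<mu> p + disk_weight \<mu> p)"
  proof (intro AE_I2)
    fix p
    have "\<bar>f p\<bar> \<le> (f p)\<^sup>2 + 1" using zero_le_power2[of "\<bar>f p\<bar> - 1"] by (simp add: power2_diff)
    then have "\<bar>f p\<bar> * disk_weight \<mu> p \<le> ((f p)\<^sup>2 + 1) * disk_weight \<mu> p"
      by (intro mult_right_mono disk_weight_nonneg)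
    then show "norm (f p * disk_weight \<mu> p) \<le> norm ((f p)\<^sup>2 * disk_weight \<mu> p + disk_weight \<mu> p)"
      using disk_weight_nonneg[of \<mu> p] by (simp add: abs_mult distrib_right)
  qed
qed

text \<open>The chord is a single point. The value agrees with \<open>0 powr \<mu> = 0\<close>,
  which includes \<mu> = 0, so the formula for polynomials extends to the closed interval.\<close>

lemma radon_endpoint:
  assumes "t\<^sup>2 = 1"
  shows "radon \<mu> \<theta> f t = 0"
  unfolding radon_def using assms by (simp add: integral_eq_zero_null_sets negligible_iff_null_sets[symmetric])

text \<open>At t = 1 the chord has shrunk to (1, 0), so of t^i u^j only j = 0 leaves a trace in the
  value of q at 1. The degree bound is a condition on coefficients because this is closed under sums
  and also covers q = 0 and d = 0.\<close>

lemma chord_polynomial: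
  assumes mu: "\<mu> \<ge> 0" and P: "P \<in> polys_below d"
  shows "\<exists>q. (\<forall>i\<ge>d. coeff q i = 0) \<and> poly q 1 = interval_moment \<mu> 0 * P (1, 0) \<and>
    (\<forall>t\<in>{-1<..<1}. has_bochner_integral (lebesgue_on {- sqrt (1 - t\<^sup>2)..sqrt (1 - t\<^sup>2)})
       (\<lambda>u. P (t, u) * (1 - u\<^sup>2 - t\<^sup>2) powr (\<mu> - 1/2)) ((1 - t\<^sup>2) powr \<mu> * poly q t))"
  using P
proof (induction rule: polys_below_induct)
  case zero
  show ?case by (intro exI[of _ 0]) (auto simp: has_bochner_integral_zero)
next
  case (add F G)
  then obtain q r where q: "\<forall>i\<ge>d. coeff q i = 0" "poly q 1 = interval_moment \<mu> 0 * F (1, 0)"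
     "\<forall>t\<in>{-1<..<1}. has_bochner_integral (lebesgue_on {- sqrt (1 - t\<^sup>2)..sqrt (1 - t\<^sup>2)})
       (\<lambda>u. F (t, u) * (1 - u\<^sup>2 - t\<^sup>2) powr (\<mu> - 1/2)) ((1 - t\<^sup>2) powr \<mu> * poly q t)"
    and r: "\<forall>i\<ge>d. coeff r i = 0" "poly r 1 = interval_moment \<mu> 0 * G (1, 0)"
     "\<forall>t\<in>{-1<..<1}. has_bochner_integral (lebesgue_on {- sqrt (1 - t\<^sup>2)..sqrt (1 - t\<^sup>2)})
       (\<lambda>u. G (t, u) * (1 - u\<^sup>2 - t\<^sup>2) powr (\<mu> - 1/2)) ((1 - t\<^sup>2) powr \<mu> * poly r t)"
    by blast
  show ?case
  proof (intro exI[of _ "q + r"] conjI ballI)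
    fix t :: real assume "t \<in> {-1<..<1}"
    with q(3) r(3) show "has_bochner_integral (lebesgue_on {- sqrt (1 - t\<^sup>2)..sqrt (1 - t\<^sup>2)})
       (\<lambda>u. (F (t, u) + G (t, u)) * (1 - u\<^sup>2 - t\<^sup>2) powr (\<mu> - 1/2)) ((1 - t\<^sup>2) powr \<mu> * poly (q + r) t)"
      unfolding distrib_right poly_add distrib_left by (intro has_bochner_integral_add) auto
  qed (use q r in \<open>auto simp: distrib_left\<close>)
next
  case (cmult c F)
  then obtain q where q: "\<forall>i\<ge>d. coeff q i = 0" "poly q 1 = interval_moment \<mu> 0 * F (1, 0)"
     "\<forall>t\<in>{-1<..<1}. has_bochner_integral (lebesgue_on {- sqrt (1 - t\<^sup>2)..sqrt (1 - t\<^sup>2)})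
       (\<lambda>u. F (t, u) * (1 - u\<^sup>2 - t\<^sup>2) powr (\<mu> - 1/2)) ((1 - t\<^sup>2) powr \<mu> * poly q t)"
    by blast
  show ?case
  proof (intro exI[of _ "smult c q"] conjI ballI)
    fix t :: real assume "t \<in> {-1<..<1}"
    with q(3) show "has_bochner_integral (lebesgue_on {- sqrt (1 - t\<^sup>2)..sqrt (1 - t\<^sup>2)})
       (\<lambda>u. c * F (t, u) * (1 - u\<^sup>2 - t\<^sup>2) powr (\<mu> - 1/2)) ((1 - t\<^sup>2) powr \<mu> * poly (smult c q) t)"
      unfolding poly_smult mult.assoc mult.left_commute[of _ c] by (intro has_bochner_integral_mult_right) auto
  qed (use q in auto)
next
  case (monomial i j)
  \<comment> \<open>Odd powers of u integrate to 0 by symmetry; \<open>[:1, 0, -1:]\<close> is 1 -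
    t^2, the square of the half chord length.\<close>
  define q where "q = (if even j then smult (interval_moment \<mu> j) ([:0, 1:] ^ i * [:1, 0, -1:] ^ (j div 2)) else 0)"
  have "coeff q n = 0" if "n \<ge> d" for n
  proof (cases "even j")
    case True
    have "degree ([:0, 1:] ^ i * [:1, 0, -1::real:] ^ (j div 2)) \<le> i + 2 * (j div 2)"
      by (simp add: degree_mult_eq degree_power_eq)
    also have "\<dots> < n" using monomial that True by simp
    finally show ?thesis by (simp add: q_def coeff_eq_0)
  qed (simp add: q_def)
  moreover have "poly q 1 = interval_moment \<mu> 0 * (fst (1::real, 0::real) ^ i * snd (1::real, 0::real) ^ j)"
    by (cases "j = 0") (auto simp: q_def power_0_left)
  moreover have "has_bochner_integral (lebesgue_on {- sqrt (1 - t\<^sup>2)..sqrt (1 - t\<^sup>2)})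
       (\<lambda>u. (fst (t, u) ^ i * snd (t, u) ^ j) * (1 - u\<^sup>2 - t\<^sup>2) powr (\<mu> - 1/2)) ((1 - t\<^sup>2) powr \<mu> * poly q t)"
    if t: "t \<in> {-1<..<1}" for t
  proof -
    have "t\<^sup>2 < 1" using t by (simp add: abs_square_less_1 abs_less_iff)
    have "sqrt (1 - t\<^sup>2) ^ j * interval_moment \<mu> j = (if even j then interval_moment \<mu> j * (1 - t\<^sup>2) ^ (j div 2) else 0)"
    proof (cases "even j")
      case True
      then obtain m where "j = 2 * m" by blast
      then show ?thesis using \<open>t\<^sup>2 < 1\<close> by (simp add: power_mult)
    qed (simp add: interval_moment_odd)
    then have pq: "poly q t = t ^ i * sqrt (1 - t\<^sup>2) ^ j * interval_moment \<mu> j"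
      by (simp add: q_def mult.assoc power2_eq_square)
    show ?thesis unfolding fst_conv snd_conv
    proof (rule has_bochner_integral_chord[OF t])
      have "has_bochner_integral (lebesgue_on {-1..1}) (\<lambda>v. t ^ i * sqrt (1 - t\<^sup>2) ^ j * (v ^ j * (1 - v\<^sup>2) powr (\<mu> - 1/2))) (poly q t)"
        unfolding pq by (intro has_bochner_integral_mult_right has_bochner_integral_interval_moment mu)
      then show "has_bochner_integral (lebesgue_on {-1..1})
         (\<lambda>v. t ^ i * (sqrt (1 - t\<^sup>2) * v) ^ j * (1 - v\<^sup>2) powr (\<mu> - 1/2)) (poly q t)"
        by (simp add: power_mult_distrib mult.assoc)
    qed
  qed
  ultimately show ?case by (intro exI[of _ q]) blast
qed

lemma radon_polynomial:
  assumes mu: "\<mu> \<ge> 0" and P: "P \<in> polys_below d"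
  shows "\<exists>q. (\<forall>i\<ge>d. coeff q i = 0) \<and> poly q 1 = interval_moment \<mu> 0 * P (cos \<theta>, sin \<theta>) \<and>
    (\<forall>t\<in>{-1..1}. radon \<mu> \<theta> P t = (1 - t\<^sup>2) powr \<mu> * poly q t)"
proof -
  let ?P = "\<lambda>p. P (cos \<theta> * fst p + (- sin \<theta>) * snd p, sin \<theta> * fst p + cos \<theta> * snd p)"
  obtain q where q: "\<forall>i\<ge>d. coeff q i = 0" "poly q 1 = interval_moment \<mu> 0 * ?P (1, 0)"
     "\<And>t. t\<in>{-1<..<1} \<Longrightarrow> has_bochner_integral (lebesgue_on {- sqrt (1 - t\<^sup>2)..sqrt (1 - t\<^sup>2)})
       (\<lambda>u. ?P (t, u) * (1 - u\<^sup>2 - t\<^sup>2) powr (\<mu> - 1/2)) ((1 - t\<^sup>2) powr \<mu> * poly q t)"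
    using chord_polynomial[OF mu polys_below_linear_comp[OF P]] by blast
  have "radon \<mu> \<theta> P t = (1 - t\<^sup>2) powr \<mu> * poly q t" if "t \<in> {-1..1}" for t
  proof (cases "t\<^sup>2 = 1")
    case True
    then show ?thesis by (simp add: radon_endpoint)
  next
    case False
    then have "t \<in> {-1<..<1}" using that by (cases "t = 1"; cases "t = -1") auto
    from has_bochner_integral_integral_eq[OF q(3)[OF this]] show ?thesis
      by (simp add: radon_def mult.commute add.commute)
  qed
  then show ?thesis using q(1,2) by auto
qed

subsection \<open>Radial and angular integrals over the disk\<close>

lemma Gamma_legendre_duplication_real:
  fixes z :: real
  assumes "z > 0"
  shows "Gamma z * Gamma (z + 1/2) = exp ((1 - 2 * z) * ln 2) * sqrt pi * Gamma (2 * z)"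
proof -
  have "complex_of_real z \<notin> \<int>\<^sub>\<le>\<^sub>0" "complex_of_real z + 1/2 \<notin> \<int>\<^sub>\<le>\<^sub>0"
    using assms by (auto elim!: nonpos_Ints_cases simp: complex_eq_iff)
  from Gamma_legendre_duplication[OF this]
  have "Gamma (complex_of_real z) * Gamma (complex_of_real (z + 1/2)) =
     complex_of_real (exp ((1 - 2 * z) * ln 2)) * complex_of_real (sqrt pi) * Gamma (complex_of_real (2 * z))"
    by (simp add: exp_of_real[symmetric])
  then show ?thesis
    unfolding Gamma_complex_of_real of_real_mult[symmetric] of_real_eq_iff .
qed

text \<open>The two factors are the integrals over [-1, 1] of (1 - v^2)^(\<mu> - 1/2) and (1 -
  t^2)^\<mu>, that is, the mass of the disk by chords. Duplication at \<mu> + 1/2 reduces all Gamma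
  values to the one at 2 \<mu> + 1.\<close>

lemma Beta_duplication_product:
  fixes \<mu> :: real
  assumes "\<mu> \<ge> 0"
  shows "2 powr (2 * \<mu>) * Beta (\<mu> + 1/2) (\<mu> + 1/2) * (2 powr (2 * \<mu> + 1) * Beta (\<mu> + 1) (\<mu> + 1)) = pi / (\<mu> + 1/2)"
proof -
  define A B C E where "A = Gamma (\<mu> + 1/2)" and "B = Gamma (\<mu> + 1)" and "C = Gamma (2 * \<mu> + 1)"
    and "E = (2::real) powr (2 * \<mu>)"
  have "A * B = exp ((1 - 2 * (\<mu> + 1/2)) * ln 2) * sqrt pi * Gamma (2 * (\<mu> + 1/2))"
    using Gamma_legendre_duplication_real[of "\<mu> + 1/2"] assms by (simp add: A_def B_def add.assoc)
  also have "exp ((1 - 2 * (\<mu> + 1/2)) * ln 2) = 1 / E"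
  proof -
    have "(1 - 2 * (\<mu> + 1/2)) * ln 2 = - (2 * \<mu> * ln 2)" by simp
    then show ?thesis by (simp only: E_def powr_def exp_minus inverse_eq_divide) simp
  qed
  also have "2 * (\<mu> + 1/2) = 2 * \<mu> + 1" by simp
  finally have AB: "A * B = 1 / E * sqrt pi * C" by (simp add: C_def)
  have G: "Gamma (2 * \<mu> + 2) = (2 * \<mu> + 1) * C"
  proof -
    have "2 * \<mu> + 1 \<notin> \<int>\<^sub>\<le>\<^sub>0" using assms by (auto elim!: nonpos_Ints_cases)
    from Gamma_plus1[OF this] show ?thesis by (simp add: C_def add.assoc)
  qed
  have pos: "C > 0" "E > 0" using assms by (auto simp: C_def E_def intro!: Gamma_real_pos)
  have "2 powr (2 * \<mu>) * Beta (\<mu> + 1/2) (\<mu> + 1/2) * (2 powr (2 * \<mu> + 1) * Beta (\<mu> + 1) (\<mu> + 1)) =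
     E * (A * A / C) * (2 * E * (B * B / ((2 * \<mu> + 1) * C)))"
  proof -
    have s: "\<mu> + 1/2 + (\<mu> + 1/2) = 2 * \<mu> + 1" "\<mu> + 1 + (\<mu> + 1) = 2 * \<mu> + 2" by auto
    show ?thesis unfolding Beta_def s G A_def B_def C_def E_def by (simp add: powr_add)
  qed
  also have "\<dots> = (A * B)\<^sup>2 * (2 * E\<^sup>2) / ((2 * \<mu> + 1) * C\<^sup>2)"
    by (simp add: power2_eq_square mult_ac)
  also have "\<dots> = 2 * pi / (2 * \<mu> + 1)"
    unfolding AB using pos by (simp add: power_mult_distrib power_divide)
  also have "\<dots> = pi / (\<mu> + 1/2)" using assms by (simp add: field_simps)
  finally show ?thesis .
qed

lemma radon_one:
  assumes "\<mu> \<ge> 0" "t \<in> {-1..1}"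
  shows "radon \<mu> \<theta> (\<lambda>_. 1) t = (1 - t\<^sup>2) powr \<mu> * interval_moment \<mu> 0"
proof -
  obtain q where q: "\<forall>i\<ge>1. coeff q i = 0" "poly q 1 = interval_moment \<mu> 0 * 1"
    "\<forall>t\<in>{-1..1}. radon \<mu> \<theta> (\<lambda>_. 1) t = (1 - t\<^sup>2) powr \<mu> * poly q t"
    using radon_polynomial[OF assms(1) polys_below_const[of 1 0], of \<theta>] by auto
  have "degree q = 0" using q(1) by (intro le_antisym degree_le) auto
  then obtain c where "q = [:c:]" by (rule degree_eq_zeroE)
  with q assms(2) show ?thesis by simp
qed

text \<open>Kept apart from the evaluation because in \<open>ridge_kernel_reproducing\<close> the
  two factors arise separately and have to cancel against \<open>disk_const\<close>.\<close>

lemma disk_mass_factorization: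
  assumes mu: "\<mu> \<ge> 0"
  shows "(LINT p|lebesgue_on unit_disk. disk_weight \<mu> p) =
    interval_moment \<mu> 0 * (LINT t|lebesgue_on {-1..1}. jacobi_weight \<mu> \<mu> t)"
proof -
  have "(LINT p|lebesgue_on unit_disk. disk_weight \<mu> p) = (LINT t|lebesgue_on {-1..1}. radon \<mu> 0 (\<lambda>_. 1) t * 1)"
    using radon_integral[of "\<lambda>_. 1" "\<lambda>_. 1" 0 \<mu>] integrable_disk_weight[OF mu] by simp
  also have "\<dots> = (LINT t|lebesgue_on {-1..1}. interval_moment \<mu> 0 * jacobi_weight \<mu> \<mu> t)"
    by (intro Bochner_Integration.integral_cong) (auto simp: radon_one[OF mu] powr_one_minus_square)
  finally show ?thesis by simp
qed

lemma disk_mass: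
  assumes mu: "\<mu> \<ge> 0"
  shows "(LINT p|lebesgue_on unit_disk. disk_weight \<mu> p) = pi / (\<mu> + 1/2)"
proof -
  have "(LINT t|lebesgue_on {-1..1}. jacobi_weight \<mu> \<mu> t) = 2 powr (2 * \<mu> + 1) * Beta (\<mu> + 1) (\<mu> + 1)"
    using mu jacobi_weight_integral[of \<mu> \<mu>] by (simp only: mult_2)
  then show ?thesis
    unfolding disk_mass_factorization[OF mu] interval_moment_0[OF mu]
    by (simp only: Beta_duplication_product[OF mu])
qed

text \<open>The argument 2 r^2 - 1 of the Jacobi polynomials in the basis, as a polynomial on the
  plane. Thus (1 - rad) / 2 = 1 - r^2 and (1 + rad) / 2 = r^2.\<close>

definition rad :: "real \<times> real \<Rightarrow> real" where
  "rad p = 2 * ((fst p)\<^sup>2 + (snd p)\<^sup>2) - 1"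

lemma continuous_on_rad [continuous_intros]: "continuous_on A rad"
  unfolding rad_def by (intro continuous_intros)

text \<open>A factor (1 - r^2)^m only raises \<mu> by m, so each such moment is again the mass of a
  weight.\<close>

lemma disk_radial_moment:
  assumes mu: "\<mu> \<ge> 0"
  shows "has_bochner_integral (lebesgue_on unit_disk) (\<lambda>p. disk_weight \<mu> p * ((1 - rad p) / 2) ^ m) (pi / (\<mu> + 1/2 + real m))"
proof -
  have eq: "disk_weight \<mu> p * ((1 - rad p) / 2) ^ m = disk_weight (\<mu> + real m) p" if "p \<in> unit_disk" for p
  proof -
    let ?x = "1 - (fst p)\<^sup>2 - (snd p)\<^sup>2"
    have "?x \<ge> 0" using that by (auto simp: unit_disk_def)
    have "(1 - rad p) / 2 = ?x" by (simp add: rad_def field_simps)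
    have "?x powr (\<mu> - 1/2) * ?x ^ m = ?x powr (\<mu> + real m - 1/2)"
    proof (cases "?x = 0")
      case False
      then have "?x > 0" using \<open>?x \<ge> 0\<close> by simp
      then have "?x powr (\<mu> - 1/2) * ?x ^ m = ?x powr (\<mu> - 1/2) * ?x powr real m"
        by (simp add: powr_realpow)
      then show ?thesis by (simp only: powr_add[symmetric]) (simp add: algebra_simps)
    qed simp
    then show ?thesis unfolding \<open>(1 - rad p) / 2 = ?x\<close> by (simp add: disk_weight_def case_prod_beta)
  qed
  have "has_bochner_integral (lebesgue_on unit_disk) (disk_weight (\<mu> + real m)) (pi / (\<mu> + 1/2 + real m))"
    using integrable_disk_weight[of "\<mu> + real m"] disk_mass[of "\<mu> + real m"] mu by (simp add: has_bochner_integral_iff add_ac)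
  then show ?thesis
    by (subst has_bochner_integral_cong[OF refl eq refl]) auto
qed

text \<open>This takes the place of polar coordinates with t = 2 r^2 - 1. Both sides are linear in
  q, and on powers of (1 - t) / 2 they are disk masses on the left and Beta values on the
  right.\<close>

lemma disk_radial_integral:
  assumes mu: "\<mu> \<ge> 0"
  shows "(LINT p|lebesgue_on unit_disk. disk_weight \<mu> p * poly q (rad p)) =
    pi / 2 powr (\<mu> + 1/2) * (LINT t|lebesgue_on {-1..1}. poly q t * jacobi_weight (\<mu> - 1/2) 0 t)"
proof -
  define c where "c = (\<lambda>m. coeff (q \<circ>\<^sub>p [:1, -2:]) m)"
  have pq: "poly q t = (\<Sum>m\<le>degree q. c m * ((1 - t) / 2) ^ m)" for t
  proof -
    have "poly q t = poly (q \<circ>\<^sub>p [:1, -2:]) ((1 - t) / 2)" by (simp add: poly_pcompose field_simps)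
    also have "\<dots> = (\<Sum>m\<le>degree q. c m * ((1 - t) / 2) ^ m)"
      by (simp add: poly_altdef degree_pcompose c_def)
    finally show ?thesis .
  qed
  have "(LINT p|lebesgue_on unit_disk. disk_weight \<mu> p * poly q (rad p)) =
      (LINT p|lebesgue_on unit_disk. (\<Sum>m\<le>degree q. c m * (disk_weight \<mu> p * ((1 - rad p) / 2) ^ m)))"
    by (simp add: pq sum_distrib_left mult_ac)
  also have "\<dots> = (\<Sum>m\<le>degree q. c m * (pi / (\<mu> + 1/2 + real m)))"
    by (intro has_bochner_integral_integral_eq has_bochner_integral_sum has_bochner_integral_mult_right disk_radial_moment mu)
  finally have L: "(LINT p|lebesgue_on unit_disk. disk_weight \<mu> p * poly q (rad p)) = (\<Sum>m\<le>degree q. c m * (pi / (\<mu> + 1/2 + real m)))" .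
  have "(LINT t|lebesgue_on {-1..1}. poly q t * jacobi_weight (\<mu> - 1/2) 0 t) =
      (LINT t|lebesgue_on {-1..1}. (\<Sum>m\<le>degree q. c m * (((1 - t) / 2) ^ m * ((1 + t) / 2) ^ 0 * jacobi_weight (\<mu> - 1/2) 0 t)))"
    by (simp add: pq sum_distrib_right mult.assoc)
  also have "\<dots> = (\<Sum>m\<le>degree q. c m * (2 powr (\<mu> - 1/2 + 0 + 1) * Beta (\<mu> - 1/2 + 1 + real m) (0 + 1 + real 0)))"
    by (intro has_bochner_integral_integral_eq has_bochner_integral_sum has_bochner_integral_mult_right has_bochner_integral_jacobi_moment)
       (use mu in auto)
  also have "\<dots> = (\<Sum>m\<le>degree q. c m * (2 powr (\<mu> + 1/2) / (\<mu> + 1/2 + real m)))"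
  proof (rule sum.cong[OF refl])
    fix m
    have nI: "\<mu> + 1/2 + real m \<notin> \<int>\<^sub>\<le>\<^sub>0" using mu by (auto elim!: nonpos_Ints_cases)
    have "Gamma (\<mu> + 1/2 + real m) > 0" using mu by (intro Gamma_real_pos) auto
    then have "Beta (\<mu> + 1/2 + real m) 1 = 1 / (\<mu> + 1/2 + real m)"
      using Gamma_plus1[OF nI] by (simp add: Beta_def)
    moreover have "\<mu> - 1/2 + 1 + real m = \<mu> + 1/2 + real m" "\<mu> - 1/2 + 0 + 1 = \<mu> + 1/2" "0 + 1 + real 0 = 1" by auto
    ultimately show "c m * (2 powr (\<mu> - 1/2 + 0 + 1) * Beta (\<mu> - 1/2 + 1 + real m) (0 + 1 + real 0)) =
       c m * (2 powr (\<mu> + 1/2) / (\<mu> + 1/2 + real m))" by (simp only:) simp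
  qed
  finally show ?thesis unfolding L by (simp add: sum_distrib_left mult_ac)
qed

section \<open>Angular integrals and the orthogonality of Jacobi times harmonic factors\<close>

definition plane_to_complex :: "real \<times> real \<Rightarrow> complex" where
  "plane_to_complex p = Complex (fst p) (snd p)"

lemma plane_to_complex_altdef: "plane_to_complex p = of_real (fst p) + \<i> * of_real (snd p)"
  by (simp add: plane_to_complex_def complex_eq_iff)

lemma continuous_on_plane_to_complex [continuous_intros]: "continuous_on A plane_to_complex"
  unfolding plane_to_complex_altdef by (intro continuous_intros)

lemma plane_to_complex_rot2: "plane_to_complex (rot2 c s p) = plane_to_complex p * Complex c s"
  by (simp add: plane_to_complex_def rot2_def complex_eq_iff)

lemma rad_rot2: "c\<^sup>2 + s\<^sup>2 = 1 \<Longrightarrow> rad (rot2 c s p) = rad p"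
  by (simp add: rad_def rot2_norm)

text \<open>The rotation by \<open>pi / (m - b)\<close> changes the sign of the integrand.\<close>

lemma disk_angular_integral:
  assumes "m \<noteq> b"
  shows "(LINT p|lebesgue_on unit_disk. disk_weight \<mu> p *\<^sub>R
     (complex_of_real (poly q (rad p)) * plane_to_complex p ^ m * cnj (plane_to_complex p) ^ b)) = 0"
proof -
  define H where "H = (\<lambda>p. indicator unit_disk p *\<^sub>R disk_weight \<mu> p *\<^sub>R
     (complex_of_real (poly q (rad p)) * plane_to_complex p ^ m * cnj (plane_to_complex p) ^ b))"
  define \<theta> where "\<theta> = pi / (real m - real b)"
  have cs: "(cos \<theta>)\<^sup>2 + (sin \<theta>)\<^sup>2 = 1" by simp
  have mH: "H \<in> borel_measurable borel"
  proof -
    have "(\<lambda>p. complex_of_real (poly q (rad p)) * plane_to_complex p ^ m * cnj (plane_to_complex p) ^ b) \<in> borel_measurable borel"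
      by (intro borel_measurable_continuous_onI continuous_intros)
    then show ?thesis unfolding H_def by measurable
  qed
  have "real m * \<theta> - real b * \<theta> = pi"
    unfolding left_diff_distrib[symmetric] \<theta>_def using assms by simp
  then have "cis (real m * \<theta> - real b * \<theta>) = -1" by simp
  then have "cis \<theta> ^ m * cnj (cis \<theta>) ^ b = -1"
    by (simp only: cis_cnj Complex.DeMoivre cis_mult) simp
  then have e: "Complex (cos \<theta>) (sin \<theta>) ^ m * cnj (Complex (cos \<theta>) (sin \<theta>)) ^ b = -1"
    by (simp add: cis.ctr)
  have "H (rot2 (cos \<theta>) (sin \<theta>) p) = (Complex (cos \<theta>) (sin \<theta>) ^ m * cnj (Complex (cos \<theta>) (sin \<theta>)) ^ b) * H p" for p
    unfolding H_def plane_to_complex_rot2 rad_rot2[OF cs] disk_weight_rot2[OF cs]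
    by (simp add: rot2_in_unit_disk[OF cs] indicator_def power_mult_distrib mult_ac)
  then have "H (rot2 (cos \<theta>) (sin \<theta>) p) = - H p" for p unfolding e by simp
  then have "integral\<^sup>L lebesgue H = - integral\<^sup>L lebesgue H"
    using integral_lebesgue_rot2[OF mH cs] by simp
  then have "integral\<^sup>L lebesgue H = 0" by simp
  then show ?thesis by (simp add: H_def integral_restrict_space)
qed

text \<open>Unequal exponents vanish by rotation. For b = j + a the powers combine to ((1 + t) /
  2)^(j + a) with t = 2 r^2 - 1: the part of exponent j turns the weight with parameters (\<mu> -
  1/2, 0) into (\<mu> - 1/2, j), and the rest is a test polynomial of degree a, where a < l by the
  degree condition.\<close>

lemma jacobi_disk_orth:
  assumes mu: "\<mu> \<ge> 0" and ab: "a + b < j + 2 * l"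
  shows "(LINT p|lebesgue_on unit_disk. disk_weight \<mu> p *\<^sub>R
     (complex_of_real (poly (jacobi (\<mu> - 1/2) (real j) l) (rad p)) * plane_to_complex p ^ (j + a) * cnj (plane_to_complex p) ^ b)) = 0"
proof (cases "j + a = b")
  case False
  then show ?thesis by (rule disk_angular_integral)
next
  case True
  let ?J = "jacobi (\<mu> - 1/2) (real j) l"
  have al: "a < l" using True ab by simp
  have z: "plane_to_complex p ^ (j + a) * cnj (plane_to_complex p) ^ b = complex_of_real (((1 + rad p) / 2) ^ (j + a))" for p
  proof -
    have "plane_to_complex p * cnj (plane_to_complex p) = complex_of_real ((1 + rad p) / 2)"
      by (simp add: plane_to_complex_def complex_mult_cnj rad_def complex_eq_iff power2_eq_square)
    then have "(plane_to_complex p * cnj (plane_to_complex p)) ^ (j + a) = complex_of_real (((1 + rad p) / 2) ^ (j + a))"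
      by (simp only: of_real_power)
    then show ?thesis using True by (simp add: power_mult_distrib)
  qed
  have jw: "((1 + t) / 2) ^ j * jacobi_weight (\<mu> - 1/2) 0 t = (1/2) ^ j * jacobi_weight (\<mu> - 1/2) (real j) t" if "t \<in> {-1..1}" for t
  \<comment> \<open>At -1 both sides are 0, even for j = 0, because
    \<open>0 powr 0 = 0\<close>.\<close>
  proof (cases "t = -1")
    case True
    then show ?thesis by (simp add: jacobi_weight_def)
  next
    case False
    then have "1 + t > 0" using that by simp
    then show ?thesis by (simp add: jacobi_weight_def powr_realpow power_divide)
  qed
  have "(LINT p|lebesgue_on unit_disk. disk_weight \<mu> p * poly (?J * [:1/2, 1/2:] ^ (j + a)) (rad p)) =
    pi / 2 powr (\<mu> + 1/2) * (LINT t|lebesgue_on {-1..1}. poly (?J * [:1/2, 1/2:] ^ (j + a)) t * jacobi_weight (\<mu> - 1/2) 0 t)"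
    by (rule disk_radial_integral[OF mu])
  also have "(LINT t|lebesgue_on {-1..1}. poly (?J * [:1/2, 1/2:] ^ (j + a)) t * jacobi_weight (\<mu> - 1/2) 0 t) =
     (LINT t|lebesgue_on {-1..1}. (1/2) ^ j * (poly ?J t * poly ([:1/2, 1/2:] ^ a) t * jacobi_weight (\<mu> - 1/2) (real j) t))"
  proof (rule Bochner_Integration.integral_cong[OF refl])
    fix t :: real assume "t \<in> space (lebesgue_on {-1..1})"
    then have "((1 + t) / 2) ^ j * jacobi_weight (\<mu> - 1/2) 0 t = (1/2) ^ j * jacobi_weight (\<mu> - 1/2) (real j) t"
      by (intro jw) simp
    then have "poly ?J t * ((1 + t) / 2) ^ a * (((1 + t) / 2) ^ j * jacobi_weight (\<mu> - 1/2) 0 t) =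
       poly ?J t * ((1 + t) / 2) ^ a * ((1/2) ^ j * jacobi_weight (\<mu> - 1/2) (real j) t)" by simp
    then show "poly (?J * [:1/2, 1/2:] ^ (j + a)) t * jacobi_weight (\<mu> - 1/2) 0 t =
        (1/2) ^ j * (poly ?J t * poly ([:1/2, 1/2:] ^ a) t * jacobi_weight (\<mu> - 1/2) (real j) t)"
      by (simp add: power_add add_divide_distrib mult_ac)
  qed
  also have "\<dots> = 0"
    using mu al by (subst integral_mult_right_zero, subst jacobi_orth) (auto simp: degree_power_eq)
  finally have 0: "(LINT p|lebesgue_on unit_disk. disk_weight \<mu> p * (poly ?J (rad p) * ((1 + rad p) / 2) ^ (j + a))) = 0"
    by (simp add: add_divide_distrib)
  have "(LINT p|lebesgue_on unit_disk. disk_weight \<mu> p *\<^sub>R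
     (complex_of_real (poly ?J (rad p)) * plane_to_complex p ^ (j + a) * cnj (plane_to_complex p) ^ b)) =
     (LINT p|lebesgue_on unit_disk. complex_of_real (disk_weight \<mu> p * (poly ?J (rad p) * ((1 + rad p) / 2) ^ (j + a))))"
    by (simp add: mult.assoc z scaleR_conv_of_real)
  also have "\<dots> = 0" by (simp only: integral_complex_of_real 0 of_real_0)
  finally show ?thesis .
qed

text \<open>In every term the exponents of z and its conjugate add up to i + j, so total degree
  bounds carry over to the complex powers.\<close>

lemma monomial_in_complex_powers:
  fixes x y :: real
  shows "complex_of_real (x ^ i * y ^ j) = (\<Sum>a\<le>i. \<Sum>b\<le>j.
     of_nat (i choose a) * of_nat (j choose b) * (-1) ^ (j - b) / (2 ^ i * (2 * \<i>) ^ j) *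
       (plane_to_complex (x, y) ^ (a + b) * cnj (plane_to_complex (x, y)) ^ (i - a + (j - b))))"
proof -
  let ?z = "plane_to_complex (x, y)"
  have x: "complex_of_real x = (?z + cnj ?z) / 2" and y: "complex_of_real y = (?z + (- cnj ?z)) / (2 * \<i>)"
    by (simp_all add: plane_to_complex_def complex_eq_iff)
  have m: "(- cnj ?z) ^ n = (-1) ^ n * cnj ?z ^ n" for n by (rule power_minus)
  have "complex_of_real (x ^ i * y ^ j) = (?z + cnj ?z) ^ i * (?z + (- cnj ?z)) ^ j / (2 ^ i * (2 * \<i>) ^ j)"
    by (simp only: of_real_mult of_real_power x y power_divide times_divide_times_eq)
  also have "\<dots> = (\<Sum>a\<le>i. \<Sum>b\<le>j. (of_nat (i choose a) * ?z ^ a * cnj ?z ^ (i - a)) *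
      (of_nat (j choose b) * ?z ^ b * ((-1) ^ (j - b) * cnj ?z ^ (j - b))) / (2 ^ i * (2 * \<i>) ^ j))"
    unfolding binomial_ring m sum_product sum_divide_distrib ..
  also have "\<dots> = (\<Sum>a\<le>i. \<Sum>b\<le>j.
     of_nat (i choose a) * of_nat (j choose b) * (-1) ^ (j - b) / (2 ^ i * (2 * \<i>) ^ j) *
       (?z ^ (a + b) * cnj ?z ^ (i - a + (j - b))))"
    by (intro sum.cong refl, simp only: power_add, simp add: mult_ac)
  finally show ?thesis .
qed

text \<open>Complex powers treat the cosine and sine elements of the basis together; they are
  recovered as real and imaginary parts.\<close>

lemma jacobi_disk_orth_polys:
  assumes mu: "\<mu> \<ge> 0" and Q: "Q \<in> polys_below (j + 2 * l)"
  shows "has_bochner_integral (lebesgue_on unit_disk) (\<lambda>p. disk_weight \<mu> p *\<^sub>R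
     (complex_of_real (poly (jacobi (\<mu> - 1/2) (real j) l) (rad p)) * plane_to_complex p ^ j * complex_of_real (Q p))) 0"
  using Q
proof (induction rule: polys_below_induct)
  case zero
  show ?case by (simp add: has_bochner_integral_zero)
next
  case (add F G)
  from has_bochner_integral_add[OF add] show ?case
    by (simp add: distrib_left scaleR_add_right)
next
  case (cmult c F)
  from has_bochner_integral_scaleR_right[OF cmult, of c] show ?case
    by (simp add: scaleR_conv_of_real mult_ac)
next
  case (monomial i' j')
  let ?J = "\<lambda>p. complex_of_real (poly (jacobi (\<mu> - 1/2) (real j) l) (rad p))"
  let ?z = plane_to_complex
  let ?c = "\<lambda>a b. of_nat (i' choose a) * of_nat (j' choose b) * (-1) ^ (j' - b) / (2 ^ i' * (2 * \<i>) ^ j')"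
  have hb: "has_bochner_integral (lebesgue_on unit_disk) (\<lambda>p. disk_weight \<mu> p *\<^sub>R (?J p * ?z p ^ (j + (a + b)) * cnj (?z p) ^ (i' - a + (j' - b)))) 0"
    if "a \<le> i'" "b \<le> j'" for a b
    unfolding has_bochner_integral_iff
  proof
    show "integrable (lebesgue_on unit_disk) (\<lambda>p. disk_weight \<mu> p *\<^sub>R (?J p * ?z p ^ (j + (a + b)) * cnj (?z p) ^ (i' - a + (j' - b))))"
      by (intro integrable_continuous_disk_weight mu continuous_intros)
    show "(LINT p|lebesgue_on unit_disk. disk_weight \<mu> p *\<^sub>R (?J p * ?z p ^ (j + (a + b)) * cnj (?z p) ^ (i' - a + (j' - b)))) = 0"
      using monomial that by (intro jacobi_disk_orth mu) auto
  qed
  have "has_bochner_integral (lebesgue_on unit_disk) (\<lambda>p. \<Sum>a\<le>i'. \<Sum>b\<le>j'. ?c a b *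
     (disk_weight \<mu> p *\<^sub>R (?J p * ?z p ^ (j + (a + b)) * cnj (?z p) ^ (i' - a + (j' - b))))) (\<Sum>a\<le>i'. \<Sum>b\<le>j'. ?c a b * 0)"
    by (intro has_bochner_integral_sum has_bochner_integral_mult_right hb) auto
  moreover have "(\<Sum>a\<le>i'. \<Sum>b\<le>j'. ?c a b *
     (disk_weight \<mu> p *\<^sub>R (?J p * ?z p ^ (j + (a + b)) * cnj (?z p) ^ (i' - a + (j' - b))))) =
     disk_weight \<mu> p *\<^sub>R (?J p * ?z p ^ j * complex_of_real (fst p ^ i' * snd p ^ j'))" for p
    unfolding monomial_in_complex_powers[of "fst p" i' "snd p" j'] prod.collapse scaleR_conv_of_real sum_distrib_left
    by (intro sum.cong refl) (simp add: power_add mult_ac)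
  ultimately show ?case by simp
qed

lemma polys_below_complex_power:
  "(\<lambda>p. Re (plane_to_complex p ^ j)) \<in> polys_below (Suc j) \<and> (\<lambda>p. Im (plane_to_complex p ^ j)) \<in> polys_below (Suc j)"
proof (induction j)
  case 0
  show ?case using polys_below_const[of 1 0] polys_below_zero by simp
next
  case (Suc j)
  have x: "fst \<in> polys_below (Suc 1)" and y: "snd \<in> polys_below (Suc 1)"
    using polys_below_linear[of 1 0 0] polys_below_linear[of 0 1 0] by simp_all
  have "(\<lambda>p. fst p * Re (plane_to_complex p ^ j) - snd p * Im (plane_to_complex p ^ j)) \<in> polys_below (1 + Suc j)"
    by (intro polys_below_diff polys_below_mult x y Suc[THEN conjunct1] Suc[THEN conjunct2])
  moreover have "(\<lambda>p. fst p * Im (plane_to_complex p ^ j) + snd p * Re (plane_to_complex p ^ j)) \<in> polys_below (1 + Suc j)"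
    by (intro polys_below_add polys_below_mult x y Suc[THEN conjunct1] Suc[THEN conjunct2])
  ultimately show ?case by (simp add: plane_to_complex_def)
qed

subsection \<open>The orthogonal polynomials and their ridge kernel\<close>

abbreviation disk_integrable :: "real \<Rightarrow> (real \<times> real \<Rightarrow> real) \<Rightarrow> bool" where
  "disk_integrable \<mu> f \<equiv> integrable (lebesgue_on unit_disk) (\<lambda>p. f p * disk_weight \<mu> p)"

lemma disk_integrable_mult_continuous:
  assumes "disk_integrable \<mu> f" "continuous_on UNIV b"
  shows "disk_integrable \<mu> (\<lambda>p. f p * b p)"
  using integrable_mult_continuous_disk[OF assms] by (simp add: mult.commute mult.left_commute)

lemma disk_integrable_mult:
  assumes "disk_integrable \<mu> f" "P \<in> polys_below d"
  shows "disk_integrable \<mu> (\<lambda>p. f p * P p)"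
  using assms by (intro disk_integrable_mult_continuous polys_below_continuous)

lemma disk_integrable_polys_below:
  assumes "\<mu> \<ge> 0" "P \<in> polys_below d"
  shows "disk_integrable \<mu> P"
  using integrable_continuous_disk_weight[OF assms(1) polys_below_continuous[OF assms(2)]] by (simp add: mult.commute)

lemma disk_inner_commute: "disk_inner \<mu> P Q = disk_inner \<mu> Q P"
  by (simp add: disk_inner_def mult.commute)

lemma disk_inner_cmult_right: "disk_inner \<mu> f (\<lambda>p. c * P p) = c * disk_inner \<mu> f P"
proof -
  have "(\<lambda>p. f p * (c * P p) * disk_weight \<mu> p) = (\<lambda>p. c * (f p * P p * disk_weight \<mu> p))"
    by (simp add: mult_ac)
  then show ?thesis by (simp add: disk_inner_def)
qed

lemma disk_inner_add_right:
  assumes "disk_integrable \<mu> f" "P \<in> polys_below d" "Q \<in> polys_below e"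
  shows "disk_inner \<mu> f (\<lambda>p. P p + Q p) = disk_inner \<mu> f P + disk_inner \<mu> f Q"
  using disk_integrable_mult[OF assms(1,2)] disk_integrable_mult[OF assms(1,3)]
  by (simp add: disk_inner_def distrib_left distrib_right)

lemma disk_inner_diff_left:
  assumes "disk_integrable \<mu> f" "disk_integrable \<mu> g" "P \<in> polys_below d"
  shows "disk_inner \<mu> (\<lambda>p. f p - g p) P = disk_inner \<mu> f P - disk_inner \<mu> g P"
  using disk_integrable_mult[OF assms(1,3)] disk_integrable_mult[OF assms(2,3)]
  by (simp add: disk_inner_def left_diff_distrib right_diff_distrib)

lemma disk_inner_sum_right:
  assumes "disk_integrable \<mu> f" "\<And>i. i \<in> I \<Longrightarrow> P i \<in> polys_below d"
  shows "disk_inner \<mu> f (\<lambda>p. \<Sum>i\<in>I. P i p) = (\<Sum>i\<in>I. disk_inner \<mu> f (P i))"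
  using assms(2)
proof (induction I rule: infinite_finite_induct)
  case (insert i I)
  then show ?case
    using disk_inner_add_right[OF assms(1), of "P i" d "\<lambda>p. \<Sum>i\<in>I. P i p" d] by (simp add: polys_below_sum)
qed (simp_all add: disk_inner_def)

lemma disk_inner_lincomb_right:
  assumes "disk_integrable \<mu> f" "\<And>i. i \<in> I \<Longrightarrow> P i \<in> polys_below d"
  shows "disk_inner \<mu> f (\<lambda>p. \<Sum>i\<in>I. c i * P i p) = (\<Sum>i\<in>I. c i * disk_inner \<mu> f (P i))"
  using disk_inner_sum_right[OF assms(1), of I "\<lambda>i p. c i * P i p" d] assms(2)
  by (simp add: polys_below_cmult disk_inner_cmult_right)

lemma disk_const_pos: "\<mu> \<ge> 0 \<Longrightarrow> disk_const \<mu> > 0"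
  by (simp add: disk_const_def)

text \<open>The integral forces vanishing on the disk only, whereas polynomials are functions on the
  whole plane; lines through the origin carry the conclusion to the remaining points.\<close>

lemma polys_below_inner_self_eq_0:
  assumes mu: "\<mu> \<ge> 0" and P: "P \<in> polys_below d" and 0: "disk_inner \<mu> P P = 0"
  shows "P = (\<lambda>_. 0)"
proof -
  have int: "disk_integrable \<mu> (\<lambda>p. P p * P p)"
    by (rule disk_integrable_mult[OF disk_integrable_polys_below[OF mu P] P])
  have "(LINT p|lebesgue_on unit_disk. P p * P p * disk_weight \<mu> p) = 0"
    using 0 disk_const_pos[OF mu] by (simp add: disk_inner_def)
  then have "AE p in lebesgue_on unit_disk. P p * P p * disk_weight \<mu> p = 0"
    using int by (subst integral_nonneg_eq_0_iff_AE[symmetric]) (auto simp: disk_weight_nonneg)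
  then have ae: "AE p in lebesgue. p \<in> unit_disk \<longrightarrow> P p * P p * disk_weight \<mu> p = 0"
    by (subst (asm) AE_restrict_space_iff) auto
  \<comment> \<open>The circle is excluded because the weight is 0 there. U is open and negligible,
    hence empty.\<close>
  define U where "U = {p. (fst p)\<^sup>2 + (snd p)\<^sup>2 < 1} \<inter> {p. P p \<noteq> 0}"
  have "open U" unfolding U_def
    using polys_below_continuous[OF P] by (intro open_Int open_Collect_less open_Collect_neq continuous_intros) auto
  have "AE p in lebesgue. p \<notin> U"
    using ae
  proof eventually_elim
    case (elim p)
    then show ?case by (cases p) (auto simp: U_def unit_disk_def disk_weight_def)
  qed
  then have "U \<in> null_sets lebesgue"
    using \<open>open U\<close> by (subst (asm) AE_iff_null_sets[symmetric]) (auto simp: sets_completionI_sets)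
  then have "negligible U" by (simp add: negligible_iff_null_sets)
  then have "U = {}" using open_not_negligible[OF \<open>open U\<close>] by blast
  have "P (x, y) = 0" for x y
  proof -
    obtain q where q: "\<And>s. P (0 + s * x, 0 + s * y) = poly q s"
      using polys_below_poly_line[OF P] by blast
    \<comment> \<open>The summand 1 under the root keeps the segment of the points s (x, y), 0 <= s
      <= \<delta>, inside the open disk and also covers the origin.\<close>
    define \<delta> where "\<delta> = 1 / sqrt (1 + x\<^sup>2 + y\<^sup>2)"
    have n: "1 + x\<^sup>2 + y\<^sup>2 > 0" using zero_le_power2[of x] zero_le_power2[of y] by linarith
    then have d: "\<delta> > 0" by (simp add: \<delta>_def)
    have "poly q s = 0" if "s \<in> {0..\<delta>}" for s
    proof -
      have "s\<^sup>2 \<le> \<delta>\<^sup>2" using that by (intro power_mono) auto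
      also have "\<delta>\<^sup>2 = 1 / (1 + x\<^sup>2 + y\<^sup>2)" using n by (simp add: \<delta>_def power_divide)
      finally have "s\<^sup>2 * (1 + x\<^sup>2 + y\<^sup>2) \<le> 1" using n by (simp add: field_simps)
      then have "s\<^sup>2 + ((s * x)\<^sup>2 + (s * y)\<^sup>2) \<le> 1" by (simp add: algebra_simps power_mult_distrib)
      then have "(s * x)\<^sup>2 + (s * y)\<^sup>2 < 1"
      proof (cases "s = 0")
        case False
        then have "s\<^sup>2 > 0" by simp
        with \<open>s\<^sup>2 + ((s * x)\<^sup>2 + (s * y)\<^sup>2) \<le> 1\<close> show ?thesis by linarith
      qed simp
      then have "(s * x, s * y) \<in> U \<or> P (s * x, s * y) = 0" by (simp add: U_def)
      then show ?thesis using q[of s] \<open>U = {}\<close> by simp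
    qed
    then have "{0..\<delta>} \<subseteq> {s. poly q s = 0}" by auto
    moreover have "infinite {0..\<delta>}" using d by (simp add: infinite_Icc)
    ultimately have "q = 0" using poly_roots_finite[of q] finite_subset by blast
    then show ?thesis using q[of 1] by simp
  qed
  then show ?thesis by auto
qed

text \<open>A polynomial of degree below k that is orthogonal to all of these is orthogonal to
  itself, hence 0. So the requirement of exact degree k can be replaced by a linear
  condition.\<close>

lemma orth_polys_iff:
  assumes mu: "\<mu> \<ge> 0"
  shows "P \<in> orth_polys \<mu> k \<longleftrightarrow> P \<in> polys_below (Suc k) \<and> (\<forall>Q\<in>polys_below k. disk_inner \<mu> P Q = 0)"
  using polys_below_inner_self_eq_0[OF mu, of P k] polys_below_zero[of "Suc k"] by (auto simp: orth_polys_def)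

lemma orth_polys_cmult:
  assumes "\<mu> \<ge> 0" "P \<in> orth_polys \<mu> k"
  shows "(\<lambda>p. c * P p) \<in> orth_polys \<mu> k"
  using assms by (auto simp: orth_polys_iff polys_below_cmult disk_inner_cmult_right disk_inner_commute[of _ "\<lambda>p. c * P p"])
    (simp add: disk_inner_commute)

lemma orth_polys_diff:
  assumes mu: "\<mu> \<ge> 0" and P: "P \<in> orth_polys \<mu> k" "Q \<in> orth_polys \<mu> k"
  shows "(\<lambda>p. P p - Q p) \<in> orth_polys \<mu> k"
proof -
  have "disk_inner \<mu> (\<lambda>p. P p - Q p) R = 0" if R: "R \<in> polys_below k" for R
    using P R by (subst disk_inner_diff_left[OF _ _ R])
      (auto simp: orth_polys_iff[OF mu] intro: disk_integrable_polys_below[OF mu])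
  then show ?thesis using P by (auto simp: orth_polys_iff[OF mu] polys_below_diff)
qed

lemma orth_polys_zero: "(\<lambda>_. 0) \<in> orth_polys \<mu> k"
  by (simp add: orth_polys_def disk_inner_def)

lemma orth_polys_sum:
  assumes mu: "\<mu> \<ge> 0" and P: "\<And>i. i \<in> I \<Longrightarrow> P i \<in> orth_polys \<mu> k"
  shows "(\<lambda>p. \<Sum>i\<in>I. P i p) \<in> orth_polys \<mu> k"
  using P
proof (induction I rule: infinite_finite_induct)
  case (insert i I)
  then have "(\<lambda>p. P i p - (-1) * (\<Sum>i\<in>I. P i p)) \<in> orth_polys \<mu> k"
    by (intro orth_polys_diff orth_polys_cmult mu) auto
  with insert show ?case by simp
qed (auto simp: orth_polys_zero)

lemma orth_polys_eqI:
  assumes mu: "\<mu> \<ge> 0" and PQ: "P \<in> orth_polys \<mu> k" "Q \<in> orth_polys \<mu> k"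
    and eq: "\<And>R. R \<in> orth_polys \<mu> k \<Longrightarrow> disk_inner \<mu> P R = disk_inner \<mu> Q R"
  shows "P = Q"
proof -
  let ?D = "\<lambda>p. P p - Q p"
  have D: "?D \<in> orth_polys \<mu> k" by (rule orth_polys_diff[OF mu PQ])
  then have Dp: "?D \<in> polys_below (Suc k)" by (simp add: orth_polys_iff[OF mu])
  have "disk_inner \<mu> ?D ?D = 0"
    using PQ eq[OF D] by (subst disk_inner_diff_left[OF _ _ Dp]) (auto simp: orth_polys_iff[OF mu] intro: disk_integrable_polys_below[OF mu])
  from polys_below_inner_self_eq_0[OF mu Dp this] show ?thesis
    by (metis diff_eq_diff_eq diff_self eq_iff_diff_eq_0 ext)
qed

text \<open>De Moivre: r^j cos (j \<phi>) and r^j sin (j \<phi>) are the real and imaginary parts of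
  z^j. This removes \<open>Arg\<close> and makes the basis visibly polynomial.\<close>

lemma disk_basis_altdef:
  "disk_basis \<mu> k l \<epsilon> p = basis_const \<mu> l k * poly (jacobi (\<mu> - 1/2) (real (k - 2 * l)) l) (rad p) *
     (if \<epsilon> = 0 then Re (plane_to_complex p ^ (k - 2 * l)) else Im (plane_to_complex p ^ (k - 2 * l)))"
proof -
  obtain x y where p: "p = (x, y)" by (cases p)
  define r \<phi> where "r = cmod (Complex x y)" and "\<phi> = Arg (Complex x y)"
  have "plane_to_complex p = rcis r \<phi>"
    by (simp add: plane_to_complex_def p r_def \<phi>_def rcis_cmod_Arg)
  then have z: "plane_to_complex p ^ (k - 2 * l) = rcis (r ^ (k - 2 * l)) (real (k - 2 * l) * \<phi>)"
    by (simp only: DeMoivre2)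
  have "r\<^sup>2 = x\<^sup>2 + y\<^sup>2" by (simp add: r_def cmod_power2)
  then have "2 * r\<^sup>2 - 1 = rad p" by (simp add: rad_def p)
  then show ?thesis
    unfolding z by (simp add: disk_basis_def p Let_def sph_def flip: r_def \<phi>_def)
qed

lemma disk_basis_in_orth_polys:
  assumes mu: "\<mu> \<ge> 0" and l: "2 * l \<le> k"
  shows "disk_basis \<mu> k l \<epsilon> \<in> orth_polys \<mu> k"
proof -
  define j where "j = k - 2 * l"
  have k: "k = j + 2 * l" using l by (simp add: j_def)
  let ?J = "jacobi (\<mu> - 1/2) (real j) l"
  have db: "disk_basis \<mu> k l \<epsilon> = (\<lambda>p. basis_const \<mu> l k * (poly ?J (rad p) *
     (if \<epsilon> = 0 then Re (plane_to_complex p ^ j) else Im (plane_to_complex p ^ j))))"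
    by (auto simp: disk_basis_altdef j_def)
  have dJ: "degree ?J = l" using mu by (intro degree_jacobi) auto
  have radp: "rad \<in> polys_below (Suc 2)"
  proof -
    have "(\<lambda>p. 2 * (fst p ^ 2 * snd p ^ 0 + fst p ^ 0 * snd p ^ 2) - 1) \<in> polys_below (Suc 2)"
      by (intro polys_below_diff polys_below_cmult polys_below_add polys_below_monomial polys_below_const) auto
    then show ?thesis by (simp add: rad_def[abs_def])
  qed
  have "(\<lambda>p. poly ?J (rad p)) \<in> polys_below (Suc (2 * l))"
    by (rule polys_below_poly_comp[OF radp]) (simp add: dJ)
  then have "(\<lambda>p. poly ?J (rad p) * (if \<epsilon> = 0 then Re (plane_to_complex p ^ j) else Im (plane_to_complex p ^ j))) \<in> polys_below (2 * l + Suc j)"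
    using polys_below_complex_power[of j] by (intro polys_below_mult) (cases "\<epsilon> = 0"; simp)+
  then have "(\<lambda>p. poly ?J (rad p) * (if \<epsilon> = 0 then Re (plane_to_complex p ^ j) else Im (plane_to_complex p ^ j))) \<in> orth_polys \<mu> k"
    (is "?B \<in> _")
    unfolding orth_polys_iff[OF mu]
  proof (intro conjI ballI)
    fix Q assume "Q \<in> polys_below k"
    then have hb: "has_bochner_integral (lebesgue_on unit_disk) (\<lambda>p. disk_weight \<mu> p *\<^sub>R
       (complex_of_real (poly ?J (rad p)) * plane_to_complex p ^ j * complex_of_real (Q p))) 0"
      unfolding k by (intro jacobi_disk_orth_polys mu)
    have "(LINT p|lebesgue_on unit_disk. ?B p * Q p * disk_weight \<mu> p) = 0"
    proof (cases "\<epsilon> = 0")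
      case True
      from has_bochner_integral_integral_eq[OF has_bochner_integral_Re[OF hb]] show ?thesis
        using True by (simp add: mult_ac)
    next
      case False
      from has_bochner_integral_integral_eq[OF has_bochner_integral_Im[OF hb]] show ?thesis
        using False by (simp add: mult_ac)
    qed
    then show "disk_inner \<mu> ?B Q = 0" by (simp add: disk_inner_def)
  qed (simp add: k add.commute)
  then show ?thesis unfolding db by (intro orth_polys_cmult mu)
qed

lemma D_angle_in_orth_polys:
  assumes mu: "\<mu> \<ge> 0"
  shows "D_angle \<mu> k \<xi> \<in> orth_polys \<mu> k"
proof -
  have "(\<lambda>p. \<Sum>i\<in>basis_indices k. (kernel_coeff \<mu> (fst i) k * disk_basis \<mu> k (fst i) (snd i) (cos \<xi>, sin \<xi>)) *
     disk_basis \<mu> k (fst i) (snd i) p) \<in> orth_polys \<mu> k"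
    by (intro orth_polys_sum orth_polys_cmult disk_basis_in_orth_polys mu) (auto simp: basis_indices_def)
  then show ?thesis by (simp add: D_angle_def[abs_def] case_prod_beta)
qed

section \<open>Gegenbauer ridge polynomials and reproduction\<close>

lemma gegenbauer_eq:
  assumes mu: "\<mu> \<ge> 0"
  shows "gegenbauer (\<mu> + 1/2) k = smult (pochhammer (2 * \<mu> + 1) k / fact k) (jacobi1 \<mu> \<mu> k)" (is "_ = smult ?c _")
proof -
  have mu': "\<mu> > -1" "\<mu> + \<mu> > -1" using mu by auto
  have c: "?c > 0" using mu by (intro divide_pos_pos pochhammer_pos) auto
  then have c0: "?c \<noteq> 0" by (rule less_imp_neq[THEN not_sym])
  have w: "(LINT s|lebesgue_on {-1..1}. poly p s * poly q s * (1 - s\<^sup>2) powr (\<mu> + 1/2 - 1/2)) =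
     (LINT s|lebesgue_on {-1..1}. poly p s * poly q s * jacobi_weight \<mu> \<mu> s)" for p q
    by (intro Bochner_Integration.integral_cong) (auto simp: powr_one_minus_square)
  have two: "2 * (\<mu> + 1/2) = 2 * \<mu> + 1" by simp
  show ?thesis
    unfolding gegenbauer_def w two
  proof (rule the_equality, intro conjI allI impI)
    show "degree (smult ?c (jacobi1 \<mu> \<mu> k)) = k"
      using c0 degree_jacobi1[OF mu'(1,1,2), of k] by (simp only: degree_smult_eq if_False)
    show "poly (smult ?c (jacobi1 \<mu> \<mu> k)) 1 = ?c" by (simp add: poly_jacobi1_1)
    show "(LINT s|lebesgue_on {-1..1}. poly (smult ?c (jacobi1 \<mu> \<mu> k)) s * poly q s * jacobi_weight \<mu> \<mu> s) = 0"
      if "degree q < k" for q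
      using jacobi1_orth[OF mu'(1,1,2) that] by (simp add: mult.assoc)
  next
    fix p :: "real poly"
    assume p: "degree p = k \<and> (\<forall>q. degree q < k \<longrightarrow> (LINT s|lebesgue_on {-1..1}. poly p s * poly q s * jacobi_weight \<mu> \<mu> s) = 0) \<and>
      poly p 1 = ?c"
    then have "p = smult (poly p 1) (jacobi1 \<mu> \<mu> k)"
      using mu' by (intro orthogonal_poly_unique) auto
    then show "p = smult ?c (jacobi1 \<mu> \<mu> k)" using p by simp
  qed
qed

lemma degree_gegenbauer:
  assumes mu: "\<mu> \<ge> 0"
  shows "degree (gegenbauer (\<mu> + 1/2) k) = k"
proof -
  have "pochhammer (2 * \<mu> + 1) k > 0" using mu by (intro pochhammer_pos) auto
  then show ?thesis
    using degree_jacobi1[of \<mu> \<mu> k] mu by (simp add: gegenbauer_eq)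
qed

definition ridge_kernel :: "real \<Rightarrow> nat \<Rightarrow> real \<Rightarrow> real \<times> real \<Rightarrow> real" where
  "ridge_kernel \<mu> k \<xi> p = (real k + \<mu> + 1/2) / (\<mu> + 1/2) *
     poly (gegenbauer (\<mu> + 1/2) k) (fst p * cos \<xi> + snd p * sin \<xi>)"

lemma polys_below_ridge:
  assumes "degree q < d"
  shows "(\<lambda>p. poly q (fst p * cos \<xi> + snd p * sin \<xi>)) \<in> polys_below d"
proof -
  have "(\<lambda>p. fst p * cos \<xi> + snd p * sin \<xi>) \<in> polys_below (Suc 1)"
    using polys_below_linear[of "cos \<xi>" "sin \<xi>" 0] by (simp add: mult.commute)
  then show ?thesis by (rule polys_below_poly_comp) (use assms in simp)
qed

lemma ridge_kernel_polys_below: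
  assumes "\<mu> \<ge> 0"
  shows "ridge_kernel \<mu> k \<xi> \<in> polys_below (Suc k)"
  unfolding ridge_kernel_def using assms by (intro polys_below_cmult polys_below_ridge) (simp add: degree_gegenbauer)

lemma disk_inner_ridge:
  assumes "disk_integrable \<mu> f"
  shows "disk_inner \<mu> f (\<lambda>p. poly q (fst p * cos \<xi> + snd p * sin \<xi>)) =
    disk_const \<mu> * (LINT t|lebesgue_on {-1..1}. radon \<mu> \<xi> f t * poly q t)"
  unfolding disk_inner_def
  by (subst radon_integral[of f "poly q"]) (auto intro!: disk_integrable_mult_continuous assms continuous_intros)

lemma disk_inner_ridge_kernel:
  assumes "disk_integrable \<mu> f"
  shows "disk_inner \<mu> f (ridge_kernel \<mu> k \<xi>) = (real k + \<mu> + 1/2) / (\<mu> + 1/2) *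
    (disk_const \<mu> * (LINT t|lebesgue_on {-1..1}. radon \<mu> \<xi> f t * poly (gegenbauer (\<mu> + 1/2) k) t))"
  unfolding ridge_kernel_def disk_inner_cmult_right disk_inner_ridge[OF assms] ..

lemma disk_inner_ridge_poly:
  assumes mu: "\<mu> \<ge> 0" and P: "P \<in> polys_below d"
  shows "\<exists>q. (\<forall>i\<ge>d. coeff q i = 0) \<and> poly q 1 = interval_moment \<mu> 0 * P (cos \<xi>, sin \<xi>) \<and>
    (\<forall>r. disk_inner \<mu> P (\<lambda>p. poly r (fst p * cos \<xi> + snd p * sin \<xi>)) =
       disk_const \<mu> * (LINT t|lebesgue_on {-1..1}. poly q t * poly r t * jacobi_weight \<mu> \<mu> t))"
proof -
  obtain q where q: "\<forall>i\<ge>d. coeff q i = 0" "poly q 1 = interval_moment \<mu> 0 * P (cos \<xi>, sin \<xi>)"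
    "\<forall>t\<in>{-1..1}. radon \<mu> \<xi> P t = (1 - t\<^sup>2) powr \<mu> * poly q t"
    using radon_polynomial[OF mu P] by blast
  have "(LINT t|lebesgue_on {-1..1}. radon \<mu> \<xi> P t * poly r t) =
       (LINT t|lebesgue_on {-1..1}. poly q t * poly r t * jacobi_weight \<mu> \<mu> t)" for r
    using q(3) by (intro Bochner_Integration.integral_cong) (auto simp: powr_one_minus_square)
  then have "disk_inner \<mu> P (\<lambda>p. poly r (fst p * cos \<xi> + snd p * sin \<xi>)) =
       disk_const \<mu> * (LINT t|lebesgue_on {-1..1}. poly q t * poly r t * jacobi_weight \<mu> \<mu> t)" for r
    unfolding disk_inner_ridge[OF disk_integrable_polys_below[OF mu P]] by simp
  with q show ?thesis by blast
qed

lemma ridge_kernel_in_orth_polys: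
  assumes mu: "\<mu> \<ge> 0"
  shows "ridge_kernel \<mu> k \<xi> \<in> orth_polys \<mu> k"
  unfolding orth_polys_iff[OF mu]
proof (intro conjI ballI ridge_kernel_polys_below mu)
  fix Q assume "Q \<in> polys_below k"
  from disk_inner_ridge_poly[OF mu this, of \<xi>] obtain q where q: "\<forall>i\<ge>k. coeff q i = 0"
    "\<And>r. disk_inner \<mu> Q (\<lambda>p. poly r (fst p * cos \<xi> + snd p * sin \<xi>)) =
       disk_const \<mu> * (LINT t|lebesgue_on {-1..1}. poly q t * poly r t * jacobi_weight \<mu> \<mu> t)"
    by blast
  have "q = 0 \<or> degree q < k"
    using q(1) by (metis leading_coeff_0_iff not_le)
  then have "(LINT t|lebesgue_on {-1..1}. poly (jacobi1 \<mu> \<mu> k) t * poly q t * jacobi_weight \<mu> \<mu> t) = 0"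
    using mu jacobi1_orth[of \<mu> \<mu> q k] by auto
  moreover have "(\<lambda>t. poly q t * poly (gegenbauer (\<mu> + 1/2) k) t * jacobi_weight \<mu> \<mu> t) =
      (\<lambda>t. (pochhammer (2 * \<mu> + 1) k / fact k) * (poly (jacobi1 \<mu> \<mu> k) t * poly q t * jacobi_weight \<mu> \<mu> t))"
    unfolding gegenbauer_eq[OF mu] by (simp add: mult_ac)
  ultimately have "(LINT t|lebesgue_on {-1..1}. poly q t * poly (gegenbauer (\<mu> + 1/2) k) t * jacobi_weight \<mu> \<mu> t) = 0"
    by simp
  then have "disk_inner \<mu> Q (ridge_kernel \<mu> k \<xi>) = 0"
    unfolding ridge_kernel_def disk_inner_cmult_right q(2) by simp
  then show "disk_inner \<mu> (ridge_kernel \<mu> k \<xi>) Q = 0"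
    by (simp add: disk_inner_commute)
qed

text \<open>With \<open>jacobi1\<close> = C / C(1), this says that (k + \<mu> + 1/2) / (\<mu> + 1/2)
  is C(1) divided by the square norm of C for the normalized weight, which is the origin of this
  factor in \<open>D_kernel\<close>.\<close>

lemma gegenbauer_normalization:
  assumes mu: "\<mu> \<ge> 0"
  shows "(real k + \<mu> + 1/2) / (\<mu> + 1/2) * (pochhammer (2 * \<mu> + 1) k / fact k) *
    jacobi_inner \<mu> \<mu> (jacobi1 \<mu> \<mu> k) (jacobi1 \<mu> \<mu> k) = 1"
proof -
  have pos: "pochhammer (\<mu> + 1) k > 0" "pochhammer (2 * \<mu> + 2) k > 0"
    using mu by (auto intro!: pochhammer_pos)
  have "(2 * \<mu> + 1) * pochhammer (2 * \<mu> + 1 + 1) k = pochhammer (2 * \<mu> + 1) (Suc k)"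
    by (simp add: pochhammer_rec)
  also have "\<dots> = (2 * \<mu> + 1 + real k) * pochhammer (2 * \<mu> + 1) k"
    by (simp add: pochhammer_rec')
  finally have r: "pochhammer (2 * \<mu> + 1) k = (2 * \<mu> + 1) * pochhammer (2 * \<mu> + 2) k / (2 * \<mu> + 1 + real k)"
    using mu by (simp add: field_simps)
  have n: "jacobi_inner \<mu> \<mu> (jacobi1 \<mu> \<mu> k) (jacobi1 \<mu> \<mu> k) =
    fact k * pochhammer (\<mu> + 1) k * (2 * \<mu> + 1 + real k) /
      (pochhammer (\<mu> + 1) k * pochhammer (2 * \<mu> + 2) k * (2 * \<mu> + 1 + 2 * real k))"
  proof -
    have "\<mu> > -1" "\<mu> + \<mu> > -1" using mu by auto
    from jacobi1_norm[OF this(1,1,2), of k] show ?thesis by (simp only: mult_2)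
  qed
  have alg: "h / g * ((2 * g) * B / c / f) * (f * A * c / (A * B * (2 * h))) = 1"
    if "A > 0" "B > 0" "f > 0" "c > 0" "h > 0" "g > 0" for A B f c h g :: real
    using that by (simp add: field_simps)
  have "2 * \<mu> + 1 = 2 * (\<mu> + 1/2)" "2 * \<mu> + 1 + 2 * real k = 2 * (real k + \<mu> + 1/2)" by auto
  then show ?thesis
    unfolding n r by (simp only:) (rule alg, use pos mu in auto)
qed

text \<open>The polynomial factor q of the Radon projection inherits orthogonality to lower degrees,
  so it is q(1) times \<open>jacobi1\<close>, and q(1) is \<open>interval_moment \<mu> 0\<close>
  times the value of P at \<xi>. What remains is a matter of normalizing constants.\<close>

lemma ridge_kernel_reproducing:
  assumes mu: "\<mu> \<ge> 0" and P: "P \<in> orth_polys \<mu> k"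
  shows "disk_inner \<mu> P (ridge_kernel \<mu> k \<xi>) = P (cos \<xi>, sin \<xi>)"
proof -
  have P': "P \<in> polys_below (Suc k)" "\<And>Q. Q \<in> polys_below k \<Longrightarrow> disk_inner \<mu> P Q = 0"
    using P by (auto simp: orth_polys_iff[OF mu])
  from disk_inner_ridge_poly[OF mu P'(1), of \<xi>] obtain q where q: "\<forall>i\<ge>Suc k. coeff q i = 0"
    "poly q 1 = interval_moment \<mu> 0 * P (cos \<xi>, sin \<xi>)"
    "\<And>r. disk_inner \<mu> P (\<lambda>p. poly r (fst p * cos \<xi> + snd p * sin \<xi>)) =
       disk_const \<mu> * (LINT t|lebesgue_on {-1..1}. poly q t * poly r t * jacobi_weight \<mu> \<mu> t)"
    by blast
  have "q = smult (poly q 1) (jacobi1 \<mu> \<mu> k)"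
  proof (rule orthogonal_poly_unique)
    show "degree q \<le> k" using q(1) by (intro degree_le) auto
    show "(LINT t|lebesgue_on {-1..1}. poly q t * poly r t * jacobi_weight \<mu> \<mu> t) = 0" if "degree r < k" for r
      using q(3)[of r] P'(2)[OF polys_below_ridge[OF that]] disk_const_pos[OF mu] by simp
  qed (use mu in auto)
  then obtain c where c: "q = smult c (jacobi1 \<mu> \<mu> k)" "c = interval_moment \<mu> 0 * P (cos \<xi>, sin \<xi>)"
    using q(2) by metis
  let ?W = "LINT t|lebesgue_on {-1..1}. jacobi_weight \<mu> \<mu> t"
  let ?N = "jacobi_inner \<mu> \<mu> (jacobi1 \<mu> \<mu> k) (jacobi1 \<mu> \<mu> k)"
  \<comment> \<open>\<open>disk_const\<close> normalizes the weight to mass 1; here that mass is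
    split into the chord factor and the factor in t.\<close>
  have aW: "disk_const \<mu> * interval_moment \<mu> 0 * ?W = 1"
  proof -
    have "disk_const \<mu> * (interval_moment \<mu> 0 * ?W) = disk_const \<mu> * (pi / (\<mu> + 1/2))"
      using disk_mass_factorization[OF mu] disk_mass[OF mu] by simp
    also have "\<dots> = 1" using mu by (simp add: disk_const_def)
    finally show ?thesis by (simp only: mult.assoc)
  qed
  then have "?W \<noteq> 0" by auto
  then have N: "(LINT t|lebesgue_on {-1..1}. poly (jacobi1 \<mu> \<mu> k) t * poly (jacobi1 \<mu> \<mu> k) t * jacobi_weight \<mu> \<mu> t) = ?N * ?W"
    by (simp add: jacobi_inner_def)
  let ?g = "pochhammer (2 * \<mu> + 1) k / fact k"
  have I: "(LINT t|lebesgue_on {-1..1}. poly q t * poly (gegenbauer (\<mu> + 1/2) k) t * jacobi_weight \<mu> \<mu> t) = c * ?g * (?N * ?W)"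
  proof -
    have "(\<lambda>t. poly q t * poly (gegenbauer (\<mu> + 1/2) k) t * jacobi_weight \<mu> \<mu> t) =
       (\<lambda>t. (c * ?g) * (poly (jacobi1 \<mu> \<mu> k) t * poly (jacobi1 \<mu> \<mu> k) t * jacobi_weight \<mu> \<mu> t))"
      unfolding gegenbauer_eq[OF mu] c(1) by (simp add: mult_ac)
    then show ?thesis by (simp only: integral_mult_right_zero N)
  qed
  have "disk_inner \<mu> P (ridge_kernel \<mu> k \<xi>) = (real k + \<mu> + 1/2) / (\<mu> + 1/2) * (disk_const \<mu> * (c * ?g * (?N * ?W)))"
    unfolding ridge_kernel_def disk_inner_cmult_right q(3) I ..
  also have "\<dots> = ((real k + \<mu> + 1/2) / (\<mu> + 1/2) * ?g * ?N) * (disk_const \<mu> * interval_moment \<mu> 0 * ?W) * P (cos \<xi>, sin \<xi>)"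
    unfolding c(2) by (simp only: mult_ac)
  also have "\<dots> = P (cos \<xi>, sin \<xi>)"
    unfolding gegenbauer_normalization[OF mu] aW by simp
  finally show ?thesis .
qed

text \<open>A polynomial in the space that vanishes on the circle is orthogonal to all ridge kernels, and their
  leading forms \<open>(x + s y)\<^sup>k\<close> span the homogeneous polynomials of degree \<open>k\<close>.\<close>

lemma orth_polys_circle_eq_0:
  assumes mu: "\<mu> \<ge> 0" and P: "P \<in> orth_polys \<mu> k" and circ: "\<And>\<xi>. P (cos \<xi>, sin \<xi>) = 0"
  shows "P = (\<lambda>_. 0)"
proof -
  have P': "P \<in> polys_below (Suc k)" "\<And>Q. Q \<in> polys_below k \<Longrightarrow> disk_inner \<mu> P Q = 0"
    using P by (auto simp: orth_polys_iff[OF mu])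
  have dP: "disk_integrable \<mu> P" by (rule disk_integrable_polys_below[OF mu P'(1)])
  let ?C = "gegenbauer (\<mu> + 1/2) k"
  have ridge: "disk_inner \<mu> P (\<lambda>p. (fst p * cos \<xi> + snd p * sin \<xi>) ^ k) = 0" for \<xi>
  proof -
    define R where "R = ?C - monom (lead_coeff ?C) k"
    have C: "poly ?C t = poly R t + lead_coeff ?C * t ^ k" for t by (simp add: R_def poly_monom)
    have "coeff R i = 0" if "i \<ge> k" for i
      using that degree_gegenbauer[OF mu, of k] by (cases "i = k") (auto simp: R_def coeff_eq_0)
    then have "R = 0 \<or> degree R < k" by (metis leading_coeff_0_iff not_le)
    then have Rp: "(\<lambda>p. poly R (fst p * cos \<xi> + snd p * sin \<xi>)) \<in> polys_below k"
      by (auto simp: polys_below_zero polys_below_ridge)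
    have kp: "(\<lambda>p. (fst p * cos \<xi> + snd p * sin \<xi>) ^ k) \<in> polys_below (Suc k)"
      using polys_below_ridge[of "monom 1 k" "Suc k" \<xi>] by (simp add: poly_monom degree_monom_eq)
    have "disk_inner \<mu> P (ridge_kernel \<mu> k \<xi>) = 0"
      using ridge_kernel_reproducing[OF mu P] circ by simp
    then have "disk_inner \<mu> P (\<lambda>p. poly ?C (fst p * cos \<xi> + snd p * sin \<xi>)) = 0"
      unfolding ridge_kernel_def disk_inner_cmult_right using mu by simp
    then have "disk_inner \<mu> P (\<lambda>p. poly R (fst p * cos \<xi> + snd p * sin \<xi>) + lead_coeff ?C * (fst p * cos \<xi> + snd p * sin \<xi>) ^ k) = 0"
      by (simp only: C)
    then have "lead_coeff ?C * disk_inner \<mu> P (\<lambda>p. (fst p * cos \<xi> + snd p * sin \<xi>) ^ k) = 0"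
      using disk_inner_add_right[OF dP Rp polys_below_cmult[OF kp]] P'(2)[OF Rp] by (simp add: disk_inner_cmult_right)
    moreover have "?C \<noteq> 0"
    proof -
      have "pochhammer (2 * \<mu> + 1) k > 0" using mu by (intro pochhammer_pos) auto
      then show ?thesis using jacobi1_nonzero[of \<mu> \<mu> k] mu by (simp add: gegenbauer_eq)
    qed
    ultimately show ?thesis by simp
  qed
  define M where "M = (\<lambda>i. disk_inner \<mu> P (\<lambda>p. fst p ^ (k - i) * snd p ^ i))"
  \<comment> \<open>The value of q at s is the pairing of P with (x + s y)^k. Each s is the tangent
    of some \<xi>, so it vanishes after division by the power of the cosine; the coefficients of q
    are binomials times the moments of P.\<close>
  define q where "q = (\<Sum>i\<le>k. monom (of_nat (k choose i) * M i) i)"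
  have "poly q s = 0" for s
  proof -
    define \<xi> where "\<xi> = arctan s"
    have c: "cos \<xi> \<noteq> 0" by (simp add: \<xi>_def cos_arctan_not_zero)
    then have s: "sin \<xi> = s * cos \<xi>" using tan_arctan[of s] by (simp add: \<xi>_def tan_def field_simps)
    have "(\<lambda>p. (fst p * cos \<xi> + snd p * sin \<xi>) ^ k) =
       (\<lambda>p. cos \<xi> ^ k * (\<Sum>i\<le>k. (of_nat (k choose i) * s ^ i) * (fst p ^ (k - i) * snd p ^ i)))"
    proof
      fix p :: "real \<times> real"
      have "fst p * cos \<xi> + snd p * sin \<xi> = cos \<xi> * (s * snd p + fst p)" by (simp add: s algebra_simps)
      then have "(fst p * cos \<xi> + snd p * sin \<xi>) ^ k = cos \<xi> ^ k * (s * snd p + fst p) ^ k"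
        by (simp add: power_mult_distrib)
      then show "(fst p * cos \<xi> + snd p * sin \<xi>) ^ k = cos \<xi> ^ k * (\<Sum>i\<le>k. (of_nat (k choose i) * s ^ i) * (fst p ^ (k - i) * snd p ^ i))"
        by (simp add: binomial_ring[of "s * snd p"] power_mult_distrib mult_ac)
    qed
    then have "cos \<xi> ^ k * (\<Sum>i\<le>k. disk_inner \<mu> P (\<lambda>p. (of_nat (k choose i) * s ^ i) * (fst p ^ (k - i) * snd p ^ i))) = 0"
      using ridge[of \<xi>]
      by (simp only: disk_inner_cmult_right) (subst (asm) disk_inner_sum_right[OF dP, where d = "Suc k"],
        auto intro!: polys_below_cmult polys_below_monomial simp: disk_inner_cmult_right)
    then have "(\<Sum>i\<le>k. (of_nat (k choose i) * s ^ i) * M i) = 0"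
      using c by (simp add: disk_inner_cmult_right M_def)
    then show ?thesis by (simp add: q_def poly_sum poly_monom mult_ac)
  qed
  then have "q = 0" using poly_all_0_iff_0 by blast
  have M0: "M i = 0" if "i \<le> k" for i
  proof -
    have "coeff q i = of_nat (k choose i) * M i"
      using that by (simp add: q_def coeff_sum if_distrib cong: if_cong)
    then show ?thesis using \<open>q = 0\<close> that by simp
  qed
  have "disk_inner \<mu> P Q = 0" if "Q \<in> polys_below (Suc k)" for Q
  proof -
    have "Q \<in> polys_below (Suc k) \<and> disk_inner \<mu> P Q = 0"
      using that
    proof (induction rule: polys_below_induct)
      case zero
      then show ?case by (simp add: polys_below_zero disk_inner_def)
    next
      case (add F G)
      then show ?case using disk_inner_add_right[OF dP] by (auto simp: polys_below_add)
    next
      case (cmult c F)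
      then show ?case by (auto simp: polys_below_cmult disk_inner_cmult_right)
    next
      case (monomial i j)
      have "disk_inner \<mu> P (\<lambda>p. fst p ^ i * snd p ^ j) = 0"
      proof (cases "i + j = k")
        case True
        then show ?thesis using M0[of j] by (auto simp: M_def)
      next
        case False
        then show ?thesis using monomial by (intro P'(2) polys_below_monomial) auto
      qed
      then show ?case using monomial by (simp add: polys_below_monomial)
    qed
    then show ?thesis by simp
  qed
  then show ?thesis using P' by (intro polys_below_inner_self_eq_0[OF mu]) auto
qed

subsection \<open>Discretization on the circle\<close>

text \<open>The weight is even, so the reflected polynomial is orthogonal to lower degrees as well
  and hence a multiple of the original; the leading coefficients give the factor (-1)^k.\<close>

lemma gegenbauer_parity:
  assumes mu: "\<mu> \<ge> 0" and "odd (k + i)"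
  shows "coeff (gegenbauer (\<mu> + 1/2) k) i = 0"
proof -
  have mu': "\<mu> > -1" "\<mu> + \<mu> > -1" using mu by auto
  let ?p = "jacobi1 \<mu> \<mu> k"
  let ?r = "?p \<circ>\<^sub>p [:0, -1:]"
  have "?r = smult (poly ?r 1) ?p"
  proof (rule orthogonal_poly_unique[OF mu'(1,1,2)])
    show "degree ?r \<le> k" using degree_jacobi1[OF mu'(1,1,2), of k] by (simp add: degree_pcompose)
    fix q :: "real poly" assume q: "degree q < k"
    have "(LINT t|lebesgue_on {-1..1}. poly ?r t * poly q t * jacobi_weight \<mu> \<mu> t) =
       (LINT t|lebesgue_on {-1..1}. poly ?p (- t) * poly (q \<circ>\<^sub>p [:0, -1:]) (- t) * jacobi_weight \<mu> \<mu> (- t))"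
      by (simp add: poly_pcompose jacobi_weight_def mult_ac)
    also have "\<dots> = (LINT t|lebesgue_on {-1..1}. poly ?p t * poly (q \<circ>\<^sub>p [:0, -1:]) t * jacobi_weight \<mu> \<mu> t)"
      by (rule integral_interval_reflect[of "\<lambda>t. poly ?p t * poly (q \<circ>\<^sub>p [:0, -1:]) t * jacobi_weight \<mu> \<mu> t"])
    also have "\<dots> = 0"
      using q by (intro jacobi1_orth[OF mu'(1,1,2)]) (simp add: degree_pcompose)
    finally show "(LINT t|lebesgue_on {-1..1}. poly ?r t * poly q t * jacobi_weight \<mu> \<mu> t) = 0" .
  qed
  then obtain c where c: "?r = smult c ?p" by blast
  have eq: "(-1) ^ i * coeff ?p i = c * coeff ?p i" for i
    using arg_cong[OF c, of "\<lambda>p. coeff p i"] by (simp add: coeff_pcompose_linear)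
  have "coeff ?p k \<noteq> 0"
    using lead_coeff_jacobi1[OF mu'(1,1,2), of k] degree_jacobi1[OF mu'(1,1,2), of k] by simp
  then have "c = (-1) ^ k" using eq[of k] by simp
  moreover have "(-1) ^ i \<noteq> (-1 :: real) ^ k" using assms(2) by (cases "even k"; cases "even i") auto
  ultimately have "coeff ?p i = 0" using eq[of i] by auto
  then show ?thesis by (simp add: gegenbauer_eq[OF mu])
qed

lemma cos_power_in_exponentials:
  assumes i: "i \<le> k" "even (k + i)"
  shows "\<exists>c. \<forall>\<phi>. complex_of_real (cos \<phi> ^ i) = (\<Sum>m\<le>k. c m * cis ((real k - 2 * real m) * \<phi>))"
proof -
  obtain h where h: "k + i = 2 * h" using i(2) by blast
  \<comment> \<open>The binomial term a has frequency 2 a - i, which equals k - 2 m for m = h - a.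
    The guard \<open>m \<le> h\<close> protects against truncated subtraction.\<close>
  define c where "c = (\<lambda>m. if m \<le> h \<and> h - m \<le> i then of_nat (i choose (h - m)) / 2 ^ i else 0 :: complex)"
  have "complex_of_real (cos \<phi> ^ i) = (\<Sum>m\<le>k. c m * cis ((real k - 2 * real m) * \<phi>))" for \<phi>
  proof -
    have "complex_of_real (cos \<phi>) = (cis \<phi> + cis (- \<phi>)) / 2" by (simp add: complex_eq_iff)
    then have "complex_of_real (cos \<phi> ^ i) = (cis \<phi> + cis (- \<phi>)) ^ i / 2 ^ i"
      by (simp only: of_real_power power_divide)
    also have "\<dots> = (\<Sum>a\<le>i. of_nat (i choose a) * cis \<phi> ^ a * cis (- \<phi>) ^ (i - a)) / 2 ^ i"
      by (simp only: binomial_ring)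
    also have "\<dots> = (\<Sum>a\<le>i. of_nat (i choose a) / 2 ^ i * cis ((2 * real a - real i) * \<phi>))"
      unfolding sum_divide_distrib
    proof (rule sum.cong[OF refl])
      fix a assume "a \<in> {..i}"
      then have "real a * \<phi> + real (i - a) * - \<phi> = (2 * real a - real i) * \<phi>"
        by (simp add: of_nat_diff algebra_simps)
      then have "cis \<phi> ^ a * cis (- \<phi>) ^ (i - a) = cis ((2 * real a - real i) * \<phi>)"
        by (simp only: Complex.DeMoivre cis_mult)
      then show "of_nat (i choose a) * cis \<phi> ^ a * cis (- \<phi>) ^ (i - a) / 2 ^ i = of_nat (i choose a) / 2 ^ i * cis ((2 * real a - real i) * \<phi>)"
        by (simp add: mult.assoc)
    qed
    also have "\<dots> = (\<Sum>m\<in>{m. m \<le> h \<and> h - m \<le> i}. c m * cis ((real k - 2 * real m) * \<phi>))"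
    proof (rule sum.reindex_bij_witness[of _ "\<lambda>m. h - m" "\<lambda>a. h - a"])
      fix a assume "a \<in> {..i}"
      then have "a \<le> h" using h i by simp
      then have "real k - 2 * real (h - a) = 2 * real a - real i"
        using h by (simp add: of_nat_diff)
      then show "c (h - a) * cis ((real k - 2 * real (h - a)) * \<phi>) = of_nat (i choose a) / 2 ^ i * cis ((2 * real a - real i) * \<phi>)"
        using \<open>a \<le> h\<close> \<open>a \<in> {..i}\<close> by (simp only:) (simp add: c_def)
    qed (use h i in auto)
    also have "\<dots> = (\<Sum>m\<le>k. c m * cis ((real k - 2 * real m) * \<phi>))"
      by (rule sum.mono_neutral_left) (use h i in \<open>auto simp: c_def\<close>)
    finally show ?thesis .
  qed
  then show ?thesis by blast
qed

lemma gegenbauer_cos_in_exponentials: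
  assumes mu: "\<mu> \<ge> 0"
  shows "\<exists>c. \<forall>\<phi>. complex_of_real (poly (gegenbauer (\<mu> + 1/2) k) (cos \<phi>)) = (\<Sum>m\<le>k. c m * cis ((real k - 2 * real m) * \<phi>))"
proof -
  let ?C = "gegenbauer (\<mu> + 1/2) k"
  have "\<exists>d. \<forall>i. i \<le> k \<and> even (k + i) \<longrightarrow> (\<forall>\<phi>. complex_of_real (cos \<phi> ^ i) = (\<Sum>m\<le>k. d i m * cis ((real k - 2 * real m) * \<phi>)))"
    using cos_power_in_exponentials[of _ k] by metis
  then obtain d where d: "\<And>i \<phi>. i \<le> k \<Longrightarrow> even (k + i) \<Longrightarrow> complex_of_real (cos \<phi> ^ i) = (\<Sum>m\<le>k. d i m * cis ((real k - 2 * real m) * \<phi>))"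
    by blast
  have "complex_of_real (poly ?C (cos \<phi>)) = (\<Sum>m\<le>k. (\<Sum>i\<le>k. of_real (coeff ?C i) * d i m) * cis ((real k - 2 * real m) * \<phi>))" for \<phi>
  proof -
    have "complex_of_real (poly ?C (cos \<phi>)) = (\<Sum>i\<le>k. of_real (coeff ?C i) * complex_of_real (cos \<phi> ^ i))"
      by (simp add: poly_altdef degree_gegenbauer[OF mu])
    also have "\<dots> = (\<Sum>i\<le>k. of_real (coeff ?C i) * (\<Sum>m\<le>k. d i m * cis ((real k - 2 * real m) * \<phi>)))"
    proof (rule sum.cong[OF refl])
      fix i assume "i \<in> {..k}"
      then show "of_real (coeff ?C i) * complex_of_real (cos \<phi> ^ i) = of_real (coeff ?C i) * (\<Sum>m\<le>k. d i m * cis ((real k - 2 * real m) * \<phi>))"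
        using d[of i \<phi>] gegenbauer_parity[OF mu, of k i] by (cases "even (k + i)") auto
    qed
    also have "\<dots> = (\<Sum>m\<le>k. (\<Sum>i\<le>k. of_real (coeff ?C i) * d i m) * cis ((real k - 2 * real m) * \<phi>))"
      by (simp add: sum_distrib_left sum_distrib_right mult.assoc) (rule sum.swap)
    finally show ?thesis .
  qed
  then show ?thesis by (intro exI[of _ "\<lambda>m. \<Sum>i\<le>k. of_real (coeff ?C i) * d i m"]) blast
qed

text \<open>This is where the \<lambda> come from: multiplied by the squared amplitude of the basis
  function on the circle, they leave the number of distinct frequencies among k - 2 l and its
  negative.\<close>

lemma kernel_coeff_normalization:
  assumes mu: "\<mu> \<ge> 0" and l: "2 * l \<le> k"
  shows "kernel_coeff \<mu> l k * (basis_const \<mu> l k * poly (jacobi (\<mu> - 1/2) (real (k - 2 * l)) l) 1)\<^sup>2 =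
    (if 2 * l < k then 2 else 1)"
proof -
  define j where "j = k - 2 * l"
  have k: "k = j + 2 * l" and kl: "k - l = j + l" using l by (simp_all add: j_def)
  have nI: "\<mu> + 3/2 \<notin> \<int>\<^sub>\<le>\<^sub>0" using mu by (auto elim!: nonpos_Ints_cases)
  have "Gamma (\<mu> + 3/2) > 0" using mu by (intro Gamma_real_pos) auto
  then have G: "Gamma (real k - 2 * real l + \<mu> + 3/2) / (Gamma (\<mu> + 3/2) * Gamma (real k - 2 * real l + 1)) = pochhammer (\<mu> + 3/2) j / fact j"
    using pochhammer_Gamma[OF nI, of j] by (simp add: k add_ac Gamma_fact)
  have bc: "(basis_const \<mu> l k)\<^sup>2 = (if 2 * l < k then 2 else 1) * (pochhammer (\<mu> + 3/2) j / fact j)"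
  proof -
    have "pochhammer (\<mu> + 3/2) j \<ge> 0" using mu by (intro pochhammer_nonneg) auto
    then show ?thesis unfolding basis_const_def G by simp
  qed
  have J: "(poly (jacobi (\<mu> - 1/2) (real j) l) 1)\<^sup>2 =
     pochhammer (\<mu> + 1/2) l * pochhammer (\<mu> + 3/2 + real j) l * (real k + \<mu> + 1/2) /
     (fact l * pochhammer (real j + 1) l * (real j + real l + \<mu> + 1/2))"
  proof -
    have "\<mu> - 1/2 > -1" "real j > -1" "\<mu> - 1/2 + real j > -1" using mu by auto
    from jacobi_at_1_square[OF this, of l] show ?thesis
    proof -
      have "\<mu> - 1/2 + 1 = \<mu> + 1/2" "\<mu> - 1/2 + real j + 2 = \<mu> + 3/2 + real j"
        "\<mu> - 1/2 + real j + 1 + 2 * real l = real k + \<mu> + 1/2" "\<mu> - 1/2 + real j + 1 + real l = real j + real l + \<mu> + 1/2"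
        by (simp_all add: k)
      with \<open>(poly (jacobi (\<mu> - 1/2) (real j) l) 1)\<^sup>2 = _\<close> show ?thesis by (simp only:)
    qed
  qed
  have p: "pochhammer (\<mu> + 3/2) (j + l) = pochhammer (\<mu> + 3/2) j * pochhammer (\<mu> + 3/2 + real j) l"
    by (rule pochhammer_product')
  have f: "(fact (j + l) :: real) = fact j * pochhammer (real j + 1) l"
    using pochhammer_product'[of "1::real" j l] by (simp add: pochhammer_fact add.commute)
  have pos: "pochhammer (\<mu> + 1/2) l > 0" "pochhammer (\<mu> + 3/2) j > 0" "pochhammer (\<mu> + 3/2 + real j) l > 0"
     "pochhammer (real j + 1) l > 0"
    using mu by (auto intro!: pochhammer_pos)
  have alg: "(L * (F * Q) * c / (A * (B * D) * h)) * (w * (B / F) * (A * D * h / (L * Q * c))) = w"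
    if "L > 0" "F > 0" "Q > 0" "c > 0" "A > 0" "B > 0" "D > 0" "h > 0" for L F Q c A B D h w :: real
    using that by simp
  have kc: "kernel_coeff \<mu> l k = fact l * (fact j * pochhammer (real j + 1) l) * (real j + real l + \<mu> + 1/2) /
     (pochhammer (\<mu> + 1/2) l * (pochhammer (\<mu> + 3/2) j * pochhammer (\<mu> + 3/2 + real j) l) * (real k + \<mu> + 1/2))"
    unfolding kernel_coeff_def kl p f by (simp add: k)
  show ?thesis
    unfolding power_mult_distrib bc j_def[symmetric] J kc
    by (rule alg) (use pos mu in auto)
qed

text \<open>This is sin ((k + 1) \<psi>) / sin \<psi>, the Chebyshev polynomial of the second kind
  in cos \<psi>, as a sum over the frequencies k, k - 2, ..., - k.\<close>

definition dirichlet :: "nat \<Rightarrow> real \<Rightarrow> complex" where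
  "dirichlet k \<psi> = (\<Sum>l\<le>k. cis ((real k - 2 * real l) * \<psi>))"

text \<open>The terms l and k - l are conjugate; only the frequency 0, present for even k, is its
  own partner.\<close>

lemma dirichlet_fold:
  "dirichlet k \<psi> = of_real (\<Sum>l\<in>{l. 2 * l \<le> k}. (if 2 * l < k then 2 else 1) * cos (real (k - 2 * l) * \<psi>))"
proof -
  let ?A = "{l. 2 * l < k}" and ?B = "{l. 2 * l = k}" and ?C = "{l. l \<le> k \<and> k < 2 * l}"
  let ?e = "\<lambda>l. cis ((real k - 2 * real l) * \<psi>)"
  have fin: "finite ?A" "finite ?B" "finite ?C"
    by (auto intro: finite_subset[of _ "{..k}"])
  have "{..k} = (?A \<union> ?B) \<union> ?C" by auto
  then have "dirichlet k \<psi> = (\<Sum>l\<in>(?A \<union> ?B) \<union> ?C. ?e l)" by (simp only: dirichlet_def)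
  also have "\<dots> = (\<Sum>l\<in>?A. ?e l) + (\<Sum>l\<in>?B. ?e l) + (\<Sum>l\<in>?C. ?e l)"
    using fin by (subst sum.union_disjoint, auto)+
  also have "(\<Sum>l\<in>?C. ?e l) = (\<Sum>l\<in>?A. cnj (?e l))"
  proof (rule sum.reindex_bij_witness[of _ "\<lambda>l. k - l" "\<lambda>l. k - l"])
    fix l assume l: "l \<in> ?C"
    then have "(real k - 2 * real (k - l)) * \<psi> = - ((real k - 2 * real l) * \<psi>)"
      by (simp add: of_nat_diff algebra_simps)
    then show "cnj (?e (k - l)) = ?e l" by (simp only: cis_cnj minus_minus)
  qed auto
  also have "(\<Sum>l\<in>?A. ?e l) + (\<Sum>l\<in>?B. ?e l) + (\<Sum>l\<in>?A. cnj (?e l)) =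
     (\<Sum>l\<in>?A. of_real (2 * cos (real (k - 2 * l) * \<psi>))) + (\<Sum>l\<in>?B. of_real (1 * cos (real (k - 2 * l) * \<psi>)))"
  proof -
    have "(\<Sum>l\<in>?A. ?e l) + (\<Sum>l\<in>?A. cnj (?e l)) = (\<Sum>l\<in>?A. of_real (2 * cos (real (k - 2 * l) * \<psi>)))"
      unfolding sum.distrib[symmetric]
      by (rule sum.cong[OF refl]) (auto simp: complex_eq_iff of_nat_diff)
    moreover have "(\<Sum>l\<in>?B. ?e l) = (\<Sum>l\<in>?B. of_real (1 * cos (real (k - 2 * l) * \<psi>)))"
      by (rule sum.cong[OF refl]) (auto simp: complex_eq_iff)
    ultimately show ?thesis by (simp add: algebra_simps)
  qed
  also have "\<dots> = (\<Sum>l\<in>?A \<union> ?B. of_real ((if 2 * l < k then 2 else 1) * cos (real (k - 2 * l) * \<psi>)))"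
    using fin by (subst sum.union_disjoint) (auto intro!: sum.cong)
  also have "?A \<union> ?B = {l. 2 * l \<le> k}" by auto
  finally show ?thesis by simp
qed

lemma D_angle_circle:
  assumes mu: "\<mu> \<ge> 0"
  shows "complex_of_real (D_angle \<mu> k \<xi> (cos \<eta>, sin \<eta>)) = dirichlet k (\<xi> - \<eta>)"
proof -
  define b where "b = (\<lambda>l. basis_const \<mu> l k * poly (jacobi (\<mu> - 1/2) (real (k - 2 * l)) l) 1)"
  have db: "disk_basis \<mu> k l \<epsilon> (cos \<theta>, sin \<theta>) = b l * sph (k - 2 * l) \<epsilon> \<theta>" for l \<epsilon> \<theta>
  proof -
    have "plane_to_complex (cos \<theta>, sin \<theta>) = cis \<theta>" by (simp add: plane_to_complex_def cis.ctr)
    then have z: "plane_to_complex (cos \<theta>, sin \<theta>) ^ (k - 2 * l) = cis (real (k - 2 * l) * \<theta>)"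
      by (simp only: Complex.DeMoivre)
    have "rad (cos \<theta>, sin \<theta>) = 1" by (simp add: rad_def)
    then show ?thesis unfolding disk_basis_altdef z by (simp add: b_def sph_def)
  qed
  let ?g = "\<lambda>l \<epsilon>. (kernel_coeff \<mu> l k * (b l)\<^sup>2) * (sph (k - 2 * l) \<epsilon> \<xi> * sph (k - 2 * l) \<epsilon> \<eta>)"
  have "D_angle \<mu> k \<xi> (cos \<eta>, sin \<eta>) = (\<Sum>(l, \<epsilon>) \<in> basis_indices k. ?g l \<epsilon>)"
    unfolding D_angle_def db by (simp add: power2_eq_square mult_ac)
  \<comment> \<open>The pair (l, 1) with 2 l = k is not in \<open>basis_indices\<close> but would
    contribute sin 0 = 0, so the index set may be completed to a product.\<close>
  also have "\<dots> = (\<Sum>(l, \<epsilon>) \<in> {l. 2 * l \<le> k} \<times> {0, 1}. ?g l \<epsilon>)"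
  proof (rule sum.mono_neutral_left)
    have "finite {l. 2 * l \<le> k}" by (rule finite_subset[of _ "{..k}"]) auto
    then show "finite ({l. 2 * l \<le> k} \<times> {0, 1::nat})" by simp
    show "basis_indices k \<subseteq> {l. 2 * l \<le> k} \<times> {0, 1}" by (auto simp: basis_indices_def)
    show "\<forall>i\<in>{l. 2 * l \<le> k} \<times> {0, 1} - basis_indices k. (case i of (l, \<epsilon>) \<Rightarrow> ?g l \<epsilon>) = 0"
      by (auto simp: basis_indices_def sph_def)
  qed
  also have "\<dots> = (\<Sum>l\<in>{l. 2 * l \<le> k}. \<Sum>\<epsilon>\<in>{0, 1}. ?g l \<epsilon>)"
    by (rule sum.cartesian_product[symmetric])
  also have "\<dots> = (\<Sum>l\<in>{l. 2 * l \<le> k}. (if 2 * l < k then 2 else 1) * cos (real (k - 2 * l) * (\<xi> - \<eta>)))"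
  proof (rule sum.cong[OF refl])
    fix l assume "l \<in> {l. 2 * l \<le> k}"
    then have kc: "kernel_coeff \<mu> l k * (b l)\<^sup>2 = (if 2 * l < k then 2 else 1)"
      unfolding b_def by (intro kernel_coeff_normalization mu) simp
    have "cos (real (k - 2 * l) * (\<xi> - \<eta>)) = sph (k - 2 * l) 0 \<xi> * sph (k - 2 * l) 0 \<eta> + sph (k - 2 * l) 1 \<xi> * sph (k - 2 * l) 1 \<eta>"
      by (simp add: sph_def right_diff_distrib cos_diff)
    then show "(\<Sum>\<epsilon>\<in>{0, 1}. ?g l \<epsilon>) = (if 2 * l < k then 2 else 1) * cos (real (k - 2 * l) * (\<xi> - \<eta>))"
      unfolding kc by (simp add: distrib_left)
  qed
  finally show ?thesis by (simp only: dirichlet_fold)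
qed

text \<open>Exactness concerns even frequencies up to 2 k, because exponentials of frequencies k - 2
  m and k - 2 l multiply to frequency 2 (k - m - l).\<close>

definition exact_nodes :: "nat \<Rightarrow> nat \<Rightarrow> (nat \<Rightarrow> real) \<Rightarrow> bool" where
  "exact_nodes k N \<xi> \<longleftrightarrow> N > 0 \<and> (\<forall>a::int. a \<noteq> 0 \<and> \<bar>a\<bar> \<le> int k \<longrightarrow> (\<Sum>\<nu><N. cis (2 * of_int a * \<xi> \<nu>)) = 0)"

text \<open>Summation over the nodes retains only the Dirichlet term l = k - m, whose frequency is
  opposite to k - 2 m: a discrete convolution.\<close>

lemma exact_nodes_dirichlet:
  assumes ex: "exact_nodes k N \<xi>" and m: "m \<le> k"
  shows "(\<Sum>\<nu><N. cis ((real k - 2 * real m) * (\<xi> \<nu> - \<zeta>)) * dirichlet k (\<xi> \<nu> - \<eta>)) =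
    of_nat N * cis ((real k - 2 * real m) * (\<eta> - \<zeta>))"
proof -
  let ?a = "\<lambda>l. int k - int m - int l"
  let ?s = "\<lambda>l. - ((real k - 2 * real m) * \<zeta>) - (real k - 2 * real l) * \<eta>"
  have "cis ((real k - 2 * real m) * (\<xi> \<nu> - \<zeta>)) * dirichlet k (\<xi> \<nu> - \<eta>) = (\<Sum>l\<le>k. cis (?s l) * cis (2 * of_int (?a l) * \<xi> \<nu>))" for \<nu>
    unfolding dirichlet_def sum_distrib_left cis_mult by (intro sum.cong refl arg_cong[of _ _ cis]) (simp add: algebra_simps)
  then have "(\<Sum>\<nu><N. cis ((real k - 2 * real m) * (\<xi> \<nu> - \<zeta>)) * dirichlet k (\<xi> \<nu> - \<eta>)) =
     (\<Sum>l\<le>k. cis (?s l) * (\<Sum>\<nu><N. cis (2 * of_int (?a l) * \<xi> \<nu>)))"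
    by (simp only: sum_distrib_left) (rule sum.swap)
  also have "\<dots> = (\<Sum>l\<in>{k - m}. cis (?s l) * (\<Sum>\<nu><N. cis (2 * of_int (?a l) * \<xi> \<nu>)))"
  proof (rule sum.mono_neutral_right)
    show "\<forall>l\<in>{..k} - {k - m}. cis (?s l) * (\<Sum>\<nu><N. cis (2 * of_int (?a l) * \<xi> \<nu>)) = 0"
    proof
      fix l assume "l \<in> {..k} - {k - m}"
      then have "?a l \<noteq> 0" "\<bar>?a l\<bar> \<le> int k" using m by auto
      then show "cis (?s l) * (\<Sum>\<nu><N. cis (2 * of_int (?a l) * \<xi> \<nu>)) = 0"
        using ex unfolding exact_nodes_def by (metis mult_zero_right)
    qed
  qed auto
  also have "\<dots> = of_nat N * cis (?s (k - m))" using m by (simp add: of_nat_diff)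
  also have "?s (k - m) = (real k - 2 * real m) * (\<eta> - \<zeta>)"
    using m by (simp add: of_nat_diff algebra_simps)
  finally show ?thesis .
qed

section \<open>Node expansions and the projection\<close>

lemma ridge_kernel_circle:
  "ridge_kernel \<mu> k \<xi> (cos \<zeta>, sin \<zeta>) = (real k + \<mu> + 1/2) / (\<mu> + 1/2) * poly (gegenbauer (\<mu> + 1/2) k) (cos (\<xi> - \<zeta>))"
  by (simp add: ridge_kernel_def cos_diff mult.commute)

text \<open>Both sides lie in the space, so agreement on the circle is enough. There the left side
  is a sum of exponentials of frequencies k - 2 m in \<eta> - \<zeta>, each of which the discrete
  convolution with the Dirichlet kernel reproduces.\<close>

lemma ridge_kernel_discrete:
  assumes mu: "\<mu> \<ge> 0" and ex: "exact_nodes k N \<xi>"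
  shows "ridge_kernel \<mu> k \<eta> = (\<lambda>p. \<Sum>\<nu><N. (D_angle \<mu> k (\<xi> \<nu>) (cos \<eta>, sin \<eta>) / real N) * ridge_kernel \<mu> k (\<xi> \<nu>) p)"
    (is "?L = ?R")
proof -
  have N: "N > 0" using ex by (simp add: exact_nodes_def)
  let ?C = "gegenbauer (\<mu> + 1/2) k"
  obtain c where c: "\<And>\<phi>. complex_of_real (poly ?C (cos \<phi>)) = (\<Sum>m\<le>k. c m * cis ((real k - 2 * real m) * \<phi>))"
    using gegenbauer_cos_in_exponentials[OF mu] by blast
  have C: "poly ?C (cos (\<eta> - \<zeta>)) = (\<Sum>\<nu><N. D_angle \<mu> k (\<xi> \<nu>) (cos \<eta>, sin \<eta>) / real N * poly ?C (cos (\<xi> \<nu> - \<zeta>)))" for \<zeta>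
  proof -
    have "complex_of_real (\<Sum>\<nu><N. D_angle \<mu> k (\<xi> \<nu>) (cos \<eta>, sin \<eta>) * poly ?C (cos (\<xi> \<nu> - \<zeta>))) =
      (\<Sum>\<nu><N. \<Sum>m\<le>k. c m * (cis ((real k - 2 * real m) * (\<xi> \<nu> - \<zeta>)) * dirichlet k (\<xi> \<nu> - \<eta>)))"
      unfolding of_real_sum of_real_mult D_angle_circle[OF mu] c sum_distrib_left by (simp add: mult_ac)
    also have "\<dots> = (\<Sum>m\<le>k. c m * (\<Sum>\<nu><N. cis ((real k - 2 * real m) * (\<xi> \<nu> - \<zeta>)) * dirichlet k (\<xi> \<nu> - \<eta>)))"
      unfolding sum_distrib_left by (rule sum.swap)
    also have "\<dots> = (\<Sum>m\<le>k. c m * (of_nat N * cis ((real k - 2 * real m) * (\<eta> - \<zeta>))))"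
      by (intro sum.cong refl) (simp add: exact_nodes_dirichlet[OF ex])
    also have "\<dots> = complex_of_real (real N * poly ?C (cos (\<eta> - \<zeta>)))"
      unfolding of_real_mult c sum_distrib_left by (simp add: mult_ac)
    finally have "(\<Sum>\<nu><N. D_angle \<mu> k (\<xi> \<nu>) (cos \<eta>, sin \<eta>) * poly ?C (cos (\<xi> \<nu> - \<zeta>))) = real N * poly ?C (cos (\<eta> - \<zeta>))"
      by (simp only: of_real_eq_iff)
    then show ?thesis using N by (simp flip: sum_divide_distrib add: field_simps)
  qed
  have R: "?R \<in> orth_polys \<mu> k"
    by (intro orth_polys_sum orth_polys_cmult ridge_kernel_in_orth_polys mu)
  have "(\<lambda>p. ?L p - ?R p) = (\<lambda>_. 0)"
  proof (rule orth_polys_circle_eq_0[OF mu])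
    show "(\<lambda>p. ?L p - ?R p) \<in> orth_polys \<mu> k"
      by (intro orth_polys_diff ridge_kernel_in_orth_polys R mu)
    show "?L (cos \<zeta>, sin \<zeta>) - ?R (cos \<zeta>, sin \<zeta>) = 0" for \<zeta>
      unfolding ridge_kernel_circle C[of \<zeta>] by (simp add: sum_distrib_left mult_ac)
  qed
  then show ?thesis by (metis (no_types, lifting) eq_iff_diff_eq_0 ext)
qed

text \<open>Pairing P with the expansion in \<open>ridge_kernel_discrete\<close> turns every ridge
  kernel into a value of P, which proves the equality on the circle.\<close>

lemma orth_polys_discrete:
  assumes mu: "\<mu> \<ge> 0" and ex: "exact_nodes k N \<xi>" and P: "P \<in> orth_polys \<mu> k"
  shows "P = (\<lambda>p. \<Sum>\<nu><N. (P (cos (\<xi> \<nu>), sin (\<xi> \<nu>)) / real N) * D_angle \<mu> k (\<xi> \<nu>) p)" (is "_ = ?R")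
proof -
  have dP: "disk_integrable \<mu> P"
    using P by (intro disk_integrable_polys_below[OF mu, of _ "Suc k"]) (simp add: orth_polys_iff[OF mu])
  have "(\<lambda>p. P p - ?R p) = (\<lambda>_. 0)"
  proof (rule orth_polys_circle_eq_0[OF mu])
    show "(\<lambda>p. P p - ?R p) \<in> orth_polys \<mu> k"
      by (intro orth_polys_diff orth_polys_sum orth_polys_cmult D_angle_in_orth_polys P mu)
    fix \<eta>
    have "P (cos \<eta>, sin \<eta>) = disk_inner \<mu> P (ridge_kernel \<mu> k \<eta>)"
      by (rule ridge_kernel_reproducing[OF mu P, symmetric])
    also have "\<dots> = disk_inner \<mu> P (\<lambda>p. \<Sum>\<nu><N. (D_angle \<mu> k (\<xi> \<nu>) (cos \<eta>, sin \<eta>) / real N) * ridge_kernel \<mu> k (\<xi> \<nu>) p)"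
      by (subst ridge_kernel_discrete[OF mu ex]) simp
    also have "\<dots> = (\<Sum>\<nu><N. (D_angle \<mu> k (\<xi> \<nu>) (cos \<eta>, sin \<eta>) / real N) * disk_inner \<mu> P (ridge_kernel \<mu> k (\<xi> \<nu>)))"
      by (rule disk_inner_lincomb_right[OF dP ridge_kernel_polys_below[OF mu]])
    also have "\<dots> = ?R (cos \<eta>, sin \<eta>)"
      unfolding ridge_kernel_reproducing[OF mu P] by (simp add: mult_ac)
    finally show "P (cos \<eta>, sin \<eta>) - ?R (cos \<eta>, sin \<eta>) = 0" by simp
  qed
  then show ?thesis by (metis (no_types, lifting) eq_iff_diff_eq_0 ext)
qed

text \<open>\<open>orth_polys_discrete\<close> expands in the D with coefficients from pairing with
  K. Its transpose, tested against all R in the space, expands Q in the K instead, so that f meets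
  ridge kernels and thus only its Radon projections.\<close>

lemma disk_inner_discrete:
  assumes mu: "\<mu> \<ge> 0" and ex: "exact_nodes k N \<xi>" and f: "disk_integrable \<mu> f" and Q: "Q \<in> orth_polys \<mu> k"
  shows "disk_inner \<mu> f Q = (\<Sum>\<nu><N. disk_inner \<mu> Q (D_angle \<mu> k (\<xi> \<nu>)) / real N * disk_inner \<mu> f (ridge_kernel \<mu> k (\<xi> \<nu>)))"
proof -
  have Vp: "R \<in> polys_below (Suc k)" if "R \<in> orth_polys \<mu> k" for R
    using that by (simp add: orth_polys_iff[OF mu])
  let ?S = "\<lambda>p. \<Sum>\<nu><N. disk_inner \<mu> Q (D_angle \<mu> k (\<xi> \<nu>)) / real N * ridge_kernel \<mu> k (\<xi> \<nu>) p"
  have "Q = ?S"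
  proof (rule orth_polys_eqI[OF mu Q])
    show "?S \<in> orth_polys \<mu> k"
      by (intro orth_polys_sum orth_polys_cmult ridge_kernel_in_orth_polys mu)
    fix R assume R: "R \<in> orth_polys \<mu> k"
    have dQ: "disk_integrable \<mu> Q" and dR: "disk_integrable \<mu> R"
      using disk_integrable_polys_below[OF mu Vp] Q R by auto
    have "disk_inner \<mu> ?S R = disk_inner \<mu> R ?S" by (rule disk_inner_commute)
    also have "\<dots> = (\<Sum>\<nu><N. disk_inner \<mu> Q (D_angle \<mu> k (\<xi> \<nu>)) / real N * R (cos (\<xi> \<nu>), sin (\<xi> \<nu>)))"
      unfolding disk_inner_lincomb_right[OF dR ridge_kernel_polys_below[OF mu]] ridge_kernel_reproducing[OF mu R] ..
    also have "\<dots> = disk_inner \<mu> Q (\<lambda>p. \<Sum>\<nu><N. (R (cos (\<xi> \<nu>), sin (\<xi> \<nu>)) / real N) * D_angle \<mu> k (\<xi> \<nu>) p)"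
      unfolding disk_inner_lincomb_right[OF dQ Vp[OF D_angle_in_orth_polys[OF mu]]] by (simp add: mult_ac)
    also have "\<dots> = disk_inner \<mu> Q R"
      by (subst (2) orth_polys_discrete[OF mu ex R]) simp
    finally show "disk_inner \<mu> Q R = disk_inner \<mu> ?S R" ..
  qed
  then have "disk_inner \<mu> f Q = disk_inner \<mu> f ?S" by simp
  also have "\<dots> = (\<Sum>\<nu><N. disk_inner \<mu> Q (D_angle \<mu> k (\<xi> \<nu>)) / real N * disk_inner \<mu> f (ridge_kernel \<mu> k (\<xi> \<nu>)))"
    by (rule disk_inner_lincomb_right[OF f ridge_kernel_polys_below[OF mu]])
  finally show ?thesis .
qed

text \<open>The expansion of the pairing of f with Q is, read from the other side, the pairing of
  \<open>?P\<close> with Q. So \<open>?P\<close> satisfies the description, and definiteness on the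
  space makes it the only candidate.\<close>

lemma disk_proj_discrete:
  assumes mu: "\<mu> \<ge> 0" and ex: "exact_nodes k N \<xi>" and f: "disk_integrable \<mu> f"
  shows "disk_proj \<mu> k f = (\<lambda>p. \<Sum>\<nu><N. disk_inner \<mu> f (ridge_kernel \<mu> k (\<xi> \<nu>)) / real N * D_angle \<mu> k (\<xi> \<nu>) p)" (is "_ = ?P")
  unfolding disk_proj_def
proof (rule the_equality)
  have Vp: "R \<in> polys_below (Suc k)" if "R \<in> orth_polys \<mu> k" for R
    using that by (simp add: orth_polys_iff[OF mu])
  have dV: "disk_integrable \<mu> R" if "R \<in> orth_polys \<mu> k" for R
    using disk_integrable_polys_below[OF mu Vp[OF that]] .
  have P: "?P \<in> orth_polys \<mu> k"
    by (intro orth_polys_sum orth_polys_cmult D_angle_in_orth_polys mu)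
  have PQ: "disk_inner \<mu> ?P Q = disk_inner \<mu> f Q" if Q: "Q \<in> orth_polys \<mu> k" for Q
  proof -
    have "disk_inner \<mu> ?P Q = disk_inner \<mu> Q ?P" by (rule disk_inner_commute)
    also have "\<dots> = disk_inner \<mu> f Q"
      unfolding disk_inner_discrete[OF mu ex f Q] disk_inner_lincomb_right[OF dV[OF Q] Vp[OF D_angle_in_orth_polys[OF mu]]]
      by (simp add: mult_ac)
    finally show ?thesis .
  qed
  show "?P \<in> orth_polys \<mu> k \<and> (\<forall>Q\<in>orth_polys \<mu> k. disk_inner \<mu> (\<lambda>p. f p - ?P p) Q = 0)"
  proof (intro conjI ballI P)
    fix Q assume Q: "Q \<in> orth_polys \<mu> k"
    show "disk_inner \<mu> (\<lambda>p. f p - ?P p) Q = 0"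
      unfolding disk_inner_diff_left[OF f dV[OF P] Vp[OF Q]] PQ[OF Q] by simp
  qed
  fix R assume R: "R \<in> orth_polys \<mu> k \<and> (\<forall>Q\<in>orth_polys \<mu> k. disk_inner \<mu> (\<lambda>p. f p - R p) Q = 0)"
  show "R = ?P"
  proof (rule orth_polys_eqI[OF mu _ P])
    fix Q assume Q: "Q \<in> orth_polys \<mu> k"
    then show "disk_inner \<mu> R Q = disk_inner \<mu> ?P Q"
      using R PQ[OF Q] disk_inner_diff_left[OF f dV Vp[OF Q], of R] by simp
  qed (use R in simp)
qed

text \<open>The sum is geometric with ratio w = cis (2 pi a / (n + 1)). As 0 < |a| <= k <= n, the
  number n + 1 does not divide a and w is not 1, while w^(n + 1) = 1. The factor c counts half
  circles: c = 1 and c = 2 give the two sums of the theorem, and c > 0 says that there are nodes at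
  all.\<close>

lemma exact_nodes_node:
  assumes "k \<le> n"
  shows "exact_nodes k (c * (n + 1)) (node n) \<longleftrightarrow> c > 0"
proof -
  have "(\<Sum>\<nu><c * (n + 1). cis (2 * of_int a * node n \<nu>)) = 0" if a: "a \<noteq> 0" "\<bar>a\<bar> \<le> int k" for a
  proof -
    define w where "w = cis (2 * pi * (of_int a / (real n + 1)))"
    have "cis (2 * of_int a * node n \<nu>) = w ^ \<nu>" for \<nu>
      by (simp only: w_def Complex.DeMoivre node_def) (simp add: mult_ac)
    moreover have "w \<noteq> 1"
    proof
      assume "w = 1"
      then have "cos (2 * pi * (of_int a / (real n + 1))) = 1" by (simp add: w_def complex_eq_iff)
      then obtain m :: int where "2 * pi * (of_int a / (real n + 1)) = of_int m * 2 * pi"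
        by (auto simp: cos_one_2pi_int)
      then have "2 * pi * (of_int a / (real n + 1)) = 2 * pi * of_int m" by (simp only: mult_ac)
      then have "of_int a / (real n + 1) = of_int m"
        unfolding mult_cancel_left using pi_gt_zero by auto
      then have "real_of_int a = of_int m * (real n + 1)" by (simp add: nonzero_divide_eq_eq)
      then have "real_of_int a = of_int (m * (int n + 1))" by simp
      then have am: "a = m * (int n + 1)" unfolding of_int_eq_iff .
      then have "m \<noteq> 0" using a by auto
      then have "1 * (int n + 1) \<le> \<bar>m\<bar> * (int n + 1)" by (intro mult_right_mono) auto
      also have "\<dots> = \<bar>a\<bar>" by (simp add: am abs_mult)
      finally show False using a assms by simp
    qed
    moreover have "w ^ (c * (n + 1)) = 1"
    proof -
      have "w ^ (n + 1) = cis (2 * pi * of_int a)"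
        by (simp only: w_def Complex.DeMoivre) (simp add: add.commute)
      also have "\<dots> = 1" by (simp add: cis_multiple_2pi)
      finally show ?thesis by (simp only: mult.commute[of c] power_mult power_one)
    qed
    ultimately show ?thesis by (simp add: geometric_sum)
  qed
  then show ?thesis by (auto simp: exact_nodes_def)
qed

theorem theorem2p8:
  fixes \<mu> :: real and n k :: nat and f :: "real \<times> real \<Rightarrow> real" and x y :: real
  assumes "\<mu> \<ge> 0" and "k \<le> n"
    and "f \<in> L2_disk \<mu>" and "(x, y) \<in> unit_disk"
  shows "disk_proj \<mu> k f (x, y) =
      1 / (real n + 1) * (\<Sum>\<nu> = 0..n. disk_const \<mu> *
        (LINT t|lebesgue_on {-1..1}. radon \<mu> (node n \<nu>) f t * D_kernel \<mu> k (node n \<nu>) t (x, y))) \<and>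
    disk_proj \<mu> k f (x, y) =
      1 / (2 * real n + 2) * (\<Sum>\<nu> = 0..2 * n + 1. disk_const \<mu> *
        (LINT t|lebesgue_on {-1..1}. radon \<mu> (node n \<nu>) f t * D_kernel \<mu> k (node n \<nu>) t (x, y)))"
proof -
  have f: "disk_integrable \<mu> f" using assms by (intro integrable_L2_disk)
  have summand: "disk_const \<mu> * (LINT t|lebesgue_on {-1..1}. radon \<mu> \<xi> f t * D_kernel \<mu> k \<xi> t (x, y)) =
     disk_inner \<mu> f (ridge_kernel \<mu> k \<xi>) * D_angle \<mu> k \<xi> (x, y)" for \<xi>
  proof -
    have "(\<lambda>t. radon \<mu> \<xi> f t * D_kernel \<mu> k \<xi> t (x, y)) =
       (\<lambda>t. ((real k + \<mu> + 1/2) / (\<mu> + 1/2) * D_angle \<mu> k \<xi> (x, y)) * (radon \<mu> \<xi> f t * poly (gegenbauer (\<mu> + 1/2) k) t))"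
      by (simp add: D_kernel_def mult_ac)
    then show ?thesis
      unfolding disk_inner_ridge_kernel[OF f] by (simp only: integral_mult_right_zero) (simp only: mult_ac)
  qed
  have gen: "disk_proj \<mu> k f (x, y) = 1 / real N * (\<Sum>\<nu><N. disk_const \<mu> *
        (LINT t|lebesgue_on {-1..1}. radon \<mu> (node n \<nu>) f t * D_kernel \<mu> k (node n \<nu>) t (x, y)))"
    if "exact_nodes k N (node n)" for N
    unfolding disk_proj_discrete[OF assms(1) that f] summand by (simp add: sum_distrib_left)
  show ?thesis
    using gen[of "n + 1"] gen[of "2 * n + 2"] exact_nodes_node[OF assms(2), of 1] exact_nodes_node[OF assms(2), of 2]
    by (simp add: lessThan_Suc_atMost atMost_atLeast0 add.commute)
qed

end
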